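(* The category $\mathbf{SinCat}_\omega$ of single-set cubical $\omega$-categories (with their morphisms) is equivalent to the category $\mathbf{CubCat}_\omega$ of classical cubical $\omega$-categories (with their functors).
   Context: A single-set category $(\mathcal{S},\delta^-,\delta^+,\odot)$ is a set $\mathcal{S}$ with maps $\delta^-,\delta^+:\mathcal{S}\to\mathcal{S}$ and a map $\odot:\mathcal{S}\times\mathcal{S}\to\mathcal{P}(\mathcal{S})$ (extended to subsets by $X\odot Y=\bigcup_{x\in X,y\in Y}x\odot y$) such that for all $x,y,z$: $\{x\}\odot(y\odot z)=(x\odot y)\odot\{z\}$; $x\odot\delta^+x=\{x\}$ and $\delta^-x\odot x=\{x\}$; $x\odot y\neq\varnothing\iff\delta^+x=\delta^-y$; and $x\odot y$ has at most one element. Write $\Delta(x,y)$ when $x\odot y\neq\varnothing$, and then $x\circ y$ for its unique element. A single-set cubical $\omega$-category is a set $\mathcal{S}$ with, for each $i\in\mathbb{N}_+=\{1,2,\dots\}$, a single-set category structure $(\mathcal{S},\delta_i^-,\delta_i^+,\odot_i)$ (with associated $\Delta_i$, $\circ_i$) and maps $s_i,\tilde s_i:\mathcal{S}\to\mathcal{S}$. Let $\mathcal{S}^i$ be the set of fixed points of $\delta_i^-$ (equivalently of $\delta_i^+$), $\mathcal{S}^{i_1,\dots,i_k}=\bigcap_l\mathcal{S}^{i_l}$, and $\mathcal{S}^{>n}=\bigcap_{i>n}\mathcal{S}^i$. Required, for all $w,x,y,z\in\mathcal{S}$, $i,j\in\mathbb{N}_+$, $\alpha,\beta\in\{-,+\}$: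 (1) $\delta_i^\alpha\delta_j^\beta=\delta_j^\beta\delta_i^\alpha$ if $i\neq j$; (2) $\delta_i^\alpha(x\circ_j y)=\delta_i^\alpha x\circ_j\delta_i^\alpha y$ if $i\neq j$ and $\Delta_j(x,y)$; (3) $(w\circ_i x)\circ_j(y\circ_i z)=(w\circ_j y)\circ_i(x\circ_j z)$ if $i\neq j$, $\Delta_i(w,x)$, $\Delta_i(y,z)$, $\Delta_j(w,y)$, $\Delta_j(x,z)$; (4) $s_i(\mathcal{S}^i)\subseteq\mathcal{S}^{i+1}$ and $\tilde s_i(\mathcal{S}^{i+1})\subseteq\mathcal{S}^i$; (5) $\tilde s_is_ix=x$ for $x\in\mathcal{S}^i$ and $s_i\tilde s_iy=y$ for $y\in\mathcal{S}^{i+1}$; (6) for $x\in\mathcal{S}^j$: $\delta_j^\alpha s_jx=s_j\delta_{j+1}^\alpha x$, and $\delta_i^\alpha s_jx=s_j\delta_i^\alpha x$ if $i\neq j,j+1$; (7) for $x,y\in\mathcal{S}^i$: $s_i(x\circ_{i+1}y)=s_ix\circ_is_iy$ if $\Delta_{i+1}(x,y)$, and $s_i(x\circ_jy)=s_ix\circ_js_iy$ if $j\neq i,i+1$ and $\Delta_j(x,y)$; (8) $s_ix=x$ if $x\in\mathcal{S}^i\cap\mathcal{S}^{i+1}$; (9) $s_is_jx=s_js_ix$ if $|i-j|\geq2$ and $x\in\mathcal{S}^i\cap\mathcal{S}^j$; (10) for every $x$ there is $k\in\mathbb{N}$ with $x\in\mathcal{S}^i$ for all $i\geq k+1$. A morphism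 $f:\mathcal{S}\to\mathcal{S}'$ is a map with $f\delta_i^\alpha={\delta'}_i^\alpha f$, $f(x\circ_iy)=f(x)\circ'_if(y)$ whenever $\Delta_i(x,y)$, and $fs_ix=s'_ifx$ for $x\in\mathcal{S}^i$, for all $i$. These form $\mathbf{SinCat}_\omega$. A classical cubical $\omega$-category is a family $(\mathcal{C}_n)_{n\in\mathbb{N}}$ of sets with maps $\partial_{n,i}^\alpha:\mathcal{C}_n\to\mathcal{C}_{n-1}$, $\epsilon_{n,i}:\mathcal{C}_{n-1}\to\mathcal{C}_n$ and partial compositions $\star_{n,i}$ defined on pairs $(a,b)\in\mathcal{C}_n^2$ with $\partial_{n,i}^+a=\partial_{n,i}^-b$, for $1\leq i\leq n$, such that (for indices in range): (i) $a\star_{n,i}(b\star_{n,i}c)=(a\star_{n,i}b)\star_{n,i}c$ if either side is defined; (ii) $a\star_{n,i}\epsilon_{n,i}\partial_{n,i}^+a=\epsilon_{n,i}\partial_{n,i}^-a\star_{n,i}a=a$; (iii) $\partial_{n-1,i}^\alpha\partial_{n,j}^\beta=\partial_{n-1,j-1}^\beta\partial_{n,i}^\alpha$ if $i<j$; (iv) for $\star_{n,j}$-composable $a,b$: $\partial_{n,i}^\alpha(a\star_{n,j}b)$ equals $\partial_{n,i}^\alpha a\star_{n,j-1}\partial_{n,i}^\alpha b$ if $i<j$, $\partial_{n,i}^-a$ if $i=j,\alpha=-$, $\partial_{n,i}^+b$ if $i=j,\alpha=+$, and $\partial_{n,i}^\alpha a\star_{n,j}\partial_{n,i}^\alpha b$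 if $i>j$; (v) $(a\star_{n,i}b)\star_{n,j}(c\star_{n,i}d)=(a\star_{n,j}c)\star_{n,i}(b\star_{n,j}d)$ whenever $a,b$ and $c,d$ are $\star_{n,i}$-composable and $a,c$ and $b,d$ are $\star_{n,j}$-composable; (vi) $\partial_{n,i}^\alpha\epsilon_{n,j}$ equals $\epsilon_{n-1,j-1}\partial_{n-1,i}^\alpha$ if $i<j$, $\mathrm{id}$ if $i=j$, $\epsilon_{n-1,j}\partial_{n-1,i-1}^\alpha$ if $i>j$; (vii) for $\star_{n,j}$-composable $a,b$: $\epsilon_{n+1,i}(a\star_{n,j}b)=\epsilon_{n+1,i}a\star_{n+1,j+1}\epsilon_{n+1,i}b$ if $i\leq j$, and $=\epsilon_{n+1,i}a\star_{n+1,j}\epsilon_{n+1,i}b$ if $i>j$; (viii) $\epsilon_{n+1,i}\epsilon_{n,j}=\epsilon_{n+1,j+1}\epsilon_{n,i}$ if $i\leq j$. A functor $F$ is a family $F_n:\mathcal{C}_n\to\mathcal{D}_n$ with $F_{n-1}\partial_{n,i}^\alpha=\partial_{n,i}^\alpha F_n$, $F_n(a\star_{n,i}b)=F_na\star_{n,i}F_nb$ for composable $a,b$, and $F_n\epsilon_{n,i}=\epsilon_{n,i}F_{n-1}$. These form $\mathbf{CubCat}_\omega$.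
   Formalization: In the classical axioms, interchange (v) is required only for distinct directions i≠j (for i=j its sides need not be defined), and in (iv) the composites of faces are taken in dimension n−1; all sets are subsets of an arbitrary infinite universe. *)

theory Defs
  imports Main "HOL-Library.FuncSet"
begin

section \<open>Categories, functors, equivalence\<close>

text \<open>
  Categories are given by families of hom-sets, which need not be disjoint.
  Composition therefore takes the three objects involved as arguments:
  \<open>Comp \<C> A B D g f\<close> is the composite of \<open>f : A \<rightarrow> B\<close> and \<open>g : B \<rightarrow> D\<close>.
\<close>

record ('o, 'm) cat =
  Obj :: "'o set"
  Hom :: "'o \<Rightarrow> 'o \<Rightarrow> 'm set"
  Ident :: "'o \<Rightarrow> 'm"
  Comp :: "'o \<Rightarrow> 'o \<Rightarrow> 'o \<Rightarrow> 'm \<Rightarrow> 'm \<Rightarrow> 'm"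

locale category =
  fixes \<C> :: "('o, 'm) cat"
  assumes ident_in_hom: "A \<in> Obj \<C> \<Longrightarrow> Ident \<C> A \<in> Hom \<C> A A"
    and comp_in_hom:
      "\<lbrakk>A \<in> Obj \<C>; B \<in> Obj \<C>; D \<in> Obj \<C>; f \<in> Hom \<C> A B; g \<in> Hom \<C> B D\<rbrakk>
        \<Longrightarrow> Comp \<C> A B D g f \<in> Hom \<C> A D"
    and comp_ident_right:
      "\<lbrakk>A \<in> Obj \<C>; B \<in> Obj \<C>; f \<in> Hom \<C> A B\<rbrakk> \<Longrightarrow> Comp \<C> A A B f (Ident \<C> A) = f"
    and comp_ident_left:
      "\<lbrakk>A \<in> Obj \<C>; B \<in> Obj \<C>; f \<in> Hom \<C> A B\<rbrakk> \<Longrightarrow> Comp \<C> A B B (Ident \<C> B) f = f"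
    and comp_assoc:
      "\<lbrakk>A \<in> Obj \<C>; B \<in> Obj \<C>; D \<in> Obj \<C>; E \<in> Obj \<C>;
        f \<in> Hom \<C> A B; g \<in> Hom \<C> B D; h \<in> Hom \<C> D E\<rbrakk>
        \<Longrightarrow> Comp \<C> A D E h (Comp \<C> A B D g f) = Comp \<C> A B E (Comp \<C> B D E h g) f"

definition is_iso :: "('o, 'm) cat \<Rightarrow> 'o \<Rightarrow> 'o \<Rightarrow> 'm \<Rightarrow> bool" where
  "is_iso \<C> A B f \<longleftrightarrow> f \<in> Hom \<C> A B \<and>
    (\<exists>g \<in> Hom \<C> B A. Comp \<C> A B A g f = Ident \<C> A \<and> Comp \<C> B A B f g = Ident \<C> B)"

record ('o, 'm, 'p, 'n) functor_data =
  fobj :: "'o \<Rightarrow> 'p"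
  fmap :: "'o \<Rightarrow> 'o \<Rightarrow> 'm \<Rightarrow> 'n"

definition is_functor ::
  "('o, 'm) cat \<Rightarrow> ('p, 'n) cat \<Rightarrow> ('o, 'm, 'p, 'n) functor_data \<Rightarrow> bool" where
  "is_functor \<C> \<D> F \<longleftrightarrow>
    (\<forall>A \<in> Obj \<C>. fobj F A \<in> Obj \<D>) \<and>
    (\<forall>A \<in> Obj \<C>. \<forall>B \<in> Obj \<C>. \<forall>f \<in> Hom \<C> A B.
        fmap F A B f \<in> Hom \<D> (fobj F A) (fobj F B)) \<and>
    (\<forall>A \<in> Obj \<C>. fmap F A A (Ident \<C> A) = Ident \<D> (fobj F A)) \<and>
    (\<forall>A \<in> Obj \<C>. \<forall>B \<in> Obj \<C>. \<forall>D \<in> Obj \<C>. \<forall>f \<in> Hom \<C> A B. \<forall>g \<in> Hom \<C> B D.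
        fmap F A D (Comp \<C> A B D g f) =
          Comp \<D> (fobj F A) (fobj F B) (fobj F D) (fmap F B D g) (fmap F A B f))"

definition id_functor :: "('o, 'm, 'o, 'm) functor_data" where
  "id_functor = \<lparr>fobj = (\<lambda>A. A), fmap = (\<lambda>A B f. f)\<rparr>"

definition comp_functor ::
  "('p, 'n, 'q, 'l) functor_data \<Rightarrow> ('o, 'm, 'p, 'n) functor_data
    \<Rightarrow> ('o, 'm, 'q, 'l) functor_data" where
  "comp_functor G F =
    \<lparr>fobj = (\<lambda>A. fobj G (fobj F A)),
     fmap = (\<lambda>A B f. fmap G (fobj F A) (fobj F B) (fmap F A B f))\<rparr>"

definition is_nat_iso ::
  "('o, 'm) cat \<Rightarrow> ('p, 'n) cat \<Rightarrow> ('o, 'm, 'p, 'n) functor_data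
    \<Rightarrow> ('o, 'm, 'p, 'n) functor_data \<Rightarrow> ('o \<Rightarrow> 'n) \<Rightarrow> bool" where
  "is_nat_iso \<C> \<D> F G \<eta> \<longleftrightarrow>
    (\<forall>A \<in> Obj \<C>. is_iso \<D> (fobj F A) (fobj G A) (\<eta> A)) \<and>
    (\<forall>A \<in> Obj \<C>. \<forall>B \<in> Obj \<C>. \<forall>f \<in> Hom \<C> A B.
        Comp \<D> (fobj F A) (fobj F B) (fobj G B) (\<eta> B) (fmap F A B f) =
        Comp \<D> (fobj F A) (fobj G A) (fobj G B) (fmap G A B f) (\<eta> A))"

definition equivalent_categories :: "('o, 'm) cat \<Rightarrow> ('p, 'n) cat \<Rightarrow> bool" where
  "equivalent_categories \<C> \<D> \<longleftrightarrow> category \<C> \<and> category \<D> \<and>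
    (\<exists>F G \<eta> \<epsilon>. is_functor \<C> \<D> F \<and> is_functor \<D> \<C> G \<and>
       is_nat_iso \<C> \<C> id_functor (comp_functor G F) \<eta> \<and>
       is_nat_iso \<D> \<D> (comp_functor F G) id_functor \<epsilon>)"

section \<open>Single-set cubical omega-categories\<close>

datatype sign = Minus | Plus

definition set_ext :: "('a \<Rightarrow> 'a \<Rightarrow> 'a set) \<Rightarrow> 'a set \<Rightarrow> 'a set \<Rightarrow> 'a set" where
  "set_ext m X Y = (\<Union>x \<in> X. \<Union>y \<in> Y. m x y)"

locale single_set_category =
  fixes S :: "'a set" and \<delta> :: "sign \<Rightarrow> 'a \<Rightarrow> 'a" and m :: "'a \<Rightarrow> 'a \<Rightarrow> 'a set"
  assumes bd_closed: "x \<in> S \<Longrightarrow> \<delta> \<alpha> x \<in> S"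
    and mul_closed: "\<lbrakk>x \<in> S; y \<in> S\<rbrakk> \<Longrightarrow> m x y \<subseteq> S"
    and mul_assoc:
      "\<lbrakk>x \<in> S; y \<in> S; z \<in> S\<rbrakk> \<Longrightarrow> set_ext m {x} (m y z) = set_ext m (m x y) {z}"
    and mul_bd_right: "x \<in> S \<Longrightarrow> m x (\<delta> Plus x) = {x}"
    and mul_bd_left: "x \<in> S \<Longrightarrow> m (\<delta> Minus x) x = {x}"
    and mul_nonempty_iff: "\<lbrakk>x \<in> S; y \<in> S\<rbrakk> \<Longrightarrow> m x y \<noteq> {} \<longleftrightarrow> \<delta> Plus x = \<delta> Minus y"
    and mul_functional: "\<lbrakk>x \<in> S; y \<in> S; u \<in> m x y; v \<in> m x y\<rbrakk> \<Longrightarrow> u = v"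

text \<open>
  The fields \<open>bd\<close>, \<open>mul\<close>, \<open>sy\<close>, \<open>rsy\<close> are the families of boundary maps, multioperations,
  symmetries and reverse symmetries.  Directions are the positive natural numbers.
\<close>

record 'a sincub =
  cells :: "'a set"
  bd :: "nat \<Rightarrow> sign \<Rightarrow> 'a \<Rightarrow> 'a"
  mul :: "nat \<Rightarrow> 'a \<Rightarrow> 'a \<Rightarrow> 'a set"
  sy :: "nat \<Rightarrow> 'a \<Rightarrow> 'a"
  rsy :: "nat \<Rightarrow> 'a \<Rightarrow> 'a"

definition composable :: "'a sincub \<Rightarrow> nat \<Rightarrow> 'a \<Rightarrow> 'a \<Rightarrow> bool" where
  "composable S i x y \<longleftrightarrow> mul S i x y \<noteq> {}"

definition circ :: "'a sincub \<Rightarrow> nat \<Rightarrow> 'a \<Rightarrow> 'a \<Rightarrow> 'a" where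
  "circ S i x y = the_elem (mul S i x y)"

definition fix_cells :: "'a sincub \<Rightarrow> nat \<Rightarrow> 'a set" where
  "fix_cells S i = {x \<in> cells S. bd S i Minus x = x}"

text \<open>
  The four \<open>_type\<close> assumptions say that the operations are defined on \<open>cells S\<close> and positive
  directions only, being \<open>undefined\<close> elsewhere, so that two objects are equal as soon as they
  have the same cells and the same operations on them.  In the equations below, the
  composites on the right-hand sides are defined as a consequence of the other axioms.
\<close>

locale single_set_cubical_omega_category =
  fixes S :: "'a sincub"
  assumes bd_type: "bd S \<in> {1..} \<rightarrow>\<^sub>E (UNIV \<rightarrow> (cells S \<rightarrow>\<^sub>E cells S))"
    and mul_type: "mul S \<in> {1..} \<rightarrow>\<^sub>E (cells S \<rightarrow>\<^sub>E (cells S \<rightarrow>\<^sub>E Pow (cells S)))"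
    and sy_type: "sy S \<in> {1..} \<rightarrow>\<^sub>E (cells S \<rightarrow>\<^sub>E cells S)"
    and rsy_type: "rsy S \<in> {1..} \<rightarrow>\<^sub>E (cells S \<rightarrow>\<^sub>E cells S)"
    and direction_category: "i \<ge> 1 \<Longrightarrow> single_set_category (cells S) (bd S i) (mul S i)"
    and bd_bd: "\<lbrakk>i \<ge> 1; j \<ge> 1; i \<noteq> j; x \<in> cells S\<rbrakk>
      \<Longrightarrow> bd S i \<alpha> (bd S j \<beta> x) = bd S j \<beta> (bd S i \<alpha> x)"
    and bd_circ: "\<lbrakk>i \<ge> 1; j \<ge> 1; i \<noteq> j; x \<in> cells S; y \<in> cells S; composable S j x y\<rbrakk>
      \<Longrightarrow> bd S i \<alpha> (circ S j x y) = circ S j (bd S i \<alpha> x) (bd S i \<alpha> y)"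
    and interchange: "\<lbrakk>i \<ge> 1; j \<ge> 1; i \<noteq> j;
        w \<in> cells S; x \<in> cells S; y \<in> cells S; z \<in> cells S;
        composable S i w x; composable S i y z; composable S j w y; composable S j x z\<rbrakk>
      \<Longrightarrow> circ S j (circ S i w x) (circ S i y z) = circ S i (circ S j w y) (circ S j x z)"
    and sy_image: "i \<ge> 1 \<Longrightarrow> sy S i ` fix_cells S i \<subseteq> fix_cells S (i + 1)"
    and rsy_image: "i \<ge> 1 \<Longrightarrow> rsy S i ` fix_cells S (i + 1) \<subseteq> fix_cells S i"
    and rsy_sy: "\<lbrakk>i \<ge> 1; x \<in> fix_cells S i\<rbrakk> \<Longrightarrow> rsy S i (sy S i x) = x"
    and sy_rsy: "\<lbrakk>i \<ge> 1; y \<in> fix_cells S (i + 1)\<rbrakk> \<Longrightarrow> sy S i (rsy S i y) = y"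
    and bd_sy_same: "\<lbrakk>j \<ge> 1; x \<in> fix_cells S j\<rbrakk>
      \<Longrightarrow> bd S j \<alpha> (sy S j x) = sy S j (bd S (j + 1) \<alpha> x)"
    and bd_sy_other: "\<lbrakk>i \<ge> 1; j \<ge> 1; i \<noteq> j; i \<noteq> j + 1; x \<in> fix_cells S j\<rbrakk>
      \<Longrightarrow> bd S i \<alpha> (sy S j x) = sy S j (bd S i \<alpha> x)"
    and sy_circ_next: "\<lbrakk>i \<ge> 1; x \<in> fix_cells S i; y \<in> fix_cells S i; composable S (i + 1) x y\<rbrakk>
      \<Longrightarrow> sy S i (circ S (i + 1) x y) = circ S i (sy S i x) (sy S i y)"
    and sy_circ_other: "\<lbrakk>i \<ge> 1; j \<ge> 1; j \<noteq> i; j \<noteq> i + 1;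
        x \<in> fix_cells S i; y \<in> fix_cells S i; composable S j x y\<rbrakk>
      \<Longrightarrow> sy S i (circ S j x y) = circ S j (sy S i x) (sy S i y)"
    and sy_fixed: "\<lbrakk>i \<ge> 1; x \<in> fix_cells S i \<inter> fix_cells S (i + 1)\<rbrakk> \<Longrightarrow> sy S i x = x"
    and sy_sy: "\<lbrakk>i \<ge> 1; j \<ge> 1; \<bar>int i - int j\<bar> \<ge> 2; x \<in> fix_cells S i \<inter> fix_cells S j\<rbrakk>
      \<Longrightarrow> sy S i (sy S j x) = sy S j (sy S i x)"
    and finite_dimensional: "x \<in> cells S \<Longrightarrow> \<exists>k. \<forall>i \<ge> k + 1. x \<in> fix_cells S i"

definition sin_hom :: "'a sincub \<Rightarrow> 'a sincub \<Rightarrow> ('a \<Rightarrow> 'a) set" where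
  "sin_hom S T = {f \<in> cells S \<rightarrow>\<^sub>E cells T.
     (\<forall>i \<ge> 1. \<forall>\<alpha>. \<forall>x \<in> cells S. f (bd S i \<alpha> x) = bd T i \<alpha> (f x)) \<and>
     (\<forall>i \<ge> 1. \<forall>x \<in> cells S. \<forall>y \<in> cells S.
        composable S i x y \<longrightarrow> f (circ S i x y) = circ T i (f x) (f y)) \<and>
     (\<forall>i \<ge> 1. \<forall>x \<in> fix_cells S i. f (sy S i x) = sy T i (f x))}"

text \<open>
  The type \<open>'a\<close> plays the role of the universe of small sets: the objects are all structures
  whose cells lie in \<open>'a\<close>.  When comparing with families \<open>(C\<^sub>n)\<close> of subsets of \<open>'a\<close>, the
  universe has to be closed under countable disjoint unions of such families, that is, infinite.
\<close>

definition SinCat :: "('a sincub, 'a \<Rightarrow> 'a) cat" where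
  "SinCat = \<lparr>Obj = {S. single_set_cubical_omega_category S},
     Hom = sin_hom,
     Ident = (\<lambda>S. restrict (\<lambda>x. x) (cells S)),
     Comp = (\<lambda>S T U g f. compose (cells S) g f)\<rparr>"

section \<open>Classical cubical omega-categories\<close>

text \<open>
  \<open>face C n i \<alpha> : C\<^sub>n \<rightarrow> C\<^sub>n\<^sub>-\<^sub>1\<close>, \<open>degen C n i : C\<^sub>n\<^sub>-\<^sub>1 \<rightarrow> C\<^sub>n\<close> and the partial composition
  \<open>star C n i\<close> on \<open>C\<^sub>n\<close> are relevant for \<open>1 \<le> i \<le> n\<close>.
\<close>

record 'a cubcat =
  ncells :: "nat \<Rightarrow> 'a set"
  face :: "nat \<Rightarrow> nat \<Rightarrow> sign \<Rightarrow> 'a \<Rightarrow> 'a"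
  degen :: "nat \<Rightarrow> nat \<Rightarrow> 'a \<Rightarrow> 'a"
  star :: "nat \<Rightarrow> nat \<Rightarrow> 'a \<Rightarrow> 'a \<Rightarrow> 'a"

definition star_dom :: "'a cubcat \<Rightarrow> nat \<Rightarrow> nat \<Rightarrow> 'a \<Rightarrow> 'a \<Rightarrow> bool" where
  "star_dom C n i a b \<longleftrightarrow>
    a \<in> ncells C n \<and> b \<in> ncells C n \<and> face C n i Plus a = face C n i Minus b"

text \<open>
  As above, the operations are \<open>undefined\<close> outside their domains.  In \<open>star_assoc\<close>,
  definedness of either side implies that of the other by \<open>face_star_minus\<close> and
  \<open>face_star_plus\<close>.  The interchange law is for distinct directions: for \<open>i = j\<close> the
  composability hypotheses do not make its two sides defined.
\<close>

locale classical_cubical_omega_category =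
  fixes C :: "'a cubcat"
  assumes face_type: "\<lbrakk>1 \<le> i; i \<le> n\<rbrakk> \<Longrightarrow> face C n i \<alpha> \<in> ncells C n \<rightarrow>\<^sub>E ncells C (n - 1)"
    and degen_type: "\<lbrakk>1 \<le> i; i \<le> n\<rbrakk> \<Longrightarrow> degen C n i \<in> ncells C (n - 1) \<rightarrow>\<^sub>E ncells C n"
    and star_closed: "\<lbrakk>1 \<le> i; i \<le> n; star_dom C n i a b\<rbrakk> \<Longrightarrow> star C n i a b \<in> ncells C n"
    and star_undefined: "\<lbrakk>1 \<le> i; i \<le> n; \<not> star_dom C n i a b\<rbrakk> \<Longrightarrow> star C n i a b = undefined"
    and out_of_range: "\<not> (1 \<le> i \<and> i \<le> n) \<Longrightarrow>
      face C n i = undefined \<and> degen C n i = undefined \<and> star C n i = undefined"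
    and star_assoc: "\<lbrakk>1 \<le> i; i \<le> n;
        (star_dom C n i b c \<and> star_dom C n i a (star C n i b c)) \<or>
        (star_dom C n i a b \<and> star_dom C n i (star C n i a b) c)\<rbrakk>
      \<Longrightarrow> star C n i a (star C n i b c) = star C n i (star C n i a b) c"
    and star_unit_right: "\<lbrakk>1 \<le> i; i \<le> n; a \<in> ncells C n\<rbrakk>
      \<Longrightarrow> star C n i a (degen C n i (face C n i Plus a)) = a"
    and star_unit_left: "\<lbrakk>1 \<le> i; i \<le> n; a \<in> ncells C n\<rbrakk>
      \<Longrightarrow> star C n i (degen C n i (face C n i Minus a)) a = a"
    and face_face: "\<lbrakk>1 \<le> i; i < j; j \<le> n; a \<in> ncells C n\<rbrakk>
      \<Longrightarrow> face C (n - 1) i \<alpha> (face C n j \<beta> a) = face C (n - 1) (j - 1) \<beta> (face C n i \<alpha> a)"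
    and face_star_less: "\<lbrakk>1 \<le> i; i < j; j \<le> n; star_dom C n j a b\<rbrakk>
      \<Longrightarrow> face C n i \<alpha> (star C n j a b) = star C (n - 1) (j - 1) (face C n i \<alpha> a) (face C n i \<alpha> b)"
    and face_star_minus: "\<lbrakk>1 \<le> i; i \<le> n; star_dom C n i a b\<rbrakk>
      \<Longrightarrow> face C n i Minus (star C n i a b) = face C n i Minus a"
    and face_star_plus: "\<lbrakk>1 \<le> i; i \<le> n; star_dom C n i a b\<rbrakk>
      \<Longrightarrow> face C n i Plus (star C n i a b) = face C n i Plus b"
    and face_star_greater: "\<lbrakk>1 \<le> j; j < i; i \<le> n; star_dom C n j a b\<rbrakk>
      \<Longrightarrow> face C n i \<alpha> (star C n j a b) = star C (n - 1) j (face C n i \<alpha> a) (face C n i \<alpha> b)"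
    and star_interchange: "\<lbrakk>1 \<le> i; i \<le> n; 1 \<le> j; j \<le> n; i \<noteq> j;
        star_dom C n i a b; star_dom C n i c d; star_dom C n j a c; star_dom C n j b d\<rbrakk>
      \<Longrightarrow> star C n j (star C n i a b) (star C n i c d) =
          star C n i (star C n j a c) (star C n j b d)"
    and face_degen_less: "\<lbrakk>1 \<le> i; i < j; j \<le> n; a \<in> ncells C (n - 1)\<rbrakk>
      \<Longrightarrow> face C n i \<alpha> (degen C n j a) = degen C (n - 1) (j - 1) (face C (n - 1) i \<alpha> a)"
    and face_degen_same: "\<lbrakk>1 \<le> i; i \<le> n; a \<in> ncells C (n - 1)\<rbrakk>
      \<Longrightarrow> face C n i \<alpha> (degen C n i a) = a"
    and face_degen_greater: "\<lbrakk>1 \<le> j; j < i; i \<le> n; a \<in> ncells C (n - 1)\<rbrakk>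
      \<Longrightarrow> face C n i \<alpha> (degen C n j a) = degen C (n - 1) j (face C (n - 1) (i - 1) \<alpha> a)"
    and degen_star_le: "\<lbrakk>1 \<le> i; i \<le> j; j \<le> n; star_dom C n j a b\<rbrakk>
      \<Longrightarrow> degen C (n + 1) i (star C n j a b) =
          star C (n + 1) (j + 1) (degen C (n + 1) i a) (degen C (n + 1) i b)"
    and degen_star_greater: "\<lbrakk>1 \<le> j; j \<le> n; j < i; i \<le> n + 1; star_dom C n j a b\<rbrakk>
      \<Longrightarrow> degen C (n + 1) i (star C n j a b) =
          star C (n + 1) j (degen C (n + 1) i a) (degen C (n + 1) i b)"
    and degen_degen: "\<lbrakk>1 \<le> i; i \<le> j; j \<le> n; a \<in> ncells C (n - 1)\<rbrakk>
      \<Longrightarrow> degen C (n + 1) i (degen C n j a) = degen C (n + 1) (j + 1) (degen C n i a)"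

definition cub_hom :: "'a cubcat \<Rightarrow> 'a cubcat \<Rightarrow> (nat \<Rightarrow> 'a \<Rightarrow> 'a) set" where
  "cub_hom C D = {F. (\<forall>n. F n \<in> ncells C n \<rightarrow>\<^sub>E ncells D n) \<and>
     (\<forall>n i \<alpha>. 1 \<le> i \<and> i \<le> n \<longrightarrow>
        (\<forall>a \<in> ncells C n. F (n - 1) (face C n i \<alpha> a) = face D n i \<alpha> (F n a))) \<and>
     (\<forall>n i a b. 1 \<le> i \<and> i \<le> n \<and> star_dom C n i a b \<longrightarrow>
        F n (star C n i a b) = star D n i (F n a) (F n b)) \<and>
     (\<forall>n i. 1 \<le> i \<and> i \<le> n \<longrightarrow>
        (\<forall>a \<in> ncells C (n - 1). F n (degen C n i a) = degen D n i (F (n - 1) a)))}"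

definition CubCat :: "('a cubcat, nat \<Rightarrow> 'a \<Rightarrow> 'a) cat" where
  "CubCat = \<lparr>Obj = {C. classical_cubical_omega_category C},
     Hom = cub_hom,
     Ident = (\<lambda>C n. restrict (\<lambda>a. a) (ncells C n)),
     Comp = (\<lambda>C D E G F n. compose (ncells C n) (G n) (F n))\<rparr>"

end

(*
  Both notions are compared through a level-free structure: one set X with faces d i,
  degeneracies e i and partial compositions c i for all directions i >= 1, such that each cell
  is fixed by e i for all large i; its levels X_n = {x. e i x = x for all i > n} form a
  classical cubical category whose last degeneracy X_n -> X_(n+1) is the inclusion.

  In a single-set category put e i = rsy i o rsy (i+1) o ..., an infinite composite which is
  finite on every cell because a reverse symmetry is the identity on cells fixed in both
  directions; it is a bijection onto the fixed cells of direction i, and d i is the boundary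
  followed by its inverse. Conversely bd i = e i o d i, and sy i = e (i+1) o d i on fixed cells,
  so the two structures have the same morphisms. Identities between the e i are proved by
  downward induction on i, starting at the directions exceeding the dimension of the cell.
  Every classical category is isomorphic to one whose last degeneracies are inclusions,
  obtained by identifying each a with its last degeneracy (this is where the infinite universe
  is needed), and the union of the levels of the latter is level-free.
*)
theory Submission
  imports Defs
begin

text \<open>The formula for \<open>e i\<close> is forced: a reverse symmetry must carry the
  degeneracy in direction \<open>i + 1\<close> to the one in direction \<open>i\<close>, so
  \<open>e i = rsy i o e (i + 1)\<close>, and unrolling stops once \<open>e k\<close> fixes the
  cell. The critical identity is \<open>e i o e j = e (j + 1) o e i\<close> for
  \<open>i <= j\<close>: moving \<open>e i\<close> past \<open>rsy j\<close> makes symmetries of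
  adjacent directions meet, and the axioms contain no braid relation between them. It is replaced by
  the fact that the cell to which the three reverse symmetries are applied is already fixed in
  directions \<open>j + 1\<close> and \<open>j + 2\<close>; on either side of the braid relation one
  factor is then the identity, and both sides agree. Only the functor from single-set to classical
  categories is written down. Being fully faithful and essentially surjective suffices, so the
  renaming that makes a classical category strict, which depends on a choice of names, never has to
  be made functorial. On a strict category the round trip through the single-set structure is an
  equality; the renaming supplies the only isomorphism.\<close>

text \<open>An inverse functor chooses for each \<open>Y\<close> an object \<open>G0 Y\<close> with
  an isomorphism \<open>e Y\<close>, and sends \<open>g\<close> to the unique preimage under
  \<open>F\<close> of its conjugate by these isomorphisms. Equations in the source category are
  checked after applying \<open>F\<close>, which is injective on hom-sets.\<close>

lemma equivalence_if_fully_faithful_essentially_surjective: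
  fixes \<C> :: "('o, 'm) cat" and \<D> :: "('p, 'n) cat"
  assumes cC: "category \<C>" and cD: "category \<D>" and F: "is_functor \<C> \<D> F"
    and ff: "\<And>A B. A \<in> Obj \<C> \<Longrightarrow> B \<in> Obj \<C>
      \<Longrightarrow> bij_betw (fmap F A B) (Hom \<C> A B) (Hom \<D> (fobj F A) (fobj F B))"
    and es: "\<And>Y. Y \<in> Obj \<D> \<Longrightarrow> \<exists>A \<in> Obj \<C>. \<exists>f. is_iso \<D> (fobj F A) Y f"
  shows "equivalent_categories \<C> \<D>"
proof -
  interpret C: category \<C> by (rule cC)
  interpret D: category \<D> by (rule cD)
  have F_obj[simp]: "fobj F A \<in> Obj \<D>" if "A \<in> Obj \<C>" for A
    using F that unfolding is_functor_def by blast
  have F_hom[simp]: "fmap F A B f \<in> Hom \<D> (fobj F A) (fobj F B)"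
    if "A \<in> Obj \<C>" "B \<in> Obj \<C>" "f \<in> Hom \<C> A B" for A B f
    using F that unfolding is_functor_def by blast
  have F_id[simp]: "fmap F A A (Ident \<C> A) = Ident \<D> (fobj F A)" if "A \<in> Obj \<C>" for A
    using F that unfolding is_functor_def by blast
  have F_comp[simp]: "fmap F A B (Comp \<C> A K B g f) =
      Comp \<D> (fobj F A) (fobj F K) (fobj F B) (fmap F K B g) (fmap F A K f)"
    if "A \<in> Obj \<C>" "B \<in> Obj \<C>" "K \<in> Obj \<C>" "f \<in> Hom \<C> A K" "g \<in> Hom \<C> K B" for A B K f g
    using F that unfolding is_functor_def by blast
  define p where "p A B = inv_into (Hom \<C> A B) (fmap F A B)" for A B
  have p_hom[simp]: "p A B g \<in> Hom \<C> A B" and F_p[simp]: "fmap F A B (p A B g) = g"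
    if "A \<in> Obj \<C>" "B \<in> Obj \<C>" "g \<in> Hom \<D> (fobj F A) (fobj F B)" for A B g
    using ff[OF that(1,2)] that(3) unfolding p_def
    by (auto simp: bij_betw_def intro: inv_into_into f_inv_into_f)
  have F_inj: "f = g" if "A \<in> Obj \<C>" "B \<in> Obj \<C>" "f \<in> Hom \<C> A B" "g \<in> Hom \<C> A B"
    "fmap F A B f = fmap F A B g" for A B f g
    using ff[OF that(1,2)] that(3-) by (auto simp: bij_betw_def inj_on_def)
  have "\<forall>Y. \<exists>A e e'. Y \<in> Obj \<D> \<longrightarrow> A \<in> Obj \<C> \<and> e \<in> Hom \<D> (fobj F A) Y \<and> e' \<in> Hom \<D> Y (fobj F A) \<and>
     Comp \<D> (fobj F A) Y (fobj F A) e' e = Ident \<D> (fobj F A) \<and>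
     Comp \<D> Y (fobj F A) Y e e' = Ident \<D> Y"
    using es unfolding is_iso_def by metis
  then obtain G0 e e' where "\<forall>Y. Y \<in> Obj \<D> \<longrightarrow> G0 Y \<in> Obj \<C> \<and> e Y \<in> Hom \<D> (fobj F (G0 Y)) Y
     \<and> e' Y \<in> Hom \<D> Y (fobj F (G0 Y)) \<and>
     Comp \<D> (fobj F (G0 Y)) Y (fobj F (G0 Y)) (e' Y) (e Y) = Ident \<D> (fobj F (G0 Y)) \<and>
     Comp \<D> Y (fobj F (G0 Y)) Y (e Y) (e' Y) = Ident \<D> Y"
    by metis
  then have G0[simp]: "G0 Y \<in> Obj \<C>"
    and e_hom[simp]: "e Y \<in> Hom \<D> (fobj F (G0 Y)) Y"
    and e'_hom[simp]: "e' Y \<in> Hom \<D> Y (fobj F (G0 Y))"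
    and e'_e[simp]: "Comp \<D> (fobj F (G0 Y)) Y (fobj F (G0 Y)) (e' Y) (e Y) = Ident \<D> (fobj F (G0 Y))"
    and e_e'[simp]: "Comp \<D> Y (fobj F (G0 Y)) Y (e Y) (e' Y) = Ident \<D> Y"
    if "Y \<in> Obj \<D>" for Y
    using that by blast+
  note [simp] = D.ident_in_hom D.comp_in_hom D.comp_ident_right D.comp_ident_left
    C.ident_in_hom C.comp_in_hom C.comp_ident_right C.comp_ident_left
  have assoc[simp]: "Comp \<D> A B E (Comp \<D> B K E h g) f = Comp \<D> A K E h (Comp \<D> A B K g f)"
    if "A \<in> Obj \<D>" "B \<in> Obj \<D>" "K \<in> Obj \<D>" "E \<in> Obj \<D>"
      "f \<in> Hom \<D> A B" "g \<in> Hom \<D> B K" "h \<in> Hom \<D> K E" for A B K E f g h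
    using D.comp_assoc that by simp
  \<comment> \<open>Since \<open>assoc\<close> nests composites to the right, an inverse pair occurs
    with a tail \<open>g\<close>; this rule and the next one cancel it in that position.\<close>
  have e_e'_cancel[simp]: "Comp \<D> A (fobj F (G0 Y)) Y (e Y) (Comp \<D> A Y (fobj F (G0 Y)) (e' Y) g) = g"
    if "A \<in> Obj \<D>" "Y \<in> Obj \<D>" "g \<in> Hom \<D> A Y" for A Y g
    using that by (simp flip: assoc)
  have e'_e_cancel[simp]: "Comp \<D> A Y (fobj F (G0 Y)) (e' Y) (Comp \<D> A (fobj F (G0 Y)) Y (e Y) g) = g"
    if "A \<in> Obj \<D>" "Y \<in> Obj \<D>" "g \<in> Hom \<D> A (fobj F (G0 Y))" for A Y g
    using that by (simp flip: assoc)
  define cj where "cj Y Z g = Comp \<D> (fobj F (G0 Y)) Z (fobj F (G0 Z)) (e' Z)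
    (Comp \<D> (fobj F (G0 Y)) Y Z g (e Y))" for Y Z g
  have cj_hom[simp]: "cj Y Z g \<in> Hom \<D> (fobj F (G0 Y)) (fobj F (G0 Z))"
    if "Y \<in> Obj \<D>" "Z \<in> Obj \<D>" "g \<in> Hom \<D> Y Z" for Y Z g
    using that by (simp add: cj_def)
  define G where "G = \<lparr>fobj = G0, fmap = (\<lambda>Y Z g. p (G0 Y) (G0 Z) (cj Y Z g))\<rparr>"
  \<comment> \<open>Fullness lifts the isomorphism \<open>e' (fobj F A)\<close> from
    \<open>F A\<close> to \<open>F (G0 (F A))\<close> to a morphism from \<open>A\<close> to
    \<open>G0 (F A)\<close>.\<close>
  define \<eta> where "\<eta> A = p A (G0 (fobj F A)) (e' (fobj F A))" for A
  have G: "is_functor \<D> \<C> G"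
    unfolding is_functor_def G_def
  proof (intro conjI ballI; simp)
    fix A assume "A \<in> Obj \<D>"
    then show "p (G0 A) (G0 A) (cj A A (Ident \<D> A)) = Ident \<C> (G0 A)"
      by (intro F_inj[of "G0 A" "G0 A"]) (simp_all, simp add: cj_def)
  next
    fix A B K f g assume "A \<in> Obj \<D>" "B \<in> Obj \<D>" "K \<in> Obj \<D>" "f \<in> Hom \<D> A B" "g \<in> Hom \<D> B K"
    then show "p (G0 A) (G0 K) (cj A K (Comp \<D> A B K g f)) =
      Comp \<C> (G0 A) (G0 B) (G0 K) (p (G0 B) (G0 K) (cj B K g)) (p (G0 A) (G0 B) (cj A B f))"
      by (intro F_inj[of "G0 A" "G0 K"]) (simp_all, simp add: cj_def)
  qed
  have \<eta>: "is_nat_iso \<C> \<C> id_functor (comp_functor G F) \<eta>"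
    unfolding is_nat_iso_def id_functor_def comp_functor_def G_def \<eta>_def
  proof (intro conjI ballI; simp)
    fix A assume A: "A \<in> Obj \<C>"
    let ?B = "G0 (fobj F A)"
    have "Comp \<C> A ?B A (p ?B A (e (fobj F A))) (p A ?B (e' (fobj F A))) = Ident \<C> A"
      using A by (intro F_inj[of A A]) simp_all
    moreover have "Comp \<C> ?B A ?B (p A ?B (e' (fobj F A))) (p ?B A (e (fobj F A))) = Ident \<C> ?B"
      using A by (intro F_inj[of ?B ?B]) simp_all
    ultimately show "is_iso \<C> A ?B (p A ?B (e' (fobj F A)))"
      unfolding is_iso_def using A by (auto intro!: bexI[of _ "p ?B A (e (fobj F A))"])
  next
    fix A B f assume "A \<in> Obj \<C>" "B \<in> Obj \<C>" "f \<in> Hom \<C> A B"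
    then show "Comp \<C> A B (G0 (fobj F B)) (p B (G0 (fobj F B)) (e' (fobj F B))) f =
       Comp \<C> A (G0 (fobj F A)) (G0 (fobj F B))
        (p (G0 (fobj F A)) (G0 (fobj F B)) (cj (fobj F A) (fobj F B) (fmap F A B f)))
        (p A (G0 (fobj F A)) (e' (fobj F A)))"
      by (intro F_inj[of A "G0 (fobj F B)"]) (simp_all, simp add: cj_def)
  qed
  have "is_nat_iso \<D> \<D> (comp_functor F G) id_functor e"
    unfolding is_nat_iso_def id_functor_def comp_functor_def G_def
  proof (intro conjI ballI; simp)
    fix A assume "A \<in> Obj \<D>"
    then show "is_iso \<D> (fobj F (G0 A)) A (e A)"
      unfolding is_iso_def by (auto intro!: bexI[of _ "e' A"])
  next
    fix A B f assume "A \<in> Obj \<D>" "B \<in> Obj \<D>" "f \<in> Hom \<D> A B"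
    then show "Comp \<D> (fobj F (G0 A)) (fobj F (G0 B)) B (e B) (cj A B f) = Comp \<D> (fobj F (G0 A)) A B f (e A)"
      by (simp add: cj_def)
  qed
  then show ?thesis
    unfolding equivalent_categories_def using cC cD F G \<eta> by blast
qed

section \<open>Cubical categories without levels\<close>

text \<open>These are the classical axioms with the level erased; shifts \<open>j - 1\<close> are
  written as \<open>Suc j\<close> on the other side to avoid subtraction. The grading survives only
  in \<open>e_fin\<close>. Faces are total: if \<open>e i\<close> fixes a cell, then
  \<open>d_e_same\<close> makes \<open>d i\<close> fix it too.\<close>

locale stable_cubical =
  fixes X :: "'a set" and d :: "nat \<Rightarrow> sign \<Rightarrow> 'a \<Rightarrow> 'a" and e :: "nat \<Rightarrow> 'a \<Rightarrow> 'a"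
    and c :: "nat \<Rightarrow> 'a \<Rightarrow> 'a \<Rightarrow> 'a"
  assumes d_closed: "\<lbrakk>i \<ge> 1; x \<in> X\<rbrakk> \<Longrightarrow> d i \<alpha> x \<in> X"
    and e_closed: "\<lbrakk>i \<ge> 1; x \<in> X\<rbrakk> \<Longrightarrow> e i x \<in> X"
    and c_closed: "\<lbrakk>i \<ge> 1; x \<in> X; y \<in> X; d i Plus x = d i Minus y\<rbrakk> \<Longrightarrow> c i x y \<in> X"
    and c_assoc: "\<lbrakk>i \<ge> 1; x \<in> X; y \<in> X; z \<in> X; d i Plus x = d i Minus y; d i Plus y = d i Minus z\<rbrakk>
      \<Longrightarrow> c i x (c i y z) = c i (c i x y) z"
    and c_unit_right: "\<lbrakk>i \<ge> 1; x \<in> X\<rbrakk> \<Longrightarrow> c i x (e i (d i Plus x)) = x"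
    and c_unit_left: "\<lbrakk>i \<ge> 1; x \<in> X\<rbrakk> \<Longrightarrow> c i (e i (d i Minus x)) x = x"
    and d_d: "\<lbrakk>i \<ge> 1; i \<le> j; x \<in> X\<rbrakk> \<Longrightarrow> d i \<alpha> (d (Suc j) \<beta> x) = d j \<beta> (d i \<alpha> x)"
    and d_c_less: "\<lbrakk>i \<ge> 1; i \<le> j; x \<in> X; y \<in> X; d (Suc j) Plus x = d (Suc j) Minus y\<rbrakk>
      \<Longrightarrow> d i \<alpha> (c (Suc j) x y) = c j (d i \<alpha> x) (d i \<alpha> y)"
    and d_c_minus: "\<lbrakk>i \<ge> 1; x \<in> X; y \<in> X; d i Plus x = d i Minus y\<rbrakk>
      \<Longrightarrow> d i Minus (c i x y) = d i Minus x"
    and d_c_plus: "\<lbrakk>i \<ge> 1; x \<in> X; y \<in> X; d i Plus x = d i Minus y\<rbrakk>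
      \<Longrightarrow> d i Plus (c i x y) = d i Plus y"
    and d_c_greater: "\<lbrakk>j \<ge> 1; j < i; x \<in> X; y \<in> X; d j Plus x = d j Minus y\<rbrakk>
      \<Longrightarrow> d i \<alpha> (c j x y) = c j (d i \<alpha> x) (d i \<alpha> y)"
    and c_interchange: "\<lbrakk>i \<ge> 1; j \<ge> 1; i \<noteq> j; w \<in> X; x \<in> X; y \<in> X; z \<in> X;
        d i Plus w = d i Minus x; d i Plus y = d i Minus z;
        d j Plus w = d j Minus y; d j Plus x = d j Minus z\<rbrakk>
      \<Longrightarrow> c j (c i w x) (c i y z) = c i (c j w y) (c j x z)"
    and d_e_less: "\<lbrakk>i \<ge> 1; i \<le> j; x \<in> X\<rbrakk> \<Longrightarrow> d i \<alpha> (e (Suc j) x) = e j (d i \<alpha> x)"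
    and d_e_same: "\<lbrakk>i \<ge> 1; x \<in> X\<rbrakk> \<Longrightarrow> d i \<alpha> (e i x) = x"
    and d_e_greater: "\<lbrakk>j \<ge> 1; j \<le> i; x \<in> X\<rbrakk> \<Longrightarrow> d (Suc i) \<alpha> (e j x) = e j (d i \<alpha> x)"
    and e_c_le: "\<lbrakk>i \<ge> 1; i \<le> j; x \<in> X; y \<in> X; d j Plus x = d j Minus y\<rbrakk>
      \<Longrightarrow> e i (c j x y) = c (Suc j) (e i x) (e i y)"
    and e_c_greater: "\<lbrakk>j \<ge> 1; j < i; x \<in> X; y \<in> X; d j Plus x = d j Minus y\<rbrakk>
      \<Longrightarrow> e i (c j x y) = c j (e i x) (e i y)"
    and e_e: "\<lbrakk>i \<ge> 1; i \<le> j; x \<in> X\<rbrakk> \<Longrightarrow> e i (e j x) = e (Suc j) (e i x)"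
    and e_fin: "x \<in> X \<Longrightarrow> \<exists>n. \<forall>i > n. e i x = x"

definition level :: "'a set \<Rightarrow> (nat \<Rightarrow> 'a \<Rightarrow> 'a) \<Rightarrow> nat \<Rightarrow> 'a set" where
  "level X e n = {x \<in> X. \<forall>i > n. e i x = x}"

text \<open>Values outside the levels and directions in range are cut to \<open>undefined\<close>,
  so that a strict classical category can be recovered as an equal record and not only up to
  isomorphism.\<close>

definition truncations ::
  "'a set \<Rightarrow> (nat \<Rightarrow> sign \<Rightarrow> 'a \<Rightarrow> 'a) \<Rightarrow> (nat \<Rightarrow> 'a \<Rightarrow> 'a) \<Rightarrow> (nat \<Rightarrow> 'a \<Rightarrow> 'a \<Rightarrow> 'a) \<Rightarrow> 'a cubcat" where
  "truncations X d e c =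
    \<lparr>ncells = level X e,
     face = (\<lambda>n i. if 1 \<le> i \<and> i \<le> n then (\<lambda>\<alpha>. restrict (d i \<alpha>) (level X e n)) else undefined),
     degen = (\<lambda>n i. if 1 \<le> i \<and> i \<le> n then restrict (e i) (level X e (n - 1)) else undefined),
     star = (\<lambda>n i. if 1 \<le> i \<and> i \<le> n then
        (\<lambda>x y. if x \<in> level X e n \<and> y \<in> level X e n \<and> d i Plus x = d i Minus y
               then c i x y else undefined) else undefined)\<rparr>"

text \<open>The fixed cells of direction \<open>i\<close> are the cells \<open>e i u\<close>, and a
  face in direction \<open>i\<close> recovers \<open>u\<close>; thus \<open>sy\<close> replaces
  \<open>e i u\<close> by \<open>e (Suc i) u\<close>, and \<open>rsy\<close> undoes this.\<close>

definition single_set ::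
  "'a set \<Rightarrow> (nat \<Rightarrow> sign \<Rightarrow> 'a \<Rightarrow> 'a) \<Rightarrow> (nat \<Rightarrow> 'a \<Rightarrow> 'a) \<Rightarrow> (nat \<Rightarrow> 'a \<Rightarrow> 'a \<Rightarrow> 'a) \<Rightarrow> 'a sincub" where
  "single_set X d e c =
    \<lparr>cells = X,
     bd = restrict (\<lambda>i \<alpha>. restrict (\<lambda>x. e i (d i \<alpha> x)) X) {1..},
     mul = restrict (\<lambda>i. restrict (\<lambda>x. restrict
        (\<lambda>y. if d i Plus x = d i Minus y then {c i x y} else {}) X) X) {1..},
     sy = restrict (\<lambda>i. restrict (\<lambda>x. e (Suc i) (d i Minus x)) X) {1..},
     rsy = restrict (\<lambda>i. restrict (\<lambda>x. e i (d (Suc i) Minus x)) X) {1..}\<rparr>"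

context stable_cubical
begin

section \<open>Levels of a level-free structure and their classical category\<close>

abbreviation "lev \<equiv> level X e"

lemma lev_iff: "x \<in> lev n \<longleftrightarrow> x \<in> X \<and> (\<forall>i > n. e i x = x)"
  by (simp add: level_def)

lemma lev_X: "x \<in> lev n \<Longrightarrow> x \<in> X"
  by (simp add: lev_iff)

text \<open>Moving \<open>e k\<close> inside a face in direction \<open>i <= k\<close> turns it into
  \<open>e (Suc k)\<close>, which fixes \<open>x\<close> already for \<open>k >= n\<close>; this
  lowers the dimension by one. Dually, \<open>e_e\<close> lowers the index in
  \<open>lev_e\<close>.\<close>

lemma lev_d: "\<lbrakk>x \<in> lev n; 1 \<le> i; i \<le> n\<rbrakk> \<Longrightarrow> d i \<alpha> x \<in> lev (n - 1)"
  unfolding lev_iff by (auto simp: d_closed simp flip: d_e_less)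

lemma lev_e: "\<lbrakk>x \<in> lev (n - 1); 1 \<le> i; i \<le> n\<rbrakk> \<Longrightarrow> e i x \<in> lev n"
  unfolding lev_iff
proof (intro conjI allI impI; (elim conjE)?)
  fix k assume *: "1 \<le> i" "i \<le> n" "x \<in> X" "\<forall>k > n - 1. e k x = x" "k > n"
  then obtain k' where "k = Suc k'" "k' > n - 1" "i \<le> k'" by (cases k) auto
  then show "e k (e i x) = e i x" using * by (simp flip: e_e)
qed (simp add: e_closed)

lemma lev_c:
  "\<lbrakk>x \<in> lev n; y \<in> lev n; 1 \<le> i; i \<le> n; d i Plus x = d i Minus y\<rbrakk> \<Longrightarrow> c i x y \<in> lev n"
  unfolding lev_iff by (auto simp: c_closed e_c_greater)

lemma e_inj: "\<lbrakk>i \<ge> 1; x \<in> X; y \<in> X\<rbrakk> \<Longrightarrow> e i x = e i y \<longleftrightarrow> x = y"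
  by (metis d_e_same)

lemma d_fixed: "\<lbrakk>i \<ge> 1; x \<in> X; e i x = x\<rbrakk> \<Longrightarrow> d i \<alpha> x = x"
  by (metis d_e_same)

lemma d_cong_less: "\<lbrakk>1 \<le> i; i \<le> j; x \<in> X; y \<in> X; d (Suc j) Plus x = d (Suc j) Minus y\<rbrakk>
   \<Longrightarrow> d j Plus (d i \<alpha> x) = d j Minus (d i \<alpha> y)"
  by (simp flip: d_d)

lemma d_cong_greater: "\<lbrakk>1 \<le> i; i < j; x \<in> X; y \<in> X; d i Plus x = d i Minus y\<rbrakk>
   \<Longrightarrow> d i Plus (d j \<alpha> x) = d i Minus (d j \<alpha> y)"
  by (cases j) (simp_all add: d_d)

lemma truncations_simps:
  "ncells (truncations X d e c) = lev"
  "\<lbrakk>1 \<le> i; i \<le> n; x \<in> lev n\<rbrakk> \<Longrightarrow> face (truncations X d e c) n i \<alpha> x = d i \<alpha> x"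
  "\<lbrakk>1 \<le> i; i \<le> n; x \<in> lev (n - 1)\<rbrakk> \<Longrightarrow> degen (truncations X d e c) n i x = e i x"
  "\<lbrakk>1 \<le> i; i \<le> n; x \<in> lev n; y \<in> lev n; d i Plus x = d i Minus y\<rbrakk>
    \<Longrightarrow> star (truncations X d e c) n i x y = c i x y"
  "\<lbrakk>1 \<le> i; i \<le> n\<rbrakk> \<Longrightarrow> star_dom (truncations X d e c) n i x y \<longleftrightarrow>
     x \<in> lev n \<and> y \<in> lev n \<and> d i Plus x = d i Minus y"
  by (auto simp: truncations_def star_dom_def)

text \<open>Every classical axiom is a level-free axiom read on levels. What remains is to see that
  the composites on both sides are defined, since \<open>star\<close> is \<open>undefined\<close> on
  pairs that are not composable.\<close>

lemma classical_truncations: "classical_cubical_omega_category (truncations X d e c)"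
proof -
  let ?C = "truncations X d e c"
  note [simp] = truncations_simps lev_X lev_d[simplified] lev_e[simplified] lev_c
  show ?thesis
  proof
    fix i n :: nat and \<alpha> assume "1 \<le> i" "i \<le> n"
    then show "face ?C n i \<alpha> \<in> ncells ?C n \<rightarrow>\<^sub>E ncells ?C (n - 1)"
      by (auto simp: truncations_def)
  next
    fix i n :: nat assume "1 \<le> i" "i \<le> n"
    then show "degen ?C n i \<in> ncells ?C (n - 1) \<rightarrow>\<^sub>E ncells ?C n"
      by (auto simp: truncations_def)
  next
    fix i n a b assume "1 \<le> i" "i \<le> n" "star_dom ?C n i a b"
    then show "star ?C n i a b \<in> ncells ?C n" by simp
  next
    fix i n a b assume "1 \<le> i" "i \<le> n" "\<not> star_dom ?C n i a b"
    then show "star ?C n i a b = undefined" by (simp, auto simp: truncations_def)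
  next
    fix i n :: nat assume "\<not> (1 \<le> i \<and> i \<le> n)"
    then show "face ?C n i = undefined \<and> degen ?C n i = undefined \<and> star ?C n i = undefined"
      by (auto simp: truncations_def)
  next
    fix i n a b k assume i: "1 \<le> i" "i \<le> n" and
      "(star_dom ?C n i b k \<and> star_dom ?C n i a (star ?C n i b k)) \<or>
        (star_dom ?C n i a b \<and> star_dom ?C n i (star ?C n i a b) k)"
    then have *: "a \<in> lev n" "b \<in> lev n" "k \<in> lev n" "d i Plus a = d i Minus b" "d i Plus b = d i Minus k"
      by (auto simp: d_c_minus d_c_plus)
    with i show "star ?C n i a (star ?C n i b k) = star ?C n i (star ?C n i a b) k"
      by (simp add: c_assoc d_c_minus d_c_plus)
  next
    fix i n a assume i: "1 \<le> i" "i \<le> n" and a: "a \<in> ncells ?C n"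
    then show "star ?C n i a (degen ?C n i (face ?C n i Plus a)) = a"
      "star ?C n i (degen ?C n i (face ?C n i Minus a)) a = a"
      by (simp_all add: c_unit_left c_unit_right d_e_same d_closed)
  next
    fix i j n a \<alpha> \<beta> assume "1 \<le> i" "i < j" "j \<le> n" "a \<in> ncells ?C n"
    then show "face ?C (n - 1) i \<alpha> (face ?C n j \<beta> a) = face ?C (n - 1) (j - 1) \<beta> (face ?C n i \<alpha> a)"
      by (cases j) (simp_all add: d_d)
  next
    fix i j n a b \<alpha> assume "1 \<le> i" "i < j" "j \<le> n" "star_dom ?C n j a b"
    then show "face ?C n i \<alpha> (star ?C n j a b) = star ?C (n - 1) (j - 1) (face ?C n i \<alpha> a) (face ?C n i \<alpha> b)"
      by (cases j) (auto simp: d_c_less d_cong_less)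
  next
    fix i n a b assume "1 \<le> i" "i \<le> n" "star_dom ?C n i a b"
    then show "face ?C n i Minus (star ?C n i a b) = face ?C n i Minus a"
      "face ?C n i Plus (star ?C n i a b) = face ?C n i Plus b"
      by (auto simp: d_c_minus d_c_plus)
  next
    fix i j n a b \<alpha> assume "1 \<le> j" "j < i" "i \<le> n" "star_dom ?C n j a b"
    then show "face ?C n i \<alpha> (star ?C n j a b) = star ?C (n - 1) j (face ?C n i \<alpha> a) (face ?C n i \<alpha> b)"
      by (auto simp: d_c_greater d_cong_greater)
  next
    fix i j n a b k l assume *: "1 \<le> i" "i \<le> n" "1 \<le> j" "j \<le> n" "i \<noteq> j"
      "star_dom ?C n i a b" "star_dom ?C n i k l" "star_dom ?C n j a k" "star_dom ?C n j b l"
    then have "d j Plus (c i a b) = d j Minus (c i k l) \<and> d i Plus (c j a k) = d i Minus (c j b l)"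
      by (cases "i < j"; cases i; cases j) (auto simp: d_c_greater d_c_less)
    with * show "star ?C n j (star ?C n i a b) (star ?C n i k l) =
          star ?C n i (star ?C n j a k) (star ?C n j b l)"
      by (auto simp: c_interchange)
  next
    fix i j n a \<alpha> assume "1 \<le> i" "i < j" "j \<le> n" "a \<in> ncells ?C (n - 1)"
    then show "face ?C n i \<alpha> (degen ?C n j a) = degen ?C (n - 1) (j - 1) (face ?C (n - 1) i \<alpha> a)"
      by (cases j; cases n) (simp_all add: d_e_less)
  next
    fix i n a \<alpha> assume "1 \<le> i" "i \<le> n" "a \<in> ncells ?C (n - 1)"
    then show "face ?C n i \<alpha> (degen ?C n i a) = a" by (simp add: d_e_same)
  next
    fix i j n a \<alpha> assume "1 \<le> j" "j < i" "i \<le> n" "a \<in> ncells ?C (n - 1)"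
    then show "face ?C n i \<alpha> (degen ?C n j a) = degen ?C (n - 1) j (face ?C (n - 1) (i - 1) \<alpha> a)"
      by (cases i; cases n) (simp_all add: d_e_greater)
  next
    fix i j n a b assume *: "1 \<le> i" "i \<le> j" "j \<le> n" "star_dom ?C n j a b"
    then have "d (Suc j) Plus (e i a) = d (Suc j) Minus (e i b)" by (auto simp: d_e_greater)
    with * show "degen ?C (n + 1) i (star ?C n j a b) =
          star ?C (n + 1) (j + 1) (degen ?C (n + 1) i a) (degen ?C (n + 1) i b)"
      by (auto simp: e_c_le)
  next
    fix i j n a b assume *: "1 \<le> j" "j \<le> n" "j < i" "i \<le> n + 1" "star_dom ?C n j a b"
    then have "d j Plus (e i a) = d j Minus (e i b)" by (cases i) (auto simp: d_e_less)
    with * show "degen ?C (n + 1) i (star ?C n j a b) =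
          star ?C (n + 1) j (degen ?C (n + 1) i a) (degen ?C (n + 1) i b)"
      by (auto simp: e_c_greater)
  next
    fix i j n a assume "1 \<le> i" "i \<le> j" "j \<le> n" "a \<in> ncells ?C (n - 1)"
    then show "degen ?C (n + 1) i (degen ?C n j a) = degen ?C (n + 1) (j + 1) (degen ?C n i a)"
      by (simp add: e_e)
  qed
qed

section \<open>The single-set category of a level-free structure\<close>

abbreviation "\<delta> i \<alpha> x \<equiv> e i (d i \<alpha> x)"

lemma \<delta>_closed: "\<lbrakk>i \<ge> 1; x \<in> X\<rbrakk> \<Longrightarrow> \<delta> i \<alpha> x \<in> X"
  by (simp add: d_closed e_closed)

lemma \<delta>_e_same: "\<lbrakk>i \<ge> 1; x \<in> X\<rbrakk> \<Longrightarrow> \<delta> i \<alpha> (e i x) = e i x"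
  by (simp add: d_e_same)

lemma \<delta>_e_less: "\<lbrakk>i \<ge> 1; i < j; x \<in> X\<rbrakk> \<Longrightarrow> \<delta> i \<alpha> (e j x) = e j (\<delta> i \<alpha> x)"
  by (cases j) (simp_all add: d_e_less d_closed e_e)

lemma \<delta>_e_greater: "\<lbrakk>j \<ge> 1; j \<le> i; x \<in> X\<rbrakk> \<Longrightarrow> \<delta> (Suc i) \<alpha> (e j x) = e j (\<delta> i \<alpha> x)"
  by (simp add: d_e_greater d_closed e_e)

lemma \<delta>_\<delta>_less: "\<lbrakk>i \<ge> 1; i < j; x \<in> X\<rbrakk> \<Longrightarrow> \<delta> i \<alpha> (\<delta> j \<beta> x) = \<delta> j \<beta> (\<delta> i \<alpha> x)"
  by (cases j) (simp_all add: d_closed d_e_less d_e_greater e_e d_d)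

lemma \<delta>_eq_iff: "\<lbrakk>i \<ge> 1; x \<in> X; y \<in> X\<rbrakk> \<Longrightarrow> \<delta> i \<alpha> x = \<delta> i \<beta> y \<longleftrightarrow> d i \<alpha> x = d i \<beta> y"
  by (simp add: e_inj d_closed)

lemma \<delta>_fixed_iff: "\<lbrakk>i \<ge> 1; x \<in> X\<rbrakk> \<Longrightarrow> \<delta> i \<alpha> x = x \<longleftrightarrow> (\<exists>u \<in> X. x = e i u)"
  by (metis \<delta>_e_same d_closed)

lemma \<delta>_c: "\<lbrakk>i \<ge> 1; j \<ge> 1; i \<noteq> j; x \<in> X; y \<in> X; d j Plus x = d j Minus y\<rbrakk>
   \<Longrightarrow> \<delta> i \<alpha> (c j x y) = c j (\<delta> i \<alpha> x) (\<delta> i \<alpha> y)"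
proof (cases "i < j")
  case True
  then obtain k where "j = Suc k" "i \<le> k" by (cases j) auto
  then show "\<lbrakk>i \<ge> 1; j \<ge> 1; i \<noteq> j; x \<in> X; y \<in> X; d j Plus x = d j Minus y\<rbrakk> \<Longrightarrow> ?thesis"
    by (simp add: d_c_less e_c_le d_closed d_cong_less)
qed (simp add: d_c_greater e_c_greater d_closed d_cong_greater)

abbreviation "T \<equiv> single_set X d e c"

lemma single_set_simps:
  "cells T = X"
  "\<lbrakk>i \<ge> 1; x \<in> X\<rbrakk> \<Longrightarrow> bd T i \<alpha> x = \<delta> i \<alpha> x"
  "\<lbrakk>i \<ge> 1; x \<in> X; y \<in> X\<rbrakk> \<Longrightarrow> mul T i x y = (if d i Plus x = d i Minus y then {c i x y} else {})"
  "\<lbrakk>i \<ge> 1; x \<in> X\<rbrakk> \<Longrightarrow> sy T i x = e (Suc i) (d i Minus x)"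
  "\<lbrakk>i \<ge> 1; x \<in> X\<rbrakk> \<Longrightarrow> rsy T i x = e i (d (Suc i) Minus x)"
  "\<lbrakk>i \<ge> 1; x \<in> X; y \<in> X\<rbrakk> \<Longrightarrow> composable T i x y \<longleftrightarrow> d i Plus x = d i Minus y"
  "\<lbrakk>i \<ge> 1; x \<in> X; y \<in> X; d i Plus x = d i Minus y\<rbrakk> \<Longrightarrow> circ T i x y = c i x y"
  by (simp_all add: single_set_def composable_def circ_def)

lemma fix_cells_single_set: "i \<ge> 1 \<Longrightarrow> fix_cells T i = e i ` X"
  unfolding fix_cells_def by (auto simp: single_set_simps \<delta>_fixed_iff e_closed)

text \<open>Writing \<open>x = e i u\<close>, the boundary of \<open>x\<close> in direction
  \<open>Suc j\<close> is \<open>e i\<close> of the boundary of \<open>u\<close> in direction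
  \<open>j\<close>; cancelling the injective \<open>e i\<close> makes \<open>u\<close> degenerate in
  direction \<open>j\<close>. The two forms of the result let a symmetry act on either outer
  degeneracy.\<close>

lemma fix_cells_two:
  assumes "i \<ge> 1" "i \<le> j" "x \<in> fix_cells T i" "x \<in> fix_cells T (Suc j)"
  obtains w where "w \<in> X" "x = e i (e j w)" "x = e (Suc j) (e i w)"
proof -
  obtain u where u: "u \<in> X" "x = e i u" using assms by (auto simp: fix_cells_single_set)
  have "\<delta> (Suc j) Minus x = x" using assms by (auto simp: fix_cells_single_set \<delta>_e_same)
  then have "e i (\<delta> j Minus u) = e i u" using assms u by (simp add: \<delta>_e_greater)
  then have "e j (d j Minus u) = u" using assms u by (simp add: e_inj \<delta>_closed)
  then show ?thesis using that[of "d j Minus u"] assms u by (simp add: d_closed flip: e_e)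
qed

text \<open>With fixed cells written as \<open>e i u\<close>, this rule and \<open>rsy_e\<close>
  reduce all symmetry axioms to identities between degeneracies, faces and composites.\<close>

lemma sy_e: "\<lbrakk>i \<ge> 1; u \<in> X\<rbrakk> \<Longrightarrow> sy T i (e i u) = e (Suc i) u"
  by (simp add: single_set_simps e_closed d_e_same)

lemma rsy_e: "\<lbrakk>i \<ge> 1; u \<in> X\<rbrakk> \<Longrightarrow> rsy T i (e (Suc i) u) = e i u"
  by (simp add: single_set_simps e_closed d_e_same)

lemma single_set_direction:
  assumes i: "i \<ge> 1"
  shows "single_set_category (cells T) (bd T i) (mul T i)"
proof
  fix x y z assume "x \<in> cells T" "y \<in> cells T" "z \<in> cells T"
  then show "set_ext (mul T i) {x} (mul T i y z) = set_ext (mul T i) (mul T i x y) {z}"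
    using i by (auto simp: set_ext_def single_set_simps c_closed c_assoc d_c_minus d_c_plus)
qed (use i in \<open>auto simp: single_set_simps c_closed c_unit_left c_unit_right d_e_same d_closed e_closed \<delta>_eq_iff
    split: if_splits\<close>)

lemma single_set_cubical: "single_set_cubical_omega_category T"
proof (rule single_set_cubical_omega_category.intro)
  show "bd T \<in> {1..} \<rightarrow>\<^sub>E (UNIV \<rightarrow> (cells T \<rightarrow>\<^sub>E cells T))"
    by (auto simp: single_set_def d_closed e_closed)
  show "mul T \<in> {1..} \<rightarrow>\<^sub>E (cells T \<rightarrow>\<^sub>E (cells T \<rightarrow>\<^sub>E Pow (cells T)))"
    by (auto simp: single_set_def c_closed split: if_splits)
  show "sy T \<in> {1..} \<rightarrow>\<^sub>E (cells T \<rightarrow>\<^sub>E cells T)" "rsy T \<in> {1..} \<rightarrow>\<^sub>E (cells T \<rightarrow>\<^sub>E cells T)"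
    by (auto simp: single_set_def d_closed e_closed)
next
  fix i :: nat assume "i \<ge> 1"
  then show "single_set_category (cells T) (bd T i) (mul T i)" by (rule single_set_direction)
next
  fix i j :: nat and x \<alpha> \<beta> assume "1 \<le> i" "1 \<le> j" "i \<noteq> j" "x \<in> cells T"
  then show "bd T i \<alpha> (bd T j \<beta> x) = bd T j \<beta> (bd T i \<alpha> x)"
    using \<delta>_\<delta>_less[of i j x] \<delta>_\<delta>_less[of j i x] by (cases "i < j") (auto simp: single_set_simps \<delta>_closed)
next
  fix i j :: nat and x y \<alpha> assume *: "1 \<le> i" "1 \<le> j" "i \<noteq> j" "x \<in> cells T" "y \<in> cells T" "composable T j x y"
  then have eq: "d j Plus x = d j Minus y" by (simp add: single_set_simps)
  \<comment> \<open>Composability is compared through boundaries rather than faces because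
    boundaries in different directions commute without an index shift.\<close>
  have "\<delta> j Plus (\<delta> i \<alpha> x) = \<delta> j Minus (\<delta> i \<alpha> y)"
    using * eq \<delta>_\<delta>_less[of i j x] \<delta>_\<delta>_less[of j i x] \<delta>_\<delta>_less[of i j y] \<delta>_\<delta>_less[of j i y]
    by (metis linorder_neqE_nat single_set_simps(1))
  then have "d j Plus (\<delta> i \<alpha> x) = d j Minus (\<delta> i \<alpha> y)"
    using * by (simp add: single_set_simps \<delta>_closed \<delta>_eq_iff)
  then show "bd T i \<alpha> (circ T j x y) = circ T j (bd T i \<alpha> x) (bd T i \<alpha> y)"
    using * eq by (simp add: single_set_simps \<delta>_closed \<delta>_c c_closed)
next
  fix i j :: nat and w x y z assume *: "1 \<le> i" "1 \<le> j" "i \<noteq> j" "w \<in> cells T" "x \<in> cells T" "y \<in> cells T" "z \<in> cells T"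
    "composable T i w x" "composable T i y z" "composable T j w y" "composable T j x z"
  then have "d j Plus (c i w x) = d j Minus (c i y z) \<and> d i Plus (c j w y) = d i Minus (c j x z)"
    by (cases "i < j"; cases i; cases j) (auto simp: d_c_greater d_c_less single_set_simps)
  with * show "circ T j (circ T i w x) (circ T i y z) = circ T i (circ T j w y) (circ T j x z)"
    by (simp add: single_set_simps c_closed c_interchange)
next
  fix i :: nat assume "1 \<le> i"
  then show "sy T i ` fix_cells T i \<subseteq> fix_cells T (i + 1)" "rsy T i ` fix_cells T (i + 1) \<subseteq> fix_cells T i"
    by (auto simp: fix_cells_single_set sy_e rsy_e)
next
  fix i :: nat and x assume "1 \<le> i" "x \<in> fix_cells T i"
  then show "rsy T i (sy T i x) = x" by (auto simp: fix_cells_single_set sy_e rsy_e)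
next
  fix i :: nat and x assume "1 \<le> i" "x \<in> fix_cells T (i + 1)"
  then show "sy T i (rsy T i x) = x" by (auto simp: fix_cells_single_set sy_e rsy_e)
next
  fix j :: nat and x \<alpha> assume "1 \<le> j" "x \<in> fix_cells T j"
  then show "bd T j \<alpha> (sy T j x) = sy T j (bd T (j + 1) \<alpha> x)"
    by (auto simp: fix_cells_single_set sy_e single_set_simps(1,2) e_closed \<delta>_closed \<delta>_e_less \<delta>_e_greater)
next
  fix i j :: nat and x \<alpha> assume *: "1 \<le> i" "1 \<le> j" "i \<noteq> j" "i \<noteq> j + 1" "x \<in> fix_cells T j"
  show "bd T i \<alpha> (sy T j x) = sy T j (bd T i \<alpha> x)"
  proof (cases "i < j")
    case True
    with * show ?thesis
      by (auto simp: fix_cells_single_set sy_e single_set_simps(1,2) e_closed \<delta>_closed \<delta>_e_less)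
  next
    case False
    then obtain k where "i = Suc k" "j < k" using * by (cases i) auto
    with * show ?thesis
      by (auto simp: fix_cells_single_set sy_e single_set_simps(1,2) e_closed \<delta>_closed \<delta>_e_greater)
  qed
next
  fix i :: nat and x y assume *: "1 \<le> i" "x \<in> fix_cells T i" "y \<in> fix_cells T i" "composable T (i + 1) x y"
  then obtain u v where uv: "u \<in> X" "v \<in> X" "x = e i u" "y = e i v" by (auto simp: fix_cells_single_set)
  have eq: "d i Plus u = d i Minus v"
    using * uv by (simp add: single_set_simps e_closed d_e_greater e_inj d_closed)
  have "circ T (i + 1) x y = e i (c i u v)"
    using * uv eq by (simp add: single_set_simps e_closed e_c_le d_e_greater)
  moreover have "circ T i (e (Suc i) u) (e (Suc i) v) = e (Suc i) (c i u v)"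
    using * uv eq by (simp add: single_set_simps e_closed e_c_greater d_e_less)
  ultimately show "sy T i (circ T (i + 1) x y) = circ T i (sy T i x) (sy T i y)"
    using * uv eq by (simp add: sy_e c_closed)
next
  fix i j :: nat and x y assume *: "1 \<le> i" "1 \<le> j" "j \<noteq> i" "j \<noteq> i + 1" "x \<in> fix_cells T i" "y \<in> fix_cells T i"
    "composable T j x y"
  then obtain u v where uv: "u \<in> X" "v \<in> X" "x = e i u" "y = e i v" by (auto simp: fix_cells_single_set)
  \<comment> \<open>The degeneracy \<open>e i\<close> shifts all directions from \<open>i\<close> on
    up by one, so composing \<open>x\<close> and \<open>y\<close> in direction \<open>j\<close>
    means composing \<open>u\<close> and \<open>v\<close> in direction \<open>k\<close>. As
    \<open>j\<close> differs from \<open>i\<close> and \<open>i + 1\<close>, \<open>k\<close> is not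
    \<open>i\<close>, and \<open>e (Suc i)\<close> shifts \<open>k\<close> to the same
    \<open>j\<close>.\<close>
  define k where "k = (if j < i then j else j - 1)"
  have k: "k \<ge> 1" "j < i \<and> k = j \<or> i < k \<and> j = Suc k" using * by (auto simp: k_def)
  have eq: "d k Plus u = d k Minus v"
    using * uv k by (cases i) (auto simp: single_set_simps e_closed d_e_less d_e_greater e_inj d_closed)
  have "circ T j x y = e i (c k u v)"
    using * uv eq k by (cases i) (auto simp: single_set_simps e_closed e_c_le e_c_greater d_e_greater d_e_less)
  moreover have "circ T j (e (Suc i) u) (e (Suc i) v) = e (Suc i) (c k u v)"
    using * uv eq k by (auto simp: single_set_simps e_closed e_c_le e_c_greater d_e_less d_e_greater)
  ultimately show "sy T i (circ T j x y) = circ T j (sy T i x) (sy T i y)"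
    using * uv eq k(1) by (simp add: sy_e c_closed)
next
  fix i :: nat and x assume "1 \<le> i" "x \<in> fix_cells T i \<inter> fix_cells T (i + 1)"
  then obtain w where "w \<in> X" "x = e i (e i w)" "x = e (Suc i) (e i w)"
    using fix_cells_two[of i i x] by auto
  then show "sy T i x = x"
    using \<open>1 \<le> i\<close> by (metis sy_e e_closed)
next
  have *: "sy T i (sy T j x) = sy T j (sy T i x)"
    if ij: "1 \<le> i" "i + 2 \<le> j" "x \<in> fix_cells T i" "x \<in> fix_cells T j" for i j :: nat and x
  proof -
    \<comment> \<open>The distance of at least two enters as \<open>Suc i \<le> k\<close>:
      \<open>e (Suc i)\<close> can then still be interchanged with \<open>e k\<close> by
      \<open>e_e\<close>.\<close>
    obtain k where k: "j = Suc k" "Suc i \<le> k" using \<open>i + 2 \<le> j\<close> by (cases j) auto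
    have le: "i \<le> k" "1 \<le> k" "1 \<le> Suc i" using k that(1) by auto
    obtain w where w: "w \<in> X" "x = e i (e k w)" "x = e (Suc k) (e i w)"
      by (rule fix_cells_two[of i k x]) (use ij k le in auto)
    have "sy T i x = e (Suc i) (e k w)" using w le that(1) by (simp add: sy_e e_closed)
    also have "\<dots> = e (Suc k) (e (Suc i) w)" using w le k by (simp add: e_e)
    finally have "sy T j (sy T i x) = e (Suc (Suc k)) (e (Suc i) w)" using w le k by (simp add: sy_e e_closed)
    moreover have "sy T j x = e i (e (Suc k) w)" using w le k that(1) by (simp add: sy_e e_closed e_e)
    then have "sy T i (sy T j x) = e (Suc i) (e (Suc k) w)" using w le k that(1) by (simp add: sy_e e_closed)
    ultimately show ?thesis using w le k by (simp add: e_e)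
  qed
  fix i j :: nat and x assume "1 \<le> i" "1 \<le> j" "\<bar>int i - int j\<bar> \<ge> 2" "x \<in> fix_cells T i \<inter> fix_cells T j"
  then show "sy T i (sy T j x) = sy T j (sy T i x)"
    using *[of i j x] *[of j i x] by (cases "i < j") auto
next
  fix x assume "x \<in> cells T"
  then obtain n where n: "x \<in> X" "\<forall>i > n. e i x = x" using e_fin by (auto simp: single_set_simps)
  then show "\<exists>k. \<forall>i \<ge> k + 1. x \<in> fix_cells T i"
    by (metis Suc_eq_plus1 Suc_le_eq fix_cells_single_set imageI le_add2 order_trans)
qed

end

section \<open>From single-set to level-free structures\<close>

context single_set_cubical_omega_category
begin

abbreviation "X \<equiv> cells S"
abbreviation "\<delta> \<equiv> bd S"
abbreviation "fx \<equiv> fix_cells S"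

definition lv :: "nat \<Rightarrow> 'a set" where
  "lv n = {x \<in> X. \<forall>i > n. x \<in> fx i}"

lemma fxD: "x \<in> fx i \<Longrightarrow> x \<in> X"
  by (simp add: fix_cells_def)

section \<open>Consequences of the single-set axioms\<close>

lemma \<delta>_closed: "\<lbrakk>i \<ge> 1; x \<in> X\<rbrakk> \<Longrightarrow> \<delta> i \<alpha> x \<in> X"
  using single_set_category.bd_closed[OF direction_category] .

lemma composable_iff: "\<lbrakk>i \<ge> 1; x \<in> X; y \<in> X\<rbrakk> \<Longrightarrow> composable S i x y \<longleftrightarrow> \<delta> i Plus x = \<delta> i Minus y"
  unfolding composable_def using single_set_category.mul_nonempty_iff[OF direction_category] .

lemma mul_circ:
  assumes "i \<ge> 1" "x \<in> X" "y \<in> X" "\<delta> i Plus x = \<delta> i Minus y"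
  shows "mul S i x y = {circ S i x y}"
proof -
  have "mul S i x y \<noteq> {}" using assms composable_iff by (simp add: composable_def)
  moreover have "u = v" if "u \<in> mul S i x y" "v \<in> mul S i x y" for u v
    using single_set_category.mul_functional[OF direction_category[OF assms(1)] assms(2,3)] that by blast
  ultimately obtain u where "mul S i x y = {u}" by blast
  then show ?thesis by (simp add: circ_def)
qed

lemma circ_closed: "\<lbrakk>i \<ge> 1; x \<in> X; y \<in> X; \<delta> i Plus x = \<delta> i Minus y\<rbrakk> \<Longrightarrow> circ S i x y \<in> X"
  using mul_circ[of i x y] single_set_category.mul_closed[OF direction_category, of i x y] by auto

lemma circ_\<delta>_right: "\<lbrakk>i \<ge> 1; x \<in> X\<rbrakk> \<Longrightarrow> circ S i x (\<delta> i Plus x) = x"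
  using single_set_category.mul_bd_right[OF direction_category, of i x] by (simp add: circ_def)

lemma circ_\<delta>_left: "\<lbrakk>i \<ge> 1; x \<in> X\<rbrakk> \<Longrightarrow> circ S i (\<delta> i Minus x) x = x"
  using single_set_category.mul_bd_left[OF direction_category, of i x] by (simp add: circ_def)

text \<open>The unit laws make \<open>x\<close> composable with its unit on either side, and
  composability is equality of the adjacent boundaries.\<close>

lemma \<delta>_glob: "\<lbrakk>i \<ge> 1; x \<in> X\<rbrakk> \<Longrightarrow> \<delta> i Minus (\<delta> i Plus x) = \<delta> i Plus x"
  "\<lbrakk>i \<ge> 1; x \<in> X\<rbrakk> \<Longrightarrow> \<delta> i Plus (\<delta> i Minus x) = \<delta> i Minus x"
  using single_set_category.mul_bd_right[OF direction_category, of i x]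
    single_set_category.mul_bd_left[OF direction_category, of i x]
    composable_iff[of i x "\<delta> i Plus x"] composable_iff[of i "\<delta> i Minus x" x]
  by (auto simp: composable_def \<delta>_closed)

lemma \<delta>_same: "\<lbrakk>i \<ge> 1; x \<in> X\<rbrakk> \<Longrightarrow> \<delta> i \<alpha> (\<delta> i \<beta> x) = \<delta> i \<beta> x"
proof -
  assume *: "i \<ge> 1" "x \<in> X"
  note g = \<delta>_glob[OF *] \<delta>_glob[OF *(1) \<delta>_closed[OF *]]
  show ?thesis
    by (cases \<alpha>; cases \<beta>) (use g(1,2) g(3)[of Minus] g(4)[of Plus] in simp_all)
qed

lemma fx_iff: "i \<ge> 1 \<Longrightarrow> x \<in> fx i \<longleftrightarrow> x \<in> X \<and> \<delta> i \<alpha> x = x"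
  using \<delta>_same[of i x \<alpha> Minus] \<delta>_same[of i x Minus \<alpha>] by (auto simp: fix_cells_def)

lemma fx_\<delta>: "\<lbrakk>i \<ge> 1; x \<in> X\<rbrakk> \<Longrightarrow> \<delta> i \<alpha> x \<in> fx i"
  by (simp add: fix_cells_def \<delta>_closed \<delta>_same)

lemma fx_fixed: "\<lbrakk>i \<ge> 1; x \<in> fx i\<rbrakk> \<Longrightarrow> \<delta> i \<alpha> x = x"
  by (simp add: fx_iff[of i x \<alpha>])

lemma fx_\<delta>_other: "\<lbrakk>i \<ge> 1; j \<ge> 1; x \<in> fx i\<rbrakk> \<Longrightarrow> \<delta> j \<alpha> x \<in> fx i"
  using bd_bd[of i j x Minus \<alpha>]
  by (cases "i = j") (auto simp: fx_\<delta> fxD, auto simp: fx_iff[of i _ Minus] \<delta>_closed)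

text \<open>By associativity, multiplying the composite by the left unit of \<open>x\<close> or the
  right unit of \<open>y\<close> leaves it unchanged. These products are therefore nonempty, which
  identifies its boundaries.\<close>

lemma circ_\<delta>: "\<lbrakk>i \<ge> 1; x \<in> X; y \<in> X; \<delta> i Plus x = \<delta> i Minus y\<rbrakk>
  \<Longrightarrow> \<delta> i Minus (circ S i x y) = \<delta> i Minus x \<and> \<delta> i Plus (circ S i x y) = \<delta> i Plus y"
proof -
  assume *: "i \<ge> 1" "x \<in> X" "y \<in> X" "\<delta> i Plus x = \<delta> i Minus y"
  interpret single_set_category X "\<delta> i" "mul S i" using *(1) by (rule direction_category)
  let ?z = "circ S i x y"
  have z: "?z \<in> X" "mul S i x y = {?z}" using * by (simp_all add: circ_closed mul_circ)
  have "set_ext (mul S i) {\<delta> i Minus x} (mul S i x y) = set_ext (mul S i) (mul S i (\<delta> i Minus x) x) {y}"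
    by (rule mul_assoc) (use * in \<open>auto simp: bd_closed\<close>)
  then have "mul S i (\<delta> i Minus x) ?z = {?z}" using * z by (simp add: set_ext_def mul_bd_left)
  moreover have "set_ext (mul S i) {x} (mul S i y (\<delta> i Plus y)) = set_ext (mul S i) (mul S i x y) {\<delta> i Plus y}"
    by (rule mul_assoc) (use * in \<open>auto simp: bd_closed\<close>)
  then have "mul S i ?z (\<delta> i Plus y) = {?z}" using * z by (simp add: set_ext_def mul_bd_right)
  ultimately show ?thesis
    using * z mul_nonempty_iff[of "\<delta> i Minus x" ?z] mul_nonempty_iff[of ?z "\<delta> i Plus y"]
    by (simp add: bd_closed \<delta>_same)
qed

lemma circ_assoc: "\<lbrakk>i \<ge> 1; x \<in> X; y \<in> X; z \<in> X; \<delta> i Plus x = \<delta> i Minus y; \<delta> i Plus y = \<delta> i Minus z\<rbrakk>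
  \<Longrightarrow> circ S i x (circ S i y z) = circ S i (circ S i x y) z"
proof -
  assume *: "i \<ge> 1" "x \<in> X" "y \<in> X" "z \<in> X" "\<delta> i Plus x = \<delta> i Minus y" "\<delta> i Plus y = \<delta> i Minus z"
  have "set_ext (mul S i) {x} (mul S i y z) = set_ext (mul S i) (mul S i x y) {z}"
    by (rule single_set_category.mul_assoc[OF direction_category]) (use * in auto)
  then show ?thesis using * by (simp add: mul_circ set_ext_def circ_closed circ_\<delta>)
qed

lemma lv_X: "x \<in> lv n \<Longrightarrow> x \<in> X" by (simp add: lv_def)

lemma lv_fx: "\<lbrakk>x \<in> lv n; i > n\<rbrakk> \<Longrightarrow> x \<in> fx i" by (simp add: lv_def)

lemma lv_mono: "\<lbrakk>m \<le> n; x \<in> lv m\<rbrakk> \<Longrightarrow> x \<in> lv n" by (auto simp: lv_def)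

lemma lv_ex: "x \<in> X \<Longrightarrow> \<exists>n. x \<in> lv n"
  using finite_dimensional by (auto simp: lv_def Suc_le_eq)

lemma lv_ex2: "x \<in> X \<Longrightarrow> y \<in> X \<Longrightarrow> \<exists>n. x \<in> lv n \<and> y \<in> lv n"
  using lv_ex[of x] lv_ex[of y] by (meson lv_mono nle_le)

lemma lv_\<delta>: "\<lbrakk>j \<ge> 1; x \<in> lv n\<rbrakk> \<Longrightarrow> \<delta> j \<alpha> x \<in> lv n"
  by (auto simp: lv_def \<delta>_closed fx_\<delta>_other)

lemma circ_idem: "\<lbrakk>i \<ge> 1; x \<in> fx i\<rbrakk> \<Longrightarrow> circ S i x x = x"
  using circ_\<delta>_right[of i x] fx_fixed[of i x Plus] by (simp add: fxD)

lemma fx_circ: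
  assumes "i \<ge> 1" "j \<ge> 1" "x \<in> fx i" "y \<in> fx i" "\<delta> j Plus x = \<delta> j Minus y"
  shows "circ S j x y \<in> fx i"
proof (cases "i = j")
  case True
  then have "x = y" using assms fx_fixed[of i x Plus] fx_fixed[of i y Minus] by simp
  then show ?thesis using assms True by (simp add: circ_idem)
next
  case False
  then show ?thesis using assms
    by (simp add: fx_iff[of i _ Minus] bd_circ circ_closed composable_iff)
qed

lemma lv_circ: "\<lbrakk>j \<ge> 1; x \<in> lv n; y \<in> lv n; \<delta> j Plus x = \<delta> j Minus y\<rbrakk> \<Longrightarrow> circ S j x y \<in> lv n"
  by (auto simp: lv_def circ_closed fx_circ)

lemma sy_fx: "\<lbrakk>i \<ge> 1; x \<in> fx i\<rbrakk> \<Longrightarrow> sy S i x \<in> fx (Suc i)"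
  using sy_image by auto

lemma rsy_fx: "\<lbrakk>i \<ge> 1; y \<in> fx (Suc i)\<rbrakk> \<Longrightarrow> rsy S i y \<in> fx i"
  using rsy_image by auto

lemma rsy_inj: "\<lbrakk>i \<ge> 1; x \<in> fx (Suc i); y \<in> fx (Suc i)\<rbrakk> \<Longrightarrow> rsy S i x = rsy S i y \<longleftrightarrow> x = y"
  by (metis sy_rsy Suc_eq_plus1)

text \<open>Apart from the inverse laws and their images, the axioms constrain only
  \<open>sy\<close>; this rule converts each law for \<open>sy\<close> into the corresponding law
  for \<open>rsy\<close>.\<close>

lemma rsy_eqI: "\<lbrakk>i \<ge> 1; u \<in> fx i; sy S i u = y\<rbrakk> \<Longrightarrow> rsy S i y = u"
  by (metis rsy_sy)

lemma rsy_fixed: "\<lbrakk>i \<ge> 1; x \<in> fx i; x \<in> fx (Suc i)\<rbrakk> \<Longrightarrow> rsy S i x = x"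
  by (rule rsy_eqI) (simp_all add: sy_fixed)

lemma \<delta>_rsy_same:
  assumes "j \<ge> 1" "y \<in> fx (Suc j)"
  shows "\<delta> (Suc j) \<alpha> (rsy S j y) = rsy S j (\<delta> j \<alpha> y)"
  by (rule rsy_eqI[symmetric])
    (use assms in \<open>simp_all add: rsy_fx fx_\<delta>_other sy_rsy bd_sy_same[symmetric, simplified]\<close>)

lemma \<delta>_rsy_other:
  assumes "i \<ge> 1" "j \<ge> 1" "i \<noteq> j" "i \<noteq> Suc j" "y \<in> fx (Suc j)"
  shows "\<delta> i \<alpha> (rsy S j y) = rsy S j (\<delta> i \<alpha> y)"
  by (rule rsy_eqI[symmetric])
    (use assms in \<open>simp_all add: rsy_fx fx_\<delta>_other sy_rsy bd_sy_other[symmetric, simplified]\<close>)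

lemma rsy_fx_other: "\<lbrakk>i \<ge> 1; j \<ge> 1; i \<noteq> j; i \<noteq> Suc j; y \<in> fx (Suc j); y \<in> fx i\<rbrakk> \<Longrightarrow> rsy S j y \<in> fx i"
  using \<delta>_rsy_other[of i j y Minus] rsy_fx[of j y] by (simp add: fx_iff[of i _ Minus] fxD)

lemma sy_fx_other: "\<lbrakk>i \<ge> 1; j \<ge> 1; i \<noteq> j; i \<noteq> Suc j; y \<in> fx j; y \<in> fx i\<rbrakk> \<Longrightarrow> sy S j y \<in> fx i"
  using bd_sy_other[of i j y Minus] sy_fx[of j y] by (simp add: fx_iff[of i _ Minus] fxD)

lemma rsy_circ_next:
  assumes "i \<ge> 1" "x \<in> fx (Suc i)" "y \<in> fx (Suc i)" "\<delta> i Plus x = \<delta> i Minus y"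
  shows "\<delta> (Suc i) Plus (rsy S i x) = \<delta> (Suc i) Minus (rsy S i y)"
    and "rsy S i (circ S i x y) = circ S (Suc i) (rsy S i x) (rsy S i y)"
proof -
  show *: "\<delta> (Suc i) Plus (rsy S i x) = \<delta> (Suc i) Minus (rsy S i y)"
    using assms by (simp add: \<delta>_rsy_same)
  show "rsy S i (circ S i x y) = circ S (Suc i) (rsy S i x) (rsy S i y)"
    by (rule rsy_eqI)
      (use assms * in \<open>simp_all add: fx_circ rsy_fx sy_circ_next[simplified] composable_iff fxD[OF rsy_fx] sy_rsy\<close>)
qed

lemma rsy_circ_other:
  assumes "i \<ge> 1" "j \<ge> 1" "j \<noteq> i" "j \<noteq> Suc i" "x \<in> fx (Suc i)" "y \<in> fx (Suc i)" "\<delta> j Plus x = \<delta> j Minus y"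
  shows "\<delta> j Plus (rsy S i x) = \<delta> j Minus (rsy S i y)"
    and "rsy S i (circ S j x y) = circ S j (rsy S i x) (rsy S i y)"
proof -
  show *: "\<delta> j Plus (rsy S i x) = \<delta> j Minus (rsy S i y)"
    using assms by (simp add: \<delta>_rsy_other)
  show "rsy S i (circ S j x y) = circ S j (rsy S i x) (rsy S i y)"
    by (rule rsy_eqI)
      (use assms * in \<open>simp_all add: fx_circ rsy_fx sy_circ_other[simplified] composable_iff fxD[OF rsy_fx] sy_rsy\<close>)
qed

lemma rsy_rsy_less:
  assumes "i \<ge> 1" "Suc i < j" "y \<in> fx (Suc i)" "y \<in> fx (Suc j)"
  shows "rsy S i (rsy S j y) = rsy S j (rsy S i y)"
proof -
  let ?u = "rsy S j (rsy S i y)"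
  have 1: "rsy S i y \<in> fx i" "rsy S i y \<in> fx (Suc j)"
    using assms rsy_fx[of i y] rsy_fx_other[of "Suc j" i y] by auto
  then have 2: "?u \<in> fx j" "?u \<in> fx i" using assms rsy_fx[of j] rsy_fx_other[of i j] by auto
  \<comment> \<open>The commutation axiom is applied to the claimed value \<open>?u\<close>, which
    was just shown to be fixed in both directions; undoing the symmetries one at a time returns
    \<open>y\<close>.\<close>
  have "sy S j (sy S i ?u) = sy S i (sy S j ?u)" using assms 2 by (intro sy_sy) auto
  also have "\<dots> = y" using assms 1 by (simp add: sy_rsy[simplified])
  finally have "sy S j (sy S i ?u) = y" .
  moreover have "sy S i ?u \<in> fx j" using assms 2 sy_fx_other[of j i ?u] by simp
  ultimately have "rsy S j y = sy S i ?u" using assms by (intro rsy_eqI) auto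
  then show ?thesis using assms 2 by (simp add: rsy_sy)
qed

lemma downward_induct [consumes 1, case_names base step]:
  assumes "i \<ge> (1::nat)" and "\<And>i. i > n \<Longrightarrow> P i"
    and "\<And>i. \<lbrakk>1 \<le> i; P (Suc i)\<rbrakk> \<Longrightarrow> P i"
  shows "P i"
proof (cases "i \<le> Suc n")
  case True
  then show ?thesis using assms(1)
  proof (induction rule: inc_induct)
    case base
    then show ?case using assms(2) by simp
  next
    case (step m)
    then show ?case using assms(3)[of m] by simp
  qed
qed (use assms(2) in simp)

section \<open>Degeneracies and faces from reverse symmetries\<close>

primrec rsys :: "nat \<Rightarrow> nat \<Rightarrow> 'a \<Rightarrow> 'a" where
  "rsys i 0 y = y"
| "rsys i (Suc k) y = rsy S i (rsys (Suc i) k y)"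

text \<open>Cells of dimension at most \<open>n\<close> are fixed by \<open>rsy S i\<close> for \<open>i > n\<close>, so \<open>E i\<close> is the infinite composite
  \<open>rsy S i \<circ> rsy S (i + 1) \<circ> \<dots>\<close>: the degeneracy in direction \<open>i\<close>, seen as a bijection onto \<open>fx i\<close>.\<close>

definition E :: "nat \<Rightarrow> 'a \<Rightarrow> 'a" where
  "E i y = rsys i (LEAST n. y \<in> lv n) y"

definition D :: "nat \<Rightarrow> sign \<Rightarrow> 'a \<Rightarrow> 'a" where
  "D i \<alpha> x = inv_into X (E i) (\<delta> i \<alpha> x)"

text \<open>The additional factor \<open>rsy S (i + k)\<close> is innermost, and its two directions
  both exceed the dimension bound \<open>n\<close> of \<open>y\<close>.\<close>

lemma rsys_Suc: "\<lbrakk>i \<ge> 1; y \<in> lv n; n < i + k\<rbrakk> \<Longrightarrow> rsys i (Suc k) y = rsys i k y"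
proof (induction k arbitrary: i)
  case 0
  then show ?case by (simp add: rsy_fixed lv_fx)
next
  case (Suc k)
  then show ?case using Suc.IH[of "Suc i"] by simp
qed

lemma rsys_fixed: "\<lbrakk>i \<ge> 1; y \<in> lv n; n < i\<rbrakk> \<Longrightarrow> rsys i k y = y"
  by (induction k) (simp_all add: rsys_Suc del: rsys.simps(2))

lemma least_lv: "x \<in> X \<Longrightarrow> x \<in> lv (LEAST n. x \<in> lv n)"
  using lv_ex by (rule LeastI_ex)

lemma E_base: "\<lbrakk>i > n; y \<in> lv n\<rbrakk> \<Longrightarrow> E i y = y"
  unfolding E_def by (rule rsys_fixed[of _ _ n]) auto

text \<open>For \<open>i \<ge> 1\<close> one more factor than the dimension changes nothing, and the
  outermost factor can be split off. This recursion and \<open>E_base\<close> are all that is used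
  about \<open>E\<close> from here on.\<close>

lemma E_step: "\<lbrakk>i \<ge> 1; y \<in> X\<rbrakk> \<Longrightarrow> E i y = rsy S i (E (Suc i) y)"
  unfolding E_def using rsys_Suc[OF _ least_lv, of i y] by simp

lemma E_fx: assumes "i \<ge> 1" "x \<in> X" shows "E i x \<in> fx i"
proof -
  obtain n where "x \<in> lv n" using lv_ex assms by blast
  show ?thesis using assms(1)
  proof (induction rule: downward_induct[of _ n])
    case (base i)
    then show ?case using \<open>x \<in> lv n\<close> by (simp add: E_base lv_fx)
  next
    case (step i)
    then show ?case using assms by (simp add: E_step[of i] rsy_fx)
  qed
qed

lemma E_closed: "i \<ge> 1 \<Longrightarrow> x \<in> X \<Longrightarrow> E i x \<in> X"
  using E_fx fxD by blast

lemma E_inj: assumes "i \<ge> 1" "x \<in> X" "y \<in> X" shows "E i x = E i y \<longleftrightarrow> x = y"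
proof -
  obtain n where "x \<in> lv n" "y \<in> lv n" using lv_ex2 assms by blast
  show ?thesis using assms(1)
  proof (induction rule: downward_induct[of _ n])
    case (base i)
    then show ?case using \<open>x \<in> lv n\<close> \<open>y \<in> lv n\<close> by (simp add: E_base)
  next
    case (step i)
    then show ?case using assms by (simp add: E_step[of i] rsy_inj E_fx)
  qed
qed

lemma E_surj: assumes "i \<ge> 1" "y \<in> fx i" shows "\<exists>u \<in> X. E i u = y"
proof -
  obtain n where n: "y \<in> lv n" using lv_ex assms fxD by blast
  \<comment> \<open>The claim is generalised to all cells of dimension at most \<open>n\<close>
    because the induction step uses it for \<open>sy S i y\<close> in place of
    \<open>y\<close>.\<close>
  have "\<forall>y \<in> lv n \<inter> fx i. \<exists>u \<in> X. E i u = y" using assms(1)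
  proof (induction rule: downward_induct[of _ n])
    case (base i)
    then show ?case using E_base lv_X by blast
  next
    case (step i)
    show ?case
    proof (cases "i > n")
      case True
      then show ?thesis using E_base lv_X by blast
    next
      \<comment> \<open>For \<open>i \<le> n\<close> the symmetry stays within \<open>lv n\<close>:
        a direction \<open>k > n\<close> is either \<open>Suc i\<close>, in which the result is
        fixed anyway, or distinct from both \<open>i\<close> and \<open>Suc i\<close>.\<close>
      case False
      show ?thesis
      proof
        fix y assume y: "y \<in> lv n \<inter> fx i"
        then have s: "sy S i y \<in> fx (Suc i)" using step sy_fx by blast
        moreover have "sy S i y \<in> fx k" if "k > n" for k
          using y s False step that sy_fx_other[of k i y] by (cases "k = Suc i") (auto simp: lv_fx)
        then have "sy S i y \<in> lv n" using fxD[OF s] by (simp add: lv_def)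
        ultimately obtain u where "u \<in> X" "E (Suc i) u = sy S i y" using step by blast
        then show "\<exists>u \<in> X. E i u = y" using step y by (auto simp: E_step[of i] rsy_sy intro!: bexI[of _ u])
      qed
    qed
  qed
  then show ?thesis using n assms by blast
qed

lemma D_closed: "i \<ge> 1 \<Longrightarrow> x \<in> X \<Longrightarrow> D i \<alpha> x \<in> X"
  unfolding D_def by (rule inv_into_into) (use E_surj[of i "\<delta> i \<alpha> x"] in \<open>auto simp: fx_\<delta> intro: rev_image_eqI\<close>)

lemma E_D: "i \<ge> 1 \<Longrightarrow> x \<in> X \<Longrightarrow> E i (D i \<alpha> x) = \<delta> i \<alpha> x"
  unfolding D_def by (rule f_inv_into_f) (use E_surj[of i "\<delta> i \<alpha> x"] in \<open>auto simp: fx_\<delta> intro: rev_image_eqI\<close>)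

text \<open>Identities for faces are verified after applying the injective \<open>E i\<close>, where
  the face becomes a boundary and the axioms of \<open>S\<close> apply.\<close>

lemma D_eqI: "\<lbrakk>i \<ge> 1; x \<in> X; u \<in> X; E i u = \<delta> i \<alpha> x\<rbrakk> \<Longrightarrow> D i \<alpha> x = u"
  using E_inj[of i "D i \<alpha> x" u] by (simp add: D_closed E_D)

lemma \<delta>_E_same: "i \<ge> 1 \<Longrightarrow> x \<in> X \<Longrightarrow> \<delta> i \<alpha> (E i x) = E i x"
  by (simp add: fx_fixed E_fx)

text \<open>Every factor \<open>rsy S k\<close> of \<open>E i\<close> has
  \<open>k \<ge> i > j\<close>, so none of them involves direction \<open>j\<close>.\<close>

lemma \<delta>_E_less: assumes "j \<ge> 1" "j < i" "x \<in> X" shows "\<delta> j \<alpha> (E i x) = E i (\<delta> j \<alpha> x)"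
proof -
  obtain n where n: "x \<in> lv n" using lv_ex assms by blast
  have "i \<ge> 1" using assms by simp
  then have "\<forall>j. 1 \<le> j \<and> j < i \<longrightarrow> \<delta> j \<alpha> (E i x) = E i (\<delta> j \<alpha> x)"
  proof (induction rule: downward_induct[of _ n])
    case (base i)
    then show ?case using n by (auto simp: E_base lv_\<delta>)
  next
    case (step i)
    then show ?case using assms by (auto simp: E_step[of i] \<delta>_closed \<delta>_rsy_other E_fx)
  qed
  then show ?thesis using assms by blast
qed

text \<open>The factors before \<open>rsy S j\<close> do not involve direction \<open>Suc j\<close>;
  \<open>rsy S j\<close> turns \<open>\<delta> (Suc j)\<close> into \<open>\<delta> j\<close>; and
  the factors after it do not involve direction \<open>j\<close>.\<close>

lemma \<delta>_E_greater: assumes "i \<ge> 1" "i \<le> j" "x \<in> X" shows "\<delta> (Suc j) \<alpha> (E i x) = E i (\<delta> j \<alpha> x)"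
proof -
  obtain n where n: "x \<in> lv n" using lv_ex assms by blast
  have "\<forall>j \<ge> i. \<delta> (Suc j) \<alpha> (E i x) = E i (\<delta> j \<alpha> x)" using assms(1)
  proof (induction rule: downward_induct[of _ n])
    case (base i)
    then show ?case using n by (auto simp: E_base lv_\<delta> fx_fixed lv_fx)
  next
    case (step i)
    show ?case
    proof (intro allI impI)
      fix j assume "j \<ge> i"
      then consider "j = i" | "j \<ge> Suc i" by linarith
      then show "\<delta> (Suc j) \<alpha> (E i x) = E i (\<delta> j \<alpha> x)"
        by cases (use step assms in \<open>auto simp: E_step[of i] \<delta>_closed \<delta>_rsy_same \<delta>_rsy_other E_fx \<delta>_E_less\<close>)
    qed
  qed
  then show ?thesis using assms by blast
qed

lemma E_circ_greater:
  assumes "j \<ge> 1" "j < i" "x \<in> X" "y \<in> X" "\<delta> j Plus x = \<delta> j Minus y"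
  shows "\<delta> j Plus (E i x) = \<delta> j Minus (E i y) \<and> E i (circ S j x y) = circ S j (E i x) (E i y)"
proof -
  obtain n where n: "x \<in> lv n" "y \<in> lv n" using lv_ex2 assms by blast
  have "i \<ge> 1" using assms by simp
  then have "j < i \<longrightarrow> E i (circ S j x y) = circ S j (E i x) (E i y)"
  proof (induction rule: downward_induct[of _ n])
    case (base i)
    then show ?case using n assms by (auto simp: E_base lv_circ)
  next
    case (step i)
    then show ?case using assms
      by (auto simp: E_step[of i] circ_closed rsy_circ_other E_fx \<delta>_E_less)
  qed
  then show ?thesis using assms by (simp add: \<delta>_E_less)
qed

text \<open>The inner factors, of index above \<open>j\<close>, preserve composition in direction
  \<open>j\<close>. The factor \<open>rsy S j\<close> turns it into composition in direction
  \<open>Suc j\<close>, which the outer factors preserve.\<close>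

lemma E_circ_le:
  assumes "i \<ge> 1" "i \<le> j" "x \<in> X" "y \<in> X" "\<delta> j Plus x = \<delta> j Minus y"
  shows "\<delta> (Suc j) Plus (E i x) = \<delta> (Suc j) Minus (E i y) \<and> E i (circ S j x y) = circ S (Suc j) (E i x) (E i y)"
proof -
  obtain n where n: "x \<in> lv n" "y \<in> lv n" using lv_ex2 assms by blast
  have "i \<le> j \<longrightarrow> E i (circ S j x y) = circ S (Suc j) (E i x) (E i y)" using assms(1)
  proof (induction rule: downward_induct[of _ n])
    case (base i)
    show ?case
    proof
      assume "i \<le> j"
      \<comment> \<open>Above the dimension, both cells are fixed in the direction of composition,
        so composable means equal and the claim is about idempotent composites.\<close>
      then have fx: "x \<in> fx j" "y \<in> fx j" "x \<in> fx (Suc j)" and j: "j \<ge> 1" "Suc j \<ge> 1" using n base by (auto simp: lv_fx)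
      then have "x = y" using assms fx_fixed by simp
      then show "E i (circ S j x y) = circ S (Suc j) (E i x) (E i y)"
        using fx j base n by (simp add: circ_idem E_base)
    qed
  next
    case (step i)
    show ?case
    proof
      assume "i \<le> j"
      then consider "j = i" | "j \<ge> Suc i" by linarith
      then show "E i (circ S j x y) = circ S (Suc j) (E i x) (E i y)"
      proof cases
        case 1
        then show ?thesis
          using step assms E_circ_greater[of i "Suc i" x y] by (simp add: E_step[of i] circ_closed rsy_circ_next E_fx)
      next
        case j: 2
        then show ?thesis
          using step assms by (simp add: E_step[of i] circ_closed rsy_circ_other E_fx \<delta>_E_greater)
      qed
    qed
  qed
  then show ?thesis using assms by (simp add: \<delta>_E_greater)
qed

lemma E_fx_greater: "\<lbrakk>i \<ge> 1; i \<le> j; x \<in> fx j\<rbrakk> \<Longrightarrow> E i x \<in> fx (Suc j)"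
  using \<delta>_E_greater[of i j x Minus] by (simp add: fx_iff[of _ _ Minus] E_closed)

lemma E_fx_less: "\<lbrakk>j \<ge> 1; j < i; x \<in> fx j\<rbrakk> \<Longrightarrow> E i x \<in> fx j"
  using \<delta>_E_less[of j i x Minus] by (simp add: fx_iff[of _ _ Minus] E_closed)

section \<open>Interchange of degeneracies\<close>

lemma rsy_lv: "\<lbrakk>1 \<le> j; j \<le> n; y \<in> lv n; y \<in> fx (Suc j)\<rbrakk> \<Longrightarrow> rsy S j y \<in> lv (Suc n)"
  by (auto simp: lv_def rsy_fx_other fxD[OF rsy_fx])

lemma E_rsy_greater:
  assumes "j \<ge> 1" "Suc j < k" "y \<in> fx (Suc j)"
  shows "E k (rsy S j y) = rsy S j (E k y)"
proof -
  obtain n0 where n0: "y \<in> lv n0" using lv_ex assms fxD by blast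
  \<comment> \<open>With \<open>j \<le> n\<close>, every direction above \<open>Suc n\<close>
    differs from \<open>j\<close> and \<open>Suc j\<close>, so \<open>rsy S j y\<close> has
    dimension at most \<open>Suc n\<close>. The induction therefore starts above
    \<open>Suc n\<close>, one higher than for \<open>y\<close>.\<close>
  define n where "n = max j n0"
  have n: "y \<in> lv n" "j \<le> n" using n0 lv_mono[of n0 n y] by (auto simp: n_def)
  have y: "y \<in> X" using assms fxD by blast
  have "k \<ge> 1" using assms by simp
  then have "Suc j < k \<longrightarrow> E k (rsy S j y) = rsy S j (E k y)"
  proof (induction rule: downward_induct[of _ "Suc n"])
    case (base k)
    then show ?case using n assms E_base[of "Suc n" k "rsy S j y"] E_base[of n k y] by (simp add: rsy_lv)
  next
    case (step k)
    then show ?case using assms y rsy_rsy_less[of j k "E (Suc k) y"]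
      by (auto simp: E_step[of k] fxD[OF rsy_fx] rsy_rsy_less E_fx E_fx_less)
  qed
  then show ?thesis using assms by simp
qed

text \<open>In the descent from \<open>j\<close> to \<open>i\<close>, each new factor
  \<open>rsy S i'\<close> has index at least two below \<open>Suc j\<close> and commutes with
  \<open>rsy S (Suc j)\<close>. The starting case \<open>i = j\<close> is a braid relation, in which
  both sides are reduced to the same pair of factors.\<close>

lemma E_rsy_le:
  assumes "i \<ge> 1" "i \<le> j" "y \<in> fx (Suc j)"
  shows "E i (rsy S j y) = rsy S (Suc j) (E i y)"
proof -
  have y: "y \<in> X" using assms fxD by blast
  show ?thesis using assms(2)
  proof (induction rule: inc_induct)
    case base
    let ?z = "E (Suc (Suc j)) y"
    have j: "j \<ge> 1" using assms by simp
    \<comment> \<open>\<open>?z\<close> is fixed in direction \<open>Suc (Suc j)\<close> as a value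
      of \<open>E\<close>, and inherits direction \<open>Suc j\<close> from
      \<open>y\<close>.\<close>
    have z: "?z \<in> fx (Suc j)" "?z \<in> fx (Suc (Suc j))" using assms y by (auto simp: E_fx E_fx_less)
    have "E j (rsy S j y) = rsy S j (rsy S (Suc j) (rsy S j ?z))"
      using j assms y by (simp add: E_step[of j] E_step[of "Suc j"] fxD[OF rsy_fx] E_rsy_greater)
    \<comment> \<open>The outermost factor acts on a cell fixed in directions \<open>j\<close> and
      \<open>Suc j\<close>, so it disappears; in the next equation a trivial factor
      \<open>rsy S (Suc j)\<close> is inserted at \<open>?z\<close> instead.\<close>
    also have "\<dots> = rsy S (Suc j) (rsy S j ?z)"
      using j z by (intro rsy_fixed) (auto simp: rsy_fx rsy_fx_other)
    also have "\<dots> = rsy S (Suc j) (rsy S j (rsy S (Suc j) ?z))"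
      using z by (simp add: rsy_fixed)
    also have "\<dots> = rsy S (Suc j) (E j y)"
      using j y by (simp add: E_step[of j] E_step[of "Suc j"])
    finally show ?case .
  next
    case (step i')
    then have i': "1 \<le> i'" using assms by simp
    have "E i' (rsy S j y) = rsy S i' (rsy S (Suc j) (E (Suc i') y))"
      using step i' assms by (simp add: E_step[of i'] fxD[OF rsy_fx])
    also have "\<dots> = rsy S (Suc j) (rsy S i' (E (Suc i') y))"
      using step i' assms y by (intro rsy_rsy_less) (auto simp: E_fx E_fx_greater)
    also have "\<dots> = rsy S (Suc j) (E i' y)" using i' y by (simp add: E_step[of i'])
    finally show ?case .
  qed
qed

text \<open>Splitting \<open>rsy S j\<close> off \<open>E j\<close>, \<open>E_rsy_le\<close> moves
  \<open>E i\<close> past it as \<open>rsy S (Suc j)\<close>, which recombines with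
  \<open>E (Suc (Suc j))\<close> to give \<open>E (Suc j)\<close>.\<close>

lemma E_E:
  assumes "i \<ge> 1" "i \<le> j" "x \<in> X"
  shows "E i (E j x) = E (Suc j) (E i x)"
proof -
  obtain n where n: "x \<in> lv n" using lv_ex assms by blast
  have "j \<ge> 1" using assms by simp
  then have "\<forall>i. 1 \<le> i \<and> i \<le> j \<longrightarrow> E i (E j x) = E (Suc j) (E i x)"
  proof (induction rule: downward_induct[of _ n])
    case (base j)
    show ?case
    proof (intro allI impI)
      fix i assume i: "1 \<le> i \<and> i \<le> j"
      \<comment> \<open>\<open>E i\<close> moves the fixed directions from \<open>i\<close> on up by
        one; since \<open>n < j\<close>, the dimension of \<open>E i x\<close> is still at most
        \<open>j\<close>, so \<open>E (Suc j)\<close> acts trivially on it.\<close>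
      have "E i x \<in> lv j"
        unfolding lv_def
      proof (intro CollectI conjI allI impI)
        fix k assume "k > j"
        then obtain k' where "k = Suc k'" "k' \<ge> j" by (cases k) auto
        then show "E i x \<in> fx k" using E_fx_greater[of i k' x] n base i by (simp add: lv_fx)
      qed (use i assms E_closed in simp)
      then have "E (Suc j) (E i x) = E i x" by (intro E_base[of j]) auto
      then show "E i (E j x) = E (Suc j) (E i x)" using base n by (simp add: E_base[of n])
    qed
  next
    case (step j)
    show ?case
    proof (intro allI impI)
      fix i assume i: "1 \<le> i \<and> i \<le> j"
      have "E i (E j x) = rsy S (Suc j) (E i (E (Suc j) x))"
        using step i assms by (simp add: E_step[of j] E_rsy_le E_fx)
      also have "\<dots> = rsy S (Suc j) (E (Suc (Suc j)) (E i x))"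
        using step i by simp
      also have "\<dots> = E (Suc j) (E i x)"
        using i assms by (simp add: E_step[of "Suc j"] E_closed)
      finally show "E i (E j x) = E (Suc j) (E i x)" .
    qed
  qed
  then show ?thesis using assms by blast
qed

section \<open>Laws for faces and verification of the level-free axioms\<close>

lemma D_iff: "\<lbrakk>i \<ge> 1; x \<in> X; y \<in> X\<rbrakk> \<Longrightarrow> D i \<alpha> x = D i \<beta> y \<longleftrightarrow> \<delta> i \<alpha> x = \<delta> i \<beta> y"
  using E_inj[of i "D i \<alpha> x" "D i \<beta> y"] by (simp add: D_closed E_D)

lemma \<delta>_D_less:
  assumes "i \<ge> 1" "i \<le> j" "x \<in> X"
  shows "\<delta> j \<beta> (D i \<alpha> x) = D i \<alpha> (\<delta> (Suc j) \<beta> x)"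
proof (rule D_eqI[symmetric])
  show "E i (\<delta> j \<beta> (D i \<alpha> x)) = \<delta> i \<alpha> (\<delta> (Suc j) \<beta> x)"
    using assms by (simp add: D_closed E_D bd_bd[of i "Suc j"] flip: \<delta>_E_greater)
qed (use assms in \<open>auto simp: D_closed \<delta>_closed\<close>)

lemma \<delta>_D_greater:
  assumes "j \<ge> 1" "j < i" "x \<in> X"
  shows "\<delta> j \<beta> (D i \<alpha> x) = D i \<alpha> (\<delta> j \<beta> x)"
proof (rule D_eqI[symmetric])
  show "E i (\<delta> j \<beta> (D i \<alpha> x)) = \<delta> i \<alpha> (\<delta> j \<beta> x)"
    using assms by (simp add: D_closed E_D bd_bd[of i j] flip: \<delta>_E_less)
qed (use assms in \<open>auto simp: D_closed \<delta>_closed\<close>)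

lemma stable: "stable_cubical X D E (circ S)"
proof (rule stable_cubical.intro)
  fix i :: nat and x \<alpha> assume *: "i \<ge> 1" "x \<in> X"
  show "D i \<alpha> x \<in> X" "E i x \<in> X" "circ S i x (E i (D i Plus x)) = x"
    "circ S i (E i (D i Minus x)) x = x" "D i \<alpha> (E i x) = x"
    using * by (simp_all add: D_closed E_closed E_D circ_\<delta>_right circ_\<delta>_left D_eqI \<delta>_E_same)
next
  fix i :: nat and x y assume *: "i \<ge> 1" "x \<in> X" "y \<in> X" "D i Plus x = D i Minus y"
  then show "circ S i x y \<in> X" "D i Minus (circ S i x y) = D i Minus x" "D i Plus (circ S i x y) = D i Plus y"
    by (simp_all add: D_iff circ_closed circ_\<delta>)
next
  fix i :: nat and x y z assume *: "i \<ge> 1" "x \<in> X" "y \<in> X" "z \<in> X"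
    "D i Plus x = D i Minus y" "D i Plus y = D i Minus z"
  then show "circ S i x (circ S i y z) = circ S i (circ S i x y) z"
    by (simp add: D_iff circ_assoc)
next
  fix i j :: nat and x \<alpha> \<beta> assume *: "i \<ge> 1" "i \<le> j" "x \<in> X"
  show "D i \<alpha> (D (Suc j) \<beta> x) = D j \<beta> (D i \<alpha> x)"
  proof (rule D_eqI)
    \<comment> \<open>The comparison is made under the injective \<open>E (Suc j)\<close>: there
      both faces become boundaries of \<open>x\<close>, and these commute.\<close>
    have "E (Suc j) (E i (D j \<beta> (D i \<alpha> x))) = E i (\<delta> j \<beta> (D i \<alpha> x))"
      using * by (simp add: D_closed E_D flip: E_E)
    also have "\<dots> = \<delta> i \<alpha> (E (Suc j) (D (Suc j) \<beta> x))"
      using * by (simp add: D_closed E_D bd_bd[of i "Suc j"] flip: \<delta>_E_greater)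
    also have "\<dots> = E (Suc j) (\<delta> i \<alpha> (D (Suc j) \<beta> x))"
      using * by (simp add: D_closed \<delta>_E_less)
    finally show "E i (D j \<beta> (D i \<alpha> x)) = \<delta> i \<alpha> (D (Suc j) \<beta> x)"
      using * by (simp add: E_inj D_closed E_closed \<delta>_closed)
  qed (use * in \<open>simp_all add: D_closed\<close>)
  show "D i \<alpha> (E (Suc j) x) = E j (D i \<alpha> x)"
    by (rule D_eqI) (use * in \<open>simp_all add: E_closed D_closed E_E E_D \<delta>_E_less\<close>)
  show "D (Suc j) \<alpha> (E i x) = E i (D j \<alpha> x)"
    by (rule D_eqI) (use * in \<open>simp_all add: E_closed D_closed E_D \<delta>_E_greater flip: E_E\<close>)
  show "E i (E j x) = E (Suc j) (E i x)"
    using * by (rule E_E)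
next
  fix i j :: nat and x y \<alpha> assume *: "i \<ge> 1" "i \<le> j" "x \<in> X" "y \<in> X" "D (Suc j) Plus x = D (Suc j) Minus y"
  then have eq: "\<delta> (Suc j) Plus x = \<delta> (Suc j) Minus y" by (simp add: D_iff)
  have eq': "\<delta> j Plus (D i \<alpha> x) = \<delta> j Minus (D i \<alpha> y)"
    using * eq by (simp add: \<delta>_D_less)
  show "D i \<alpha> (circ S (Suc j) x y) = circ S j (D i \<alpha> x) (D i \<alpha> y)"
  proof (rule D_eqI)
    show "E i (circ S j (D i \<alpha> x) (D i \<alpha> y)) = \<delta> i \<alpha> (circ S (Suc j) x y)"
      using * eq eq' by (simp add: E_circ_le D_closed E_D bd_circ composable_iff)
  qed (use * eq eq' in \<open>simp_all add: circ_closed D_closed\<close>)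
next
  fix i j :: nat and x y \<alpha> assume *: "j \<ge> 1" "j < i" "x \<in> X" "y \<in> X" "D j Plus x = D j Minus y"
  then have eq: "\<delta> j Plus x = \<delta> j Minus y" by (simp add: D_iff)
  have eq': "\<delta> j Plus (D i \<alpha> x) = \<delta> j Minus (D i \<alpha> y)"
    using * eq by (simp add: \<delta>_D_greater)
  show "D i \<alpha> (circ S j x y) = circ S j (D i \<alpha> x) (D i \<alpha> y)"
  proof (rule D_eqI)
    show "E i (circ S j (D i \<alpha> x) (D i \<alpha> y)) = \<delta> i \<alpha> (circ S j x y)"
      using * eq eq' by (simp add: E_circ_greater D_closed E_D bd_circ composable_iff)
  qed (use * eq eq' in \<open>simp_all add: circ_closed D_closed\<close>)
  show "E i (circ S j x y) = circ S j (E i x) (E i y)"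
    using * eq by (simp add: E_circ_greater)
next
  fix i j :: nat and w x y z assume "i \<ge> 1" "j \<ge> 1" "i \<noteq> j" "w \<in> X" "x \<in> X" "y \<in> X" "z \<in> X"
    "D i Plus w = D i Minus x" "D i Plus y = D i Minus z"
    "D j Plus w = D j Minus y" "D j Plus x = D j Minus z"
  then show "circ S j (circ S i w x) (circ S i y z) = circ S i (circ S j w y) (circ S j x z)"
    by (simp add: interchange composable_iff D_iff)
next
  fix i j :: nat and x y assume *: "i \<ge> 1" "i \<le> j" "x \<in> X" "y \<in> X" "D j Plus x = D j Minus y"
  then show "E i (circ S j x y) = circ S (Suc j) (E i x) (E i y)"
    by (simp add: D_iff E_circ_le)
next
  fix x assume "x \<in> X"
  then show "\<exists>n. \<forall>i > n. E i x = x" using lv_ex E_base by blast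
qed

end

section \<open>From strict classical to level-free structures\<close>

locale strict_cubical = classical_cubical_omega_category C for C :: "'a cubcat" +
  assumes degen_last: "a \<in> ncells C n \<Longrightarrow> degen C (Suc n) (Suc n) a = a"
begin

abbreviation "K \<equiv> ncells C"

lemma face_in: "\<lbrakk>1 \<le> i; i \<le> n; a \<in> K n\<rbrakk> \<Longrightarrow> face C n i \<alpha> a \<in> K (n - 1)"
  using face_type by blast

lemma degen_in: "\<lbrakk>1 \<le> i; i \<le> n; a \<in> K (n - 1)\<rbrakk> \<Longrightarrow> degen C n i a \<in> K n"
  using degen_type by blast

lemma K_Suc: "a \<in> K n \<Longrightarrow> a \<in> K (Suc n)"
  using degen_in[of "Suc n" "Suc n" a] by (simp add: degen_last)

lemma K_mono: "m \<le> n \<Longrightarrow> a \<in> K m \<Longrightarrow> a \<in> K n"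
  by (induction rule: dec_induct) (auto intro: K_Suc)

text \<open>Replacing \<open>a\<close> by its last degeneracy turns the axiom on faces of
  degeneracies into independence of the level. \<open>degen_Suc\<close> and \<open>star_Suc\<close>
  use \<open>degen_degen\<close> and \<open>degen_star_greater\<close> in the same way.\<close>

lemma face_Suc:
  assumes "1 \<le> i" "i \<le> n" "a \<in> K n"
  shows "face C (Suc n) i \<alpha> a = face C n i \<alpha> a"
proof -
  have "face C (Suc n) i \<alpha> (degen C (Suc n) (Suc n) a) = degen C n n (face C n i \<alpha> a)"
    using assms face_degen_less[of i "Suc n" "Suc n" a \<alpha>] by simp
  then show ?thesis
    using assms face_in[of i n a \<alpha>] degen_last[of "face C n i \<alpha> a" "n - 1"] by (simp add: degen_last)
qed

lemma degen_Suc: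
  assumes "1 \<le> i" "i \<le> n" "a \<in> K (n - 1)"
  shows "degen C (Suc n) i a = degen C n i a"
  using assms degen_degen[of i n n a] degen_in[of i n a] degen_last[of a "n - 1"] by (simp add: degen_last)

lemma star_dom_Suc: "\<lbrakk>1 \<le> i; i \<le> n; a \<in> K n; b \<in> K n\<rbrakk> \<Longrightarrow> star_dom C (Suc n) i a b \<longleftrightarrow> star_dom C n i a b"
  by (simp add: star_dom_def face_Suc K_Suc)

lemma star_Suc:
  assumes "1 \<le> i" "i \<le> n" "star_dom C n i a b"
  shows "star C (Suc n) i a b = star C n i a b"
  using assms degen_star_greater[of i n "Suc n" a b] star_closed[of i n a b]
  by (simp add: degen_last star_dom_def)

lemma face_mono: "m \<le> n \<Longrightarrow> 1 \<le> i \<Longrightarrow> i \<le> m \<Longrightarrow> a \<in> K m \<Longrightarrow> face C n i \<alpha> a = face C m i \<alpha> a"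
  by (induction rule: dec_induct) (simp_all add: face_Suc K_mono[of m])

lemma degen_mono: "m \<le> n \<Longrightarrow> 1 \<le> i \<Longrightarrow> i \<le> m \<Longrightarrow> a \<in> K (m - 1) \<Longrightarrow> degen C n i a = degen C m i a"
proof (induction rule: dec_induct)
  case (step n)
  then show ?case using K_mono[of "m - 1" "n - 1" a] by (simp add: degen_Suc)
qed simp

lemma star_mono: "m \<le> n \<Longrightarrow> 1 \<le> i \<Longrightarrow> i \<le> m \<Longrightarrow> star_dom C m i a b
  \<Longrightarrow> star_dom C n i a b \<and> star C n i a b = star C m i a b"
proof (induction rule: dec_induct)
  case (step n)
  then have "a \<in> K n" "b \<in> K n" by (auto simp: star_dom_def)
  then show ?case using step by (simp add: star_Suc star_dom_Suc)
qed simp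

definition "X = (\<Union>n. K n)"

definition lvl :: "'a \<Rightarrow> nat" where "lvl a = (LEAST n. a \<in> K n)"

text \<open>The operations are evaluated at the least level that contains the cells and has
  direction \<open>i\<close>; by \<open>d_eq\<close>, \<open>e_eq\<close> and \<open>c_eq\<close>
  every higher level gives the same value.\<close>

definition d :: "nat \<Rightarrow> sign \<Rightarrow> 'a \<Rightarrow> 'a" where
  "d i \<alpha> a = face C (max i (lvl a)) i \<alpha> a"

text \<open>The extra \<open>Suc\<close> is due to \<open>degen C n\<close> starting from level
  \<open>n - 1\<close>.\<close>

definition e :: "nat \<Rightarrow> 'a \<Rightarrow> 'a" where
  "e i a = degen C (max i (Suc (lvl a))) i a"

definition c :: "nat \<Rightarrow> 'a \<Rightarrow> 'a \<Rightarrow> 'a" where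
  "c i a b = star C (max i (max (lvl a) (lvl b))) i a b"

lemma lvl: "a \<in> K n \<Longrightarrow> a \<in> K (lvl a) \<and> lvl a \<le> n"
  unfolding lvl_def by (auto intro: LeastI Least_le)

lemma K_X: "a \<in> K n \<Longrightarrow> a \<in> X"
  by (auto simp: X_def)

lemma d_eq: "\<lbrakk>1 \<le> i; i \<le> n; a \<in> K n\<rbrakk> \<Longrightarrow> d i \<alpha> a = face C n i \<alpha> a"
  unfolding d_def using lvl[of a n] K_mono[of "lvl a" "max i (lvl a)" a] by (intro face_mono[symmetric]) auto

lemma e_eq: "\<lbrakk>1 \<le> i; i \<le> n; a \<in> K (n - 1)\<rbrakk> \<Longrightarrow> e i a = degen C n i a"
  unfolding e_def using lvl[of a "n - 1"] K_mono[of "lvl a" "max i (Suc (lvl a)) - 1" a]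
  by (intro degen_mono[symmetric]) auto

lemma star_dom_iff: "\<lbrakk>1 \<le> i; i \<le> n\<rbrakk> \<Longrightarrow> star_dom C n i a b \<longleftrightarrow> a \<in> K n \<and> b \<in> K n \<and> d i Plus a = d i Minus b"
  by (auto simp: star_dom_def d_eq)

lemma c_eq:
  assumes "1 \<le> i" "i \<le> n" "star_dom C n i a b" shows "c i a b = star C n i a b"
proof -
  let ?m = "max i (max (lvl a) (lvl b))"
  have *: "a \<in> K n" "b \<in> K n" "d i Plus a = d i Minus b" using assms by (simp_all add: star_dom_iff)
  then have "?m \<le> n" "a \<in> K ?m" "b \<in> K ?m"
    using lvl[of a n] lvl[of b n] K_mono[of "lvl a" ?m a] K_mono[of "lvl b" ?m b] assms by auto
  moreover have "star_dom C ?m i a b" using * assms calculation by (subst star_dom_iff) auto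
  ultimately show ?thesis unfolding c_def using star_mono[of ?m n i a b] assms by simp
qed

text \<open>Each level-free axiom concerns finitely many cells and directions, so it can be checked
  in a single level \<open>n\<close> above a prescribed bound \<open>m\<close>.\<close>

lemma common_level: "finite A \<Longrightarrow> A \<subseteq> X \<Longrightarrow> \<exists>n \<ge> m. A \<subseteq> K n"
proof (induction rule: finite_induct)
  case (insert a A)
  then obtain k n where "a \<in> K k" "n \<ge> m" "A \<subseteq> K n" by (auto simp: X_def)
  then show ?case using K_mono[of k "max k n" a] K_mono[of n "max k n"] by (intro exI[of _ "max k n"]) auto
qed auto

lemma e_last: "a \<in> K n \<Longrightarrow> n < i \<Longrightarrow> e i a = a"
  using e_eq[of i i a] degen_last[of a "i - 1"] K_mono[of n "i - 1" a] by simp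

lemma stable: "stable_cubical X d e c"
proof (rule stable_cubical.intro)
  fix i :: nat and x \<alpha> assume *: "1 \<le> i" "x \<in> X"
  then obtain n where n: "n \<ge> i" "x \<in> K n" using common_level[of "{x}" i] by auto
  show "d i \<alpha> x \<in> X" using * n by (simp add: d_eq[of i n] K_X[OF face_in])
  show "e i x \<in> X" using * n by (simp add: e_eq[of i "Suc n"] K_X[OF degen_in])
  have f: "face C n i \<alpha> x \<in> K (n - 1)" for \<alpha> using * n by (intro face_in) auto
  have "star_dom C n i x (degen C n i (face C n i Plus x))" "star_dom C n i (degen C n i (face C n i Minus x)) x"
    using * n f by (simp_all add: star_dom_def degen_in face_degen_same)
  then show "c i x (e i (d i Plus x)) = x" "c i (e i (d i Minus x)) x = x"
    using * n f by (simp_all add: d_eq[of i n] e_eq[of i n] c_eq[of i n] star_unit_left star_unit_right)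
  show "d i \<alpha> (e i x) = x"
    using * n degen_in[of i "Suc n" x] by (simp add: e_eq[of i "Suc n"] d_eq[of i "Suc n"] face_degen_same)
next
  fix i :: nat and x y assume *: "1 \<le> i" "x \<in> X" "y \<in> X" "d i Plus x = d i Minus y"
  then obtain n where n: "n \<ge> i" "x \<in> K n" "y \<in> K n" using common_level[of "{x, y}" i] by auto
  have dom: "star_dom C n i x y" using * n by (simp add: star_dom_iff)
  have cl: "star C n i x y \<in> K n" using dom * n by (simp add: star_closed)
  then show "c i x y \<in> X" using * n dom by (auto simp: c_eq[of i n] intro: K_X)
  show "d i Minus (c i x y) = d i Minus x" "d i Plus (c i x y) = d i Plus y"
    using * n dom cl face_star_minus[of i n x y] face_star_plus[of i n x y]
    by (simp_all add: c_eq[of i n] d_eq[of i n])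
next
  fix i :: nat and x y z assume *: "1 \<le> i" "x \<in> X" "y \<in> X" "z \<in> X" "d i Plus x = d i Minus y" "d i Plus y = d i Minus z"
  then obtain n where n: "n \<ge> i" "x \<in> K n" "y \<in> K n" "z \<in> K n" using common_level[of "{x, y, z}" i] by auto
  have dom: "star_dom C n i x y" "star_dom C n i y z" using * n by (simp_all add: star_dom_iff)
  then have "star C n i x y \<in> K n" "star C n i y z \<in> K n" using * n by (simp_all add: star_closed)
  then have "star_dom C n i (star C n i x y) z" "star_dom C n i x (star C n i y z)"
    using dom * n by (simp_all add: star_dom_def face_star_minus face_star_plus)
  then show "c i x (c i y z) = c i (c i x y) z"
    using dom * n by (simp add: c_eq[of i n] star_assoc)
next
  fix i j :: nat and x \<alpha> \<beta> assume *: "1 \<le> i" "i \<le> j" "x \<in> X"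
  then obtain n where n: "n \<ge> Suc j" "x \<in> K n" using common_level[of "{x}" "Suc j"] by auto
  show "d i \<alpha> (d (Suc j) \<beta> x) = d j \<beta> (d i \<alpha> x)"
    using * n face_face[of i "Suc j" n x \<alpha> \<beta>] face_in[of i n x] face_in[of "Suc j" n x]
    by (simp add: d_eq[of i n] d_eq[of "Suc j" n] d_eq[of i "n - 1"] d_eq[of j "n - 1"])
  show "d i \<alpha> (e (Suc j) x) = e j (d i \<alpha> x)"
    using * n face_degen_less[of i "Suc j" "Suc n" x] degen_in[of "Suc j" "Suc n" x] face_in[of i n x]
    by (simp add: e_eq[of "Suc j" "Suc n"] d_eq[of i n] d_eq[of i "Suc n"] e_eq[of j n])
  show "d (Suc j) \<alpha> (e i x) = e i (d j \<alpha> x)"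
    using * n face_degen_greater[of i "Suc j" "Suc n" x] degen_in[of i "Suc n" x] face_in[of j n x]
    by (simp add: e_eq[of i "Suc n"] d_eq[of j n] d_eq[of "Suc j" "Suc n"] e_eq[of i n])
  show "e i (e j x) = e (Suc j) (e i x)"
    using * n degen_degen[of i j "Suc n" x] degen_in[of i "Suc n" x] degen_in[of j "Suc n" x]
    by (simp add: e_eq[of i "Suc n"] e_eq[of j "Suc n"] e_eq[of i "Suc (Suc n)"] e_eq[of "Suc j" "Suc (Suc n)"])
next
  fix i j :: nat and x y \<alpha> assume *: "1 \<le> i" "i \<le> j" "x \<in> X" "y \<in> X" "d (Suc j) Plus x = d (Suc j) Minus y"
  then obtain n where n: "n \<ge> Suc j" "x \<in> K n" "y \<in> K n" using common_level[of "{x, y}" "Suc j"] by auto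
  have dom: "star_dom C n (Suc j) x y" using * n by (simp add: star_dom_iff)
  have "face C (n - 1) j Plus (face C n i \<alpha> x) = face C (n - 1) j Minus (face C n i \<alpha> y)"
    using * n dom face_face[of i "Suc j" n x \<alpha> Plus] face_face[of i "Suc j" n y \<alpha> Minus] by (simp add: star_dom_def)
  then have dom': "star_dom C (n - 1) j (face C n i \<alpha> x) (face C n i \<alpha> y)"
    using * n by (simp add: star_dom_def face_in[simplified])
  show "d i \<alpha> (c (Suc j) x y) = c j (d i \<alpha> x) (d i \<alpha> y)"
    using * n dom dom' star_closed[of "Suc j" n x y] face_star_less[of i "Suc j" n x y \<alpha>]
    by (simp add: c_eq[of "Suc j" n] d_eq[of i n] c_eq[of j "n - 1"])
next
  fix i j :: nat and x y \<alpha> assume *: "1 \<le> j" "j < i" "x \<in> X" "y \<in> X" "d j Plus x = d j Minus y"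
  then obtain n where n: "n \<ge> i" "x \<in> K n" "y \<in> K n" using common_level[of "{x, y}" i] by auto
  have dom: "star_dom C n j x y" using * n by (simp add: star_dom_iff)
  have "face C (n - 1) j Plus (face C n i \<alpha> x) = face C (n - 1) j Minus (face C n i \<alpha> y)"
    using * n dom face_face[of j i n x Plus \<alpha>] face_face[of j i n y Minus \<alpha>] by (simp add: star_dom_def)
  then have dom': "star_dom C (n - 1) j (face C n i \<alpha> x) (face C n i \<alpha> y)"
    using * n by (simp add: star_dom_def face_in[simplified])
  show "d i \<alpha> (c j x y) = c j (d i \<alpha> x) (d i \<alpha> y)"
    using * n dom dom' star_closed[of j n x y] face_star_greater[of j i n x y \<alpha>]
    by (simp add: c_eq[of j n] d_eq[of i n] c_eq[of j "n - 1"])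
  have "face C (Suc n) j Plus (degen C (Suc n) i x) = face C (Suc n) j Minus (degen C (Suc n) i y)"
    using * n dom face_degen_less[of j i "Suc n" x Plus] face_degen_less[of j i "Suc n" y Minus] by (simp add: star_dom_def)
  then have "star_dom C (Suc n) j (degen C (Suc n) i x) (degen C (Suc n) i y)"
    using * n by (simp add: star_dom_def degen_in)
  then show "e i (c j x y) = c j (e i x) (e i y)"
    using * n dom star_closed[of j n x y] degen_star_greater[of j n i x y]
    by (simp add: c_eq[of j n] e_eq[of i "Suc n"] c_eq[of j "Suc n"])
next
  fix i j :: nat and w x y z assume *: "1 \<le> i" "1 \<le> j" "i \<noteq> j" "w \<in> X" "x \<in> X" "y \<in> X" "z \<in> X"
    "d i Plus w = d i Minus x" "d i Plus y = d i Minus z" "d j Plus w = d j Minus y" "d j Plus x = d j Minus z"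
  then obtain n where n: "n \<ge> max i j" "w \<in> K n" "x \<in> K n" "y \<in> K n" "z \<in> K n"
    using common_level[of "{w, x, y, z}" "max i j"] by auto
  have dom: "star_dom C n i w x" "star_dom C n i y z" "star_dom C n j w y" "star_dom C n j x z"
    using * n by (simp_all add: star_dom_iff)
  have cl: "star C n i w x \<in> K n" "star C n i y z \<in> K n" "star C n j w y \<in> K n" "star C n j x z \<in> K n"
    using * n dom by (simp_all add: star_closed)
  have "face C n j Plus (star C n i w x) = face C n j Minus (star C n i y z)"
    using * n dom face_star_less[of j i n w x Plus] face_star_less[of j i n y z Minus]
      face_star_greater[of i j n w x Plus] face_star_greater[of i j n y z Minus]
    by (cases "i < j") (simp_all add: star_dom_def)
  moreover have "face C n i Plus (star C n j w y) = face C n i Minus (star C n j x z)"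
    using * n dom face_star_less[of i j n w y Plus] face_star_less[of i j n x z Minus]
      face_star_greater[of j i n w y Plus] face_star_greater[of j i n x z Minus]
    by (cases "i < j") (simp_all add: star_dom_def)
  ultimately show "c j (c i w x) (c i y z) = c i (c j w y) (c j x z)"
    using * n dom cl by (simp add: c_eq[of i n] c_eq[of j n] star_dom_def star_interchange)
next
  fix i j :: nat and x y assume *: "1 \<le> i" "i \<le> j" "x \<in> X" "y \<in> X" "d j Plus x = d j Minus y"
  then obtain n where n: "n \<ge> j" "x \<in> K n" "y \<in> K n" using common_level[of "{x, y}" j] by auto
  have dom: "star_dom C n j x y" using * n by (simp add: star_dom_iff)
  have "face C (Suc n) (Suc j) Plus (degen C (Suc n) i x) = face C (Suc n) (Suc j) Minus (degen C (Suc n) i y)"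
    using * n dom face_degen_greater[of i "Suc j" "Suc n" x Plus] face_degen_greater[of i "Suc j" "Suc n" y Minus]
    by (simp add: star_dom_def)
  then have "star_dom C (Suc n) (Suc j) (degen C (Suc n) i x) (degen C (Suc n) i y)"
    using * n by (simp add: star_dom_def degen_in)
  then show "e i (c j x y) = c (Suc j) (e i x) (e i y)"
    using * n dom star_closed[of j n x y] degen_star_le[of i j n x y]
    by (simp add: c_eq[of j n] e_eq[of i "Suc n"] c_eq[of "Suc j" "Suc n"])
next
  fix x assume "x \<in> X"
  then show "\<exists>n. \<forall>i > n. e i x = x" using e_last by (auto simp: X_def)
qed

sublocale stable_cubical X d e c by (rule stable)

lemma level_eq: "level X e n = K n"
proof
  show "K n \<subseteq> level X e n" by (auto simp: level_def e_last K_X)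
  show "level X e n \<subseteq> K n"
  proof
    fix x assume x: "x \<in> level X e n"
    then obtain m where m: "x \<in> K m" "n \<le> m"
      using common_level[of "{x}" n] by (auto simp: level_def)
    from m(2) show "x \<in> K n"
    proof (induction rule: inc_induct)
      case base
      show ?case by (rule m(1))
    next
      case (step k)
      \<comment> \<open>A cell fixed by the degeneracy \<open>e (Suc k)\<close> equals its own face
        in direction \<open>Suc k\<close>, and that face lies in \<open>K k\<close>; this descends
        from \<open>K m\<close> to \<open>K n\<close>.\<close>
      have "d (Suc k) Minus x = x" using x step by (intro d_fixed) (auto simp: level_def)
      then show ?case using step face_in[of "Suc k" "Suc k" x Minus] d_eq[of "Suc k" "Suc k" x Minus] by simp
    qed
  qed
qed

lemma truncations_eq: "truncations X d e c = C"
proof (rule cubcat.equality)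
  let ?C = "truncations X d e c"
  show "ncells ?C = ncells C"
    by (auto simp: truncations_def level_eq)
  show "face ?C = face C"
  proof (intro ext)
    fix n i \<alpha> x
    show "face ?C n i \<alpha> x = face C n i \<alpha> x"
    proof (cases "1 \<le> i \<and> i \<le> n")
      case True
      then have "face C n i \<alpha> \<in> extensional (K n)" using face_type[of i n \<alpha>] by (auto simp: PiE_def)
      then show ?thesis using True by (auto simp: truncations_def level_eq d_eq[of i n] extensional_def)
    qed (use out_of_range in \<open>auto simp: truncations_def\<close>)
  qed
  show "degen ?C = degen C"
  proof (intro ext)
    fix n i x
    show "degen ?C n i x = degen C n i x"
    proof (cases "1 \<le> i \<and> i \<le> n")
      case True
      then have "degen C n i \<in> extensional (K (n - 1))" using degen_type[of i n] by (auto simp: PiE_def)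
      then show ?thesis using True by (auto simp: truncations_def level_eq e_eq[of i n] extensional_def)
    qed (use out_of_range in \<open>auto simp: truncations_def\<close>)
  qed
  show "star ?C = star C"
  proof (intro ext)
    fix n i x y
    show "star ?C n i x y = star C n i x y"
    proof (cases "1 \<le> i \<and> i \<le> n")
      case True
      then show ?thesis
        using star_undefined[of i n x y] c_eq[of i n x y] by (auto simp: truncations_def level_eq star_dom_iff)
    qed (use out_of_range in \<open>auto simp: truncations_def\<close>)
  qed
qed simp

end

section \<open>Morphisms and the comparison of hom-sets\<close>

lemma (in stable_cubical) level_lv:
  "x \<in> level X e n \<Longrightarrow> x \<in> single_set_cubical_omega_category.lv T n"
proof -
  interpret S: single_set_cubical_omega_category T by (rule single_set_cubical)
  assume x: "x \<in> level X e n"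
  then have "x \<in> fix_cells T i" if "i > n" for i
    using that fix_cells_single_set[of i] by (force simp: lev_iff intro: rev_image_eqI)
  then show ?thesis using x by (simp add: S.lv_def single_set_simps lev_iff)
qed

text \<open>Both sides satisfy the same recursion, by \<open>E_step\<close> and
  \<open>rsy_e\<close>, and both are the identity in directions above the dimension of
  \<open>x\<close>.\<close>

lemma (in stable_cubical) single_set_E:
  assumes i: "i \<ge> 1" and x: "x \<in> X"
  shows "single_set_cubical_omega_category.E T i x = e i x"
proof -
  interpret S: single_set_cubical_omega_category T by (rule single_set_cubical)
  obtain n where n: "\<forall>i > n. e i x = x" using e_fin x by blast
  then have lv: "x \<in> S.lv n" using x by (intro level_lv) (simp add: lev_iff)
  show ?thesis using i
  proof (induction rule: S.downward_induct[of _ n])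
    case (base i)
    then show ?case using lv n by (simp add: S.E_base)
  next
    case (step i)
    then show ?case using x by (simp add: S.E_step[of i] single_set_simps(1) rsy_e)
  qed
qed

lemma (in stable_cubical) single_set_D:
  assumes "i \<ge> 1" "x \<in> X"
  shows "single_set_cubical_omega_category.D T i \<alpha> x = d i \<alpha> x"
proof -
  interpret S: single_set_cubical_omega_category T by (rule single_set_cubical)
  show ?thesis
    using assms by (intro S.D_eqI) (simp_all add: single_set_simps(1,2) single_set_E d_closed)
qed

definition classical_of :: "'a sincub \<Rightarrow> 'a cubcat" where
  "classical_of T = truncations (cells T) (single_set_cubical_omega_category.D T)
     (single_set_cubical_omega_category.E T) (circ T)"

lemma (in stable_cubical) classical_of_single_set: "classical_of T = truncations X d e c"
proof -
  let ?D = "single_set_cubical_omega_category.D T" and ?E = "single_set_cubical_omega_category.E T"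
  have lev: "level X ?E n = lev n" for n
    by (auto simp: level_def single_set_E)
  have c: "circ T i x y = c i x y" if "Suc 0 \<le> i" "x \<in> lev n" "y \<in> lev n" "d i Plus x = d i Minus y"
    for i n x y using that by (simp add: single_set_simps lev_X)
  show ?thesis
    unfolding classical_of_def truncations_def
    by (auto simp: single_set_simps(1) lev single_set_E single_set_D c lev_X fun_eq_iff restrict_def)
qed

definition stable_hom where
  "stable_hom X d e c X' d' e' c' = {f \<in> X \<rightarrow>\<^sub>E X'.
     (\<forall>i \<ge> 1. \<forall>\<alpha>. \<forall>x \<in> X. f (d i \<alpha> x) = d' i \<alpha> (f x)) \<and>
     (\<forall>i \<ge> 1. \<forall>x \<in> X. f (e i x) = e' i (f x)) \<and>
     (\<forall>i \<ge> 1. \<forall>x \<in> X. \<forall>y \<in> X. d i Plus x = d i Minus y \<longrightarrow> f (c i x y) = c' i (f x) (f y))}"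

text \<open>A functor between truncations preserves last degeneracies, which are inclusions, so its
  components agree on common cells and glue to one map. Conversely, commuting with the
  \<open>e i\<close> makes a map preserve levels.\<close>

lemma bij_betw_stable_hom_cub_hom:
  assumes "stable_cubical X d e c" "stable_cubical X' d' e' c'"
  shows "bij_betw (\<lambda>f n. restrict f (level X e n)) (stable_hom X d e c X' d' e' c')
    (cub_hom (truncations X d e c) (truncations X' d' e' c'))"
    (is "bij_betw ?R ?H ?H'")
proof -
  interpret A: stable_cubical X d e c by fact
  interpret B: stable_cubical X' d' e' c' by fact
  have into: "?R f \<in> ?H'" if "f \<in> ?H" for f
  proof -
    have f: "f \<in> X \<rightarrow>\<^sub>E X'" "\<And>i \<alpha> x. 1 \<le> i \<Longrightarrow> x \<in> X \<Longrightarrow> f (d i \<alpha> x) = d' i \<alpha> (f x)"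
      "\<And>i x. 1 \<le> i \<Longrightarrow> x \<in> X \<Longrightarrow> f (e i x) = e' i (f x)"
      "\<And>i x y. 1 \<le> i \<Longrightarrow> x \<in> X \<Longrightarrow> y \<in> X \<Longrightarrow> d i Plus x = d i Minus y \<Longrightarrow> f (c i x y) = c' i (f x) (f y)"
      using that by (auto simp: stable_hom_def)
    have fl: "f x \<in> B.lev n" if "x \<in> A.lev n" for n x
      using that f(1) by (auto simp: A.lev_iff B.lev_iff simp flip: f(3))
    show ?thesis
      unfolding cub_hom_def
    proof (intro CollectI conjI allI impI ballI; (elim conjE)?)
      fix n show "?R f n \<in> ncells (truncations X d e c) n \<rightarrow>\<^sub>E ncells (truncations X' d' e' c') n"
        using fl by (simp add: A.truncations_simps B.truncations_simps)
    next
      fix n i \<alpha> a assume "1 \<le> i" "i \<le> n" "a \<in> ncells (truncations X d e c) n"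
      then show "?R f (n - 1) (face (truncations X d e c) n i \<alpha> a) = face (truncations X' d' e' c') n i \<alpha> (?R f n a)"
        using fl by (simp add: A.truncations_simps B.truncations_simps A.lev_d[simplified] f A.lev_X)
    next
      fix n i a b assume *: "1 \<le> i" "i \<le> n" "star_dom (truncations X d e c) n i a b"
      then have ab: "a \<in> A.lev n" "b \<in> A.lev n" "d i Plus a = d i Minus b" by (simp_all add: A.truncations_simps)
      then have "d' i Plus (f a) = d' i Minus (f b)" using * by (simp add: A.lev_X flip: f(2))
      then show "?R f n (star (truncations X d e c) n i a b) = star (truncations X' d' e' c') n i (?R f n a) (?R f n b)"
        using fl * ab by (simp add: A.truncations_simps B.truncations_simps A.lev_c f A.lev_X)
    next
      fix n i a assume "1 \<le> i" "i \<le> n" "a \<in> ncells (truncations X d e c) (n - 1)"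
      then show "?R f n (degen (truncations X d e c) n i a) = degen (truncations X' d' e' c') n i (?R f (n - 1) a)"
        using fl by (simp add: A.truncations_simps B.truncations_simps A.lev_e[simplified] f A.lev_X)
    qed
  qed
  have ex: "\<exists>n. x \<in> A.lev n" if "x \<in> X" for x
    using A.e_fin[OF that] that by (auto simp: A.lev_iff)
  have inj: "inj_on ?R ?H"
  proof (rule inj_onI)
    fix f g assume fg: "f \<in> ?H" "g \<in> ?H" "?R f = ?R g"
    show "f = g"
    proof (rule PiE_ext[of f X "\<lambda>_. X'" g])
      fix x assume "x \<in> X"
      then obtain n where "x \<in> A.lev n" using ex by blast
      then show "f x = g x" using fun_cong[OF fun_cong[OF fg(3), of n], of x] by simp
    qed (use fg in \<open>auto simp: stable_hom_def\<close>)
  qed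
  have surj: "\<exists>f \<in> ?H. ?R f = F" if F: "F \<in> ?H'" for F
  proof -
    have F1: "F n \<in> A.lev n \<rightarrow>\<^sub>E B.lev n" for n
      using F unfolding cub_hom_def by (simp add: A.truncations_simps B.truncations_simps)
    have F1': "F n a \<in> B.lev n" if "a \<in> A.lev n" for n a using F1 that by blast
    have F2: "F (n - 1) (d i \<alpha> a) = d' i \<alpha> (F n a)" if "1 \<le> i" "i \<le> n" "a \<in> A.lev n" for n i \<alpha> a
    proof -
      have "F (n - 1) (face (truncations X d e c) n i \<alpha> a) = face (truncations X' d' e' c') n i \<alpha> (F n a)"
        using F that unfolding cub_hom_def by (simp add: A.truncations_simps)
      then show ?thesis using that by (simp add: A.truncations_simps B.truncations_simps F1')
    qed
    have F3: "F n (c i a b) = c' i (F n a) (F n b)"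
      if "1 \<le> i" "i \<le> n" "a \<in> A.lev n" "b \<in> A.lev n" "d i Plus a = d i Minus b" for n i a b
    proof -
      have "star_dom (truncations X d e c) n i a b" using that by (simp add: A.truncations_simps)
      then have "F n (star (truncations X d e c) n i a b) = star (truncations X' d' e' c') n i (F n a) (F n b)"
        using F that unfolding cub_hom_def by blast
      moreover have "d' i Plus (F n a) = d' i Minus (F n b)" using that by (simp flip: F2)
      ultimately show ?thesis using that by (simp add: A.truncations_simps B.truncations_simps F1')
    qed
    have F4: "F n (e i a) = e' i (F (n - 1) a)" if "1 \<le> i" "i \<le> n" "a \<in> A.lev (n - 1)" for n i a
    proof -
      have "F n (degen (truncations X d e c) n i a) = degen (truncations X' d' e' c') n i (F (n - 1) a)"
        using F that unfolding cub_hom_def by (simp add: A.truncations_simps)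
      then show ?thesis using that F1'[of a "n - 1"] by (simp add: A.truncations_simps B.truncations_simps)
    qed
    \<comment> \<open>The degeneracy \<open>e (Suc n)\<close> is the identity on level
      \<open>n\<close>, in source and target alike; commuting with it says that
      \<open>F (Suc n)\<close> extends \<open>F n\<close>.\<close>
    have step: "F (Suc n) x = F n x" if "x \<in> A.lev n" for n x
      using F4[of "Suc n" "Suc n" x] F1'[OF that] that by (simp add: A.lev_iff B.lev_iff)
    have mono: "x \<in> A.lev n" if "x \<in> A.lev m" "m \<le> n" for m n x
      using that by (auto simp: A.lev_iff)
    have F_mono: "F n x = F m x" if "x \<in> A.lev m" "m \<le> n" for m n x
      using that(2) by (induction rule: dec_induct) (use that(1) mono step in simp_all)
    \<comment> \<open>The least level of \<open>x\<close> serves as a canonical choice;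
      \<open>F_mono\<close> shows that any other level containing \<open>x\<close> gives the same
      value.\<close>
    define f where "f = restrict (\<lambda>x. F (LEAST n. x \<in> A.lev n) x) X"
    have f_eq: "f x = F n x" if "x \<in> A.lev n" for n x
      unfolding f_def using that F_mono[of x "LEAST n. x \<in> A.lev n" n]
      by (simp add: A.lev_X LeastI[of "\<lambda>n. x \<in> A.lev n"] Least_le)
    have ex_ge: "\<exists>n \<ge> i. x \<in> A.lev n" if "x \<in> X" for x i
      using ex[OF that] mono by (meson linorder_le_cases order_refl)
    have ex2: "\<exists>n \<ge> i. x \<in> A.lev n \<and> y \<in> A.lev n" if "x \<in> X" "y \<in> X" for x y i
      using ex_ge[OF that(1), of i] ex_ge[OF that(2)] mono by (meson order_trans)
    have "f \<in> ?H"
      unfolding stable_hom_def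
    proof (intro CollectI conjI allI impI ballI)
      show "f \<in> X \<rightarrow>\<^sub>E X'"
      proof (rule PiE_I)
        fix x assume "x \<in> X"
        then obtain n where "x \<in> A.lev n" using ex by blast
        then show "f x \<in> X'" using f_eq F1' B.lev_X by metis
      qed (simp add: f_def)
    next
      fix i :: nat and \<alpha> x assume "1 \<le> i" "x \<in> X"
      then obtain n where "n \<ge> i" "x \<in> A.lev n" using ex_ge by blast
      then show "f (d i \<alpha> x) = d' i \<alpha> (f x)"
        using \<open>1 \<le> i\<close> F2[of i n x \<alpha>] A.lev_d[of x n i \<alpha>] f_eq[of "d i \<alpha> x" "n - 1"] by (simp add: f_eq[of x n])
    next
      fix i :: nat and x assume "1 \<le> i" "x \<in> X"
      then obtain n where "n \<ge> i" "x \<in> A.lev n" using ex_ge by blast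
      then show "f (e i x) = e' i (f x)"
        using \<open>1 \<le> i\<close> F4[of i "Suc n" x] A.lev_e[of x "Suc n" i] f_eq[of "e i x" "Suc n"] by (simp add: f_eq[of x n])
    next
      fix i :: nat and x y assume "1 \<le> i" "x \<in> X" "y \<in> X" "d i Plus x = d i Minus y"
      moreover then obtain n where "n \<ge> i" "x \<in> A.lev n" "y \<in> A.lev n" using ex2 by blast
      ultimately show "f (c i x y) = c' i (f x) (f y)"
        by (simp add: f_eq[of _ n] A.lev_c F3)
    qed
    moreover have "?R f = F"
    proof
      fix n show "?R f n = F n"
        by (rule extensionalityI[of _ "A.lev n"]) (use F1[of n] in \<open>auto simp: f_eq PiE_def\<close>)
    qed
    ultimately show ?thesis by blast
  qed
  show ?thesis
    unfolding bij_betw_def using into inj surj by (auto simp: image_iff)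
qed

text \<open>A map preserving symmetries preserves their inverses on fixed cells, hence
  \<open>E\<close> by its recursion, and then \<open>D\<close> by injectivity of \<open>E\<close>.
  In the other direction, boundaries are \<open>E\<close> after \<open>D\<close>, and symmetries are
  determined by \<open>E\<close>.\<close>

lemma sin_hom_eq_stable_hom:
  assumes "single_set_cubical_omega_category T" "single_set_cubical_omega_category U"
  shows "sin_hom T U = stable_hom (cells T) (single_set_cubical_omega_category.D T)
      (single_set_cubical_omega_category.E T) (circ T)
    (cells U) (single_set_cubical_omega_category.D U) (single_set_cubical_omega_category.E U) (circ U)"
proof -
  interpret A: single_set_cubical_omega_category T by fact
  interpret B: single_set_cubical_omega_category U by fact
  show ?thesis
  proof (intro equalityI subsetI)
    fix f assume "f \<in> sin_hom T U"
    then have f: "f \<in> cells T \<rightarrow>\<^sub>E cells U"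
      "\<And>i \<alpha> x. \<lbrakk>i \<ge> 1; x \<in> cells T\<rbrakk> \<Longrightarrow> f (bd T i \<alpha> x) = bd U i \<alpha> (f x)"
      "\<And>i x y. \<lbrakk>i \<ge> 1; x \<in> cells T; y \<in> cells T; composable T i x y\<rbrakk> \<Longrightarrow> f (circ T i x y) = circ U i (f x) (f y)"
      "\<And>i x. \<lbrakk>i \<ge> 1; x \<in> fix_cells T i\<rbrakk> \<Longrightarrow> f (sy T i x) = sy U i (f x)"
      by (auto simp: sin_hom_def)
    have fc: "f x \<in> cells U" if "x \<in> cells T" for x using f(1) that by blast
    have ffx: "f x \<in> fix_cells U i" if "i \<ge> 1" "x \<in> fix_cells T i" for x i
      using that fc f(2)[of i x Minus] by (simp add: A.fx_iff[of i x Minus] B.fx_iff[of i "f x" Minus])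
    have flv: "f x \<in> B.lv n" if "x \<in> A.lv n" for x n
      using that ffx fc by (auto simp: A.lv_def B.lv_def)
    have frsy: "f (rsy T i y) = rsy U i (f y)" if "i \<ge> 1" "y \<in> fix_cells T (Suc i)" for i y
      using that f(4)[of i "rsy T i y"]
      by (intro B.rsy_eqI[symmetric]) (simp_all add: A.rsy_fx ffx A.sy_rsy)
    have fE: "f (A.E i x) = B.E i (f x)" if i: "i \<ge> 1" and x: "x \<in> cells T" for i x
    proof -
      obtain n where n: "x \<in> A.lv n" using A.lv_ex x by blast
      show ?thesis using i
      proof (induction rule: A.downward_induct[of _ n])
        case (base i)
        then show ?case using n flv by (simp add: A.E_base B.E_base)
      next
        case (step i)
        then show ?case using x fc by (simp add: A.E_step[of i] B.E_step[of i] frsy A.E_fx)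
      qed
    qed
    have fD: "f (A.D i \<alpha> x) = B.D i \<alpha> (f x)" if "i \<ge> 1" "x \<in> cells T" for i \<alpha> x
      using that by (intro B.D_eqI[symmetric]) (simp_all add: fc A.D_closed A.E_D f(2) flip: fE)
    show "f \<in> stable_hom (cells T) A.D A.E (circ T) (cells U) B.D B.E (circ U)"
      unfolding stable_hom_def using f(1) fE fD f(3) by (auto simp: A.composable_iff A.D_iff)
  next
    fix f assume "f \<in> stable_hom (cells T) A.D A.E (circ T) (cells U) B.D B.E (circ U)"
    then have f: "f \<in> cells T \<rightarrow>\<^sub>E cells U"
      "\<And>i \<alpha> x. \<lbrakk>i \<ge> 1; x \<in> cells T\<rbrakk> \<Longrightarrow> f (A.D i \<alpha> x) = B.D i \<alpha> (f x)"
      "\<And>i x. \<lbrakk>i \<ge> 1; x \<in> cells T\<rbrakk> \<Longrightarrow> f (A.E i x) = B.E i (f x)"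
      "\<And>i x y. \<lbrakk>i \<ge> 1; x \<in> cells T; y \<in> cells T; A.D i Plus x = A.D i Minus y\<rbrakk> \<Longrightarrow> f (circ T i x y) = circ U i (f x) (f y)"
      by (auto simp: stable_hom_def)
    have fc: "f x \<in> cells U" if "x \<in> cells T" for x using f(1) that by blast
    have fbd: "f (bd T i \<alpha> x) = bd U i \<alpha> (f x)" if "i \<ge> 1" "x \<in> cells T" for i \<alpha> x
      using that by (simp add: f(2,3) A.D_closed fc B.E_D flip: A.E_D)
    have fsy: "f (sy T i x) = sy U i (f x)" if ix: "i \<ge> 1" "x \<in> fix_cells T i" for i x
    proof -
      \<comment> \<open>Every fixed cell is a degeneracy \<open>E i u\<close>, and
        \<open>E_step\<close> read backwards gives \<open>sy\<close> of it as
        \<open>E (Suc i) u\<close>; this expresses \<open>sy\<close> through \<open>E\<close>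
        alone.\<close>
      obtain u where u: "u \<in> cells T" "x = A.E i u" using A.E_surj[OF ix] by blast
      have "sy T i x = A.E (Suc i) u"
        using ix u A.sy_rsy[of i "A.E (Suc i) u"] by (simp add: A.E_step[of i] A.E_fx)
      moreover have "sy U i (B.E i (f u)) = B.E (Suc i) (f u)"
        using ix u fc B.sy_rsy[of i "B.E (Suc i) (f u)"] by (simp add: B.E_step[of i] B.E_fx)
      ultimately show ?thesis using ix u by (simp add: f(3))
    qed
    show "f \<in> sin_hom T U"
      unfolding sin_hom_def using f(1,4) fbd fsy by (auto simp: A.composable_iff A.D_iff)
  qed
qed

lemma bij_betw_sin_hom_cub_hom:
  assumes "single_set_cubical_omega_category T" "single_set_cubical_omega_category U"
  shows "bij_betw (\<lambda>f n. restrict f (ncells (classical_of T) n)) (sin_hom T U)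
    (cub_hom (classical_of T) (classical_of U))"
proof -
  have "ncells (classical_of T) = level (cells T) (single_set_cubical_omega_category.E T)"
    by (simp add: classical_of_def truncations_def)
  then show ?thesis
    unfolding sin_hom_eq_stable_hom[OF assms] classical_of_def[of T] classical_of_def[of U]
    using bij_betw_stable_hom_cub_hom[OF assms(1)[THEN single_set_cubical_omega_category.stable]
      assms(2)[THEN single_set_cubical_omega_category.stable]] by (simp add: truncations_def)
qed

section \<open>The two categories\<close>

lemma category_SinCat: "category (SinCat :: ('a sincub, 'a \<Rightarrow> 'a) cat)"
proof
  fix A B D :: "'a sincub" and f g
  assume "A \<in> Obj SinCat" "B \<in> Obj SinCat" "D \<in> Obj SinCat" and fg: "f \<in> Hom SinCat A B" "g \<in> Hom SinCat B D"
  then interpret A: single_set_cubical_omega_category A + B: single_set_cubical_omega_category B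
    by (simp_all add: SinCat_def)
  have f: "f \<in> cells A \<rightarrow>\<^sub>E cells B" "f \<in> sin_hom A B" and g: "g \<in> sin_hom B D"
    using fg by (auto simp: SinCat_def sin_hom_def)
  have fc: "f x \<in> cells B" if "x \<in> cells A" for x using f that by blast
  have bd: "f (bd A i \<alpha> x) = bd B i \<alpha> (f x)" if "i \<ge> 1" "x \<in> cells A" for i \<alpha> x
    using f that by (auto simp: sin_hom_def)
  \<comment> \<open>Preservation of composites can be applied to \<open>g\<close> only once
    \<open>f x\<close> and \<open>f y\<close> are composable; this holds because composability is an
    equality of boundaries, which \<open>f\<close> preserves.\<close>
  have cp: "composable B i (f x) (f y)" "circ A i x y \<in> cells A"
    if "i \<ge> 1" "x \<in> cells A" "y \<in> cells A" "composable A i x y" for i x y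
    using that fc bd[of i x Plus] bd[of i y Minus]
    by (simp_all add: A.composable_iff B.composable_iff A.circ_closed)
  have fx: "f x \<in> fix_cells B i" "sy A i x \<in> cells A" if "i \<ge> 1" "x \<in> fix_cells A i" for i x
    using that fc bd[of i x Minus] A.fxD[OF A.sy_fx, of i x] by (auto simp: fix_cells_def)
  show "Comp SinCat A B D g f \<in> Hom SinCat A D"
    using f g unfolding SinCat_def sin_hom_def
    by (auto simp: compose_def A.\<delta>_closed cp fx fc A.fxD)
next
  fix A B D E :: "'a sincub" and f g h
  assume "f \<in> Hom SinCat A B" "g \<in> Hom SinCat B D" "h \<in> Hom SinCat D E"
  then show "Comp SinCat A D E h (Comp SinCat A B D g f) = Comp SinCat A B E (Comp SinCat B D E h g) f"
    by (auto simp: SinCat_def sin_hom_def compose_def fun_eq_iff)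
next
  fix A :: "'a sincub" assume "A \<in> Obj SinCat"
  then interpret A: single_set_cubical_omega_category A by (simp add: SinCat_def)
  show "Ident SinCat A \<in> Hom SinCat A A"
    by (auto simp: SinCat_def sin_hom_def A.\<delta>_closed A.composable_iff A.circ_closed A.fxD A.fxD[OF A.sy_fx])
next
  fix A B :: "'a sincub" and f assume "A \<in> Obj SinCat" "B \<in> Obj SinCat" "f \<in> Hom SinCat A B"
  then show "Comp SinCat A A B f (Ident SinCat A) = f" "Comp SinCat A B B (Ident SinCat B) f = f"
    by (auto simp: SinCat_def sin_hom_def compose_def fun_eq_iff extensional_def PiE_def)
qed

lemma category_CubCat: "category (CubCat :: ('a cubcat, nat \<Rightarrow> 'a \<Rightarrow> 'a) cat)"
proof
  fix A B D :: "'a cubcat" and f g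
  assume "A \<in> Obj CubCat" "B \<in> Obj CubCat" "D \<in> Obj CubCat" and fg: "f \<in> Hom CubCat A B" "g \<in> Hom CubCat B D"
  then interpret A: classical_cubical_omega_category A + B: classical_cubical_omega_category B
    by (simp_all add: CubCat_def)
  have f: "f n \<in> ncells A n \<rightarrow>\<^sub>E ncells B n" "f \<in> cub_hom A B" and g: "g n \<in> ncells B n \<rightarrow>\<^sub>E ncells D n" "g \<in> cub_hom B D" for n
    using fg by (auto simp: CubCat_def cub_hom_def)
  have fc: "f n x \<in> ncells B n" if "x \<in> ncells A n" for x n using f(1)[of n] that by blast
  have face: "f (n - 1) (face A n i \<alpha> x) = face B n i \<alpha> (f n x)" "face A n i \<alpha> x \<in> ncells A (n - 1)"
    if "1 \<le> i" "i \<le> n" "x \<in> ncells A n" for i n \<alpha> x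
    using f that A.face_type[of i n \<alpha>] by (auto simp: cub_hom_def)
  have dom: "star_dom B n i (f n x) (f n y)" "star A n i x y \<in> ncells A n"
    if "1 \<le> i" "i \<le> n" "star_dom A n i x y" for i n x y
    using that fc face(1)[of i n x Plus] face(1)[of i n y Minus] A.star_closed[of i n x y]
    by (auto simp: star_dom_def)
  have degen: "degen A n i x \<in> ncells A n" if "1 \<le> i" "i \<le> n" "x \<in> ncells A (n - 1)" for i n x
    using that A.degen_type[of i n] by blast
  show "Comp CubCat A B D g f \<in> Hom CubCat A D"
    unfolding CubCat_def cub_hom_def cat.simps
  proof (intro CollectI conjI allI impI ballI; (elim conjE)?)
    fix n show "compose (ncells A n) (g n) (f n) \<in> ncells A n \<rightarrow>\<^sub>E ncells D n"
      using fc g(1) by (auto simp: compose_def)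
  next
    fix n i \<alpha> a assume "1 \<le> i" "i \<le> n" "a \<in> ncells A n"
    then show "compose (ncells A (n - 1)) (g (n - 1)) (f (n - 1)) (face A n i \<alpha> a) =
      face D n i \<alpha> (compose (ncells A n) (g n) (f n) a)"
      using g(2) face[of i n a \<alpha>] fc[of a n] by (simp add: compose_def cub_hom_def)
  next
    fix n i a b assume *: "1 \<le> i" "i \<le> n" "star_dom A n i a b"
    then have "f n (star A n i a b) = star B n i (f n a) (f n b)" using f(2) by (auto simp: cub_hom_def)
    moreover have "a \<in> ncells A n" "b \<in> ncells A n" using * by (auto simp: star_dom_def)
    ultimately show "compose (ncells A n) (g n) (f n) (star A n i a b) =
      star D n i (compose (ncells A n) (g n) (f n) a) (compose (ncells A n) (g n) (f n) b)"
      using g(2) dom[OF *] * by (simp add: compose_def cub_hom_def)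
  next
    fix n i a assume *: "1 \<le> i" "i \<le> n" "a \<in> ncells A (n - 1)"
    then have "f n (degen A n i a) = degen B n i (f (n - 1) a)" using f(2) by (auto simp: cub_hom_def)
    then show "compose (ncells A n) (g n) (f n) (degen A n i a) =
      degen D n i (compose (ncells A (n - 1)) (g (n - 1)) (f (n - 1)) a)"
      using g(2) degen[OF *] fc[OF *(3)] * by (simp add: compose_def cub_hom_def)
  qed
next
  fix A B D E :: "'a cubcat" and f g h
  assume "f \<in> Hom CubCat A B" "g \<in> Hom CubCat B D" "h \<in> Hom CubCat D E"
  then have "f n \<in> ncells A n \<rightarrow>\<^sub>E ncells B n" for n by (simp add: CubCat_def cub_hom_def)
  then have "f n x \<in> ncells B n" if "x \<in> ncells A n" for n x using that by blast
  then show "Comp CubCat A D E h (Comp CubCat A B D g f) = Comp CubCat A B E (Comp CubCat B D E h g) f"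
    by (auto simp: CubCat_def compose_def fun_eq_iff)
next
  fix A :: "'a cubcat" assume "A \<in> Obj CubCat"
  then interpret A: classical_cubical_omega_category A by (simp add: CubCat_def)
  have F: "face A n i \<alpha> x \<in> ncells A (n - 1)" if "1 \<le> i" "i \<le> n" "x \<in> ncells A n" for i n \<alpha> x
    using that A.face_type[of i n \<alpha>] by blast
  have D: "degen A n i x \<in> ncells A n" if "1 \<le> i" "i \<le> n" "x \<in> ncells A (n - 1)" for i n x
    using that A.degen_type[of i n] by blast
  have S: "a \<in> ncells A n \<and> b \<in> ncells A n" if "star_dom A n i a b" for n i a b
    using that by (simp add: star_dom_def)
  show "Ident CubCat A \<in> Hom CubCat A A"
    using F[simplified] D[simplified] by (auto simp: CubCat_def cub_hom_def A.star_closed dest: S)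
next
  fix A B :: "'a cubcat" and f assume "A \<in> Obj CubCat" "B \<in> Obj CubCat" and f: "f \<in> Hom CubCat A B"
  from f have "f n \<in> ncells A n \<rightarrow>\<^sub>E ncells B n" for n by (simp add: CubCat_def cub_hom_def)
  then have "x \<in> ncells A n \<Longrightarrow> f n x \<in> ncells B n" "x \<notin> ncells A n \<Longrightarrow> f n x = undefined" for n x
    by (blast, metis PiE_arb)
  then show "Comp CubCat A A B f (Ident CubCat A) = f" "Comp CubCat A B B (Ident CubCat B) f = f"
    by (auto simp: CubCat_def compose_def fun_eq_iff)
qed

section \<open>Strictification\<close>

definition transport :: "'a cubcat \<Rightarrow> (nat \<Rightarrow> 'a \<Rightarrow> 'a) \<Rightarrow> 'a cubcat" where
  "transport C \<iota> = (let p = (\<lambda>n. inv_into (ncells C n) (\<iota> n)) in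
    \<lparr>ncells = (\<lambda>n. \<iota> n ` ncells C n),
     face = (\<lambda>n i. if 1 \<le> i \<and> i \<le> n
       then (\<lambda>\<alpha>. restrict (\<lambda>x. \<iota> (n - 1) (face C n i \<alpha> (p n x))) (\<iota> n ` ncells C n)) else undefined),
     degen = (\<lambda>n i. if 1 \<le> i \<and> i \<le> n
       then restrict (\<lambda>x. \<iota> n (degen C n i (p (n - 1) x))) (\<iota> (n - 1) ` ncells C (n - 1)) else undefined),
     star = (\<lambda>n i. if 1 \<le> i \<and> i \<le> n
       then (\<lambda>x y. if x \<in> \<iota> n ` ncells C n \<and> y \<in> \<iota> n ` ncells C n \<and> star_dom C n i (p n x) (p n y)
         then \<iota> n (star C n i (p n x) (p n y)) else undefined) else undefined)\<rparr>)"

text \<open>Injectivity is required separately on each level: images of different levels must be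
  allowed to overlap, since last degeneracies are to become inclusions.\<close>

locale transported = classical_cubical_omega_category C for C :: "'a cubcat" +
  fixes \<iota> :: "nat \<Rightarrow> 'a \<Rightarrow> 'a"
  assumes inj: "inj_on (\<iota> n) (ncells C n)"
begin

abbreviation "C' \<equiv> transport C \<iota>"

lemma face_in: "\<lbrakk>1 \<le> i; i \<le> n; a \<in> ncells C n\<rbrakk> \<Longrightarrow> face C n i \<alpha> a \<in> ncells C (n - 1)"
  using face_type by blast

lemma degen_in: "\<lbrakk>1 \<le> i; i \<le> n; a \<in> ncells C (n - 1)\<rbrakk> \<Longrightarrow> degen C n i a \<in> ncells C n"
  using degen_type by blast

lemma ncells': "ncells C' n = \<iota> n ` ncells C n"
  by (simp add: transport_def Let_def)

lemma inv_\<iota>: "a \<in> ncells C n \<Longrightarrow> inv_into (ncells C n) (\<iota> n) (\<iota> n a) = a"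
  using inj by simp

lemma face': "\<lbrakk>1 \<le> i; i \<le> n; a \<in> ncells C n\<rbrakk> \<Longrightarrow> face C' n i \<alpha> (\<iota> n a) = \<iota> (n - 1) (face C n i \<alpha> a)"
  by (simp add: transport_def Let_def inv_\<iota>)

lemma degen': "\<lbrakk>1 \<le> i; i \<le> n; a \<in> ncells C (n - 1)\<rbrakk> \<Longrightarrow> degen C' n i (\<iota> (n - 1) a) = \<iota> n (degen C n i a)"
  by (simp add: transport_def Let_def inv_\<iota>)

lemma degen'_Suc: "\<lbrakk>1 \<le> i; i \<le> Suc n; a \<in> ncells C n\<rbrakk> \<Longrightarrow> degen C' (Suc n) i (\<iota> n a) = \<iota> (Suc n) (degen C (Suc n) i a)"
  using degen'[of i "Suc n" a] by simp

text \<open>Composability is an equality between two faces in level \<open>n - 1\<close>, and it is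
  reflected because \<open>\<iota> (n - 1)\<close> is injective on that level.\<close>

lemma star_dom'_iff: "\<lbrakk>1 \<le> i; i \<le> n; a \<in> ncells C n; b \<in> ncells C n\<rbrakk>
   \<Longrightarrow> star_dom C' n i (\<iota> n a) (\<iota> n b) \<longleftrightarrow> star_dom C n i a b"
  using inj_on_eq_iff[OF inj[of "n - 1"] face_in[of i n a Plus] face_in[of i n b Minus]]
  by (simp add: star_dom_def ncells' face')

lemma star_dom'E:
  assumes "star_dom C' n i x y" "1 \<le> i" "i \<le> n"
  obtains a b where "x = \<iota> n a" "y = \<iota> n b" "a \<in> ncells C n" "b \<in> ncells C n" "star_dom C n i a b"
proof -
  obtain a b where "x = \<iota> n a" "y = \<iota> n b" "a \<in> ncells C n" "b \<in> ncells C n"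
    using assms(1) by (auto simp: star_dom_def ncells')
  then show thesis using that assms star_dom'_iff by metis
qed

lemma star': "\<lbrakk>1 \<le> i; i \<le> n; star_dom C n i a b\<rbrakk> \<Longrightarrow> star C' n i (\<iota> n a) (\<iota> n b) = \<iota> n (star C n i a b)"
  by (simp add: transport_def Let_def inv_\<iota> star_dom_def)

lemma star'_undefined:
  assumes "1 \<le> i" "i \<le> n" "\<not> star_dom C' n i x y"
  shows "star C' n i x y = undefined"
proof (cases "x \<in> \<iota> n ` ncells C n \<and> y \<in> \<iota> n ` ncells C n")
  case True
  then obtain a b where ab: "x = \<iota> n a" "y = \<iota> n b" "a \<in> ncells C n" "b \<in> ncells C n" by blast
  then have "\<not> star_dom C n i a b" using assms by (simp add: star_dom'_iff)
  then show ?thesis using ab assms(1,2) by (simp add: transport_def Let_def inv_\<iota>)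
next
  case False
  then show ?thesis using assms by (auto simp: transport_def Let_def)
qed

lemma star_domD: "star_dom C n i a b \<Longrightarrow> a \<in> ncells C n \<and> b \<in> ncells C n"
  by (simp add: star_dom_def)

lemma classical_transport: "classical_cubical_omega_category C'"
proof
  fix i n :: nat and \<alpha> assume "1 \<le> i" "i \<le> n"
  then show "face C' n i \<alpha> \<in> ncells C' n \<rightarrow>\<^sub>E ncells C' (n - 1)" "degen C' n i \<in> ncells C' (n - 1) \<rightarrow>\<^sub>E ncells C' n"
    using face_in[simplified] degen_in[simplified] by (auto simp: transport_def Let_def inv_\<iota>)
next
  fix i n x y assume *: "1 \<le> i" "i \<le> n" "star_dom C' n i x y"
  then obtain a b where ab: "x = \<iota> n a" "y = \<iota> n b" "a \<in> ncells C n" "b \<in> ncells C n" "star_dom C n i a b"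
    by (elim star_dom'E)
  have cl: "star C n i a b \<in> ncells C n" using * ab by (simp add: star_closed)
  show "star C' n i x y \<in> ncells C' n" "face C' n i Minus (star C' n i x y) = face C' n i Minus x"
    "face C' n i Plus (star C' n i x y) = face C' n i Plus y"
    using * ab cl by (simp_all add: star' ncells' face' face_star_minus face_star_plus)
next
  fix i n x y assume "1 \<le> i" "i \<le> n" "\<not> star_dom C' n i x y"
  then show "star C' n i x y = undefined" by (rule star'_undefined)
next
  fix i n :: nat assume "\<not> (1 \<le> i \<and> i \<le> n)"
  then show "face C' n i = undefined \<and> degen C' n i = undefined \<and> star C' n i = undefined"
    by (auto simp: transport_def Let_def)
next
  fix i n x y z assume i: "1 \<le> i" "i \<le> n" and
    "star_dom C' n i y z \<and> star_dom C' n i x (star C' n i y z) \<or>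
      star_dom C' n i x y \<and> star_dom C' n i (star C' n i x y) z"
  then have "x \<in> ncells C' n \<and> y \<in> ncells C' n \<and> z \<in> ncells C' n" by (auto simp: star_dom_def)
  then obtain a b k where abk: "x = \<iota> n a" "y = \<iota> n b" "z = \<iota> n k" "a \<in> ncells C n" "b \<in> ncells C n" "k \<in> ncells C n"
    by (auto simp: ncells')
  have "star_dom C n i b k \<and> star_dom C n i a (star C n i b k) \<or>
      star_dom C n i a b \<and> star_dom C n i (star C n i a b) k" (is "?L \<or> ?R")
    using \<open>_ \<or> _\<close>
  proof
    assume *: "star_dom C' n i y z \<and> star_dom C' n i x (star C' n i y z)"
    then have bk: "star_dom C n i b k" using abk i by (simp add: star_dom'_iff)
    then have "star_dom C n i a (star C n i b k)" using abk i * by (simp add: star' star_dom'_iff star_closed)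
    with bk show ?thesis by simp
  next
    assume *: "star_dom C' n i x y \<and> star_dom C' n i (star C' n i x y) z"
    then have ab: "star_dom C n i a b" using abk i by (simp add: star_dom'_iff)
    then have "star_dom C n i (star C n i a b) k" using abk i * by (simp add: star' star_dom'_iff star_closed)
    with ab show ?thesis by simp
  qed
  \<comment> \<open>Either bracketing being defined makes both pairs and both bracketings
    composable, so all four products can be transported.\<close>
  then have "star_dom C n i a b" "star_dom C n i b k" "star_dom C n i (star C n i a b) k" "star_dom C n i a (star C n i b k)"
    and "star C n i a (star C n i b k) = star C n i (star C n i a b) k"
    using i star_assoc[of i n b k a] by (auto simp: star_dom_def star_closed face_star_minus face_star_plus)
  then show "star C' n i x (star C' n i y z) = star C' n i (star C' n i x y) z"
    using i abk by (simp add: star')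
next
  fix i n x assume i: "1 \<le> i" "i \<le> n" and "x \<in> ncells C' n"
  then obtain a where a: "x = \<iota> n a" "a \<in> ncells C n" by (auto simp: ncells')
  have f: "face C n i \<alpha> a \<in> ncells C (n - 1)" for \<alpha> using i a by (intro face_in)
  have "star_dom C n i a (degen C n i (face C n i Plus a))" "star_dom C n i (degen C n i (face C n i Minus a)) a"
    using i a f by (auto simp: star_dom_def degen_in face_degen_same)
  then show "star C' n i x (degen C' n i (face C' n i Plus x)) = x" "star C' n i (degen C' n i (face C' n i Minus x)) x = x"
    using i a f[simplified] degen'[of i n "face C n i Plus a"] degen'[of i n "face C n i Minus a"]
    by (simp_all add: face' star' star_unit_left star_unit_right)
next
  fix i j n x \<alpha> \<beta> assume i: "1 \<le> i" "i < j" "j \<le> n" and "x \<in> ncells C' n"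
  then obtain a where a: "x = \<iota> n a" "a \<in> ncells C n" by (auto simp: ncells')
  then show "face C' (n - 1) i \<alpha> (face C' n j \<beta> x) = face C' (n - 1) (j - 1) \<beta> (face C' n i \<alpha> x)"
    using i face_in[of i n a \<alpha>] face_in[of j n a \<beta>] face_face[of i j n a \<alpha> \<beta>]
      face'[of i "n - 1" "face C n j \<beta> a" \<alpha>] face'[of "j - 1" "n - 1" "face C n i \<alpha> a" \<beta>]
    by (simp add: face')
next
  fix i j n x y \<alpha> assume i: "1 \<le> i" "i < j" "j \<le> n" and "star_dom C' n j x y"
  then obtain a b where ab: "x = \<iota> n a" "y = \<iota> n b" "a \<in> ncells C n" "b \<in> ncells C n" "star_dom C n j a b"
    by (auto elim: star_dom'E)
  have "star_dom C (n - 1) (j - 1) (face C n i \<alpha> a) (face C n i \<alpha> b)"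
    using i ab face_in[of i n a \<alpha>] face_in[of i n b \<alpha>] face_face[of i j n a \<alpha> Plus] face_face[of i j n b \<alpha> Minus]
    by (simp add: star_dom_def)
  then show "face C' n i \<alpha> (star C' n j x y) = star C' (n - 1) (j - 1) (face C' n i \<alpha> x) (face C' n i \<alpha> y)"
    using i ab star'[of "j - 1" "n - 1"] star_closed[of j n a b] face_star_less[of i j n a b \<alpha>]
    by (simp add: face' star')
next
  fix i j n x y \<alpha> assume i: "1 \<le> j" "j < i" "i \<le> n" and "star_dom C' n j x y"
  then obtain a b where ab: "x = \<iota> n a" "y = \<iota> n b" "a \<in> ncells C n" "b \<in> ncells C n" "star_dom C n j a b"
    by (auto elim: star_dom'E)
  have "star_dom C (n - 1) j (face C n i \<alpha> a) (face C n i \<alpha> b)"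
    using i ab face_in[of i n a \<alpha>] face_in[of i n b \<alpha>] face_face[of j i n a Plus \<alpha>] face_face[of j i n b Minus \<alpha>]
    by (simp add: star_dom_def)
  then show "face C' n i \<alpha> (star C' n j x y) = star C' (n - 1) j (face C' n i \<alpha> x) (face C' n i \<alpha> y)"
    using i ab star'[of j "n - 1"] star_closed[of j n a b] face_star_greater[of j i n a b \<alpha>]
    by (simp add: face' star')
next
  fix i j n x y z w assume i: "1 \<le> i" "i \<le> n" "1 \<le> j" "j \<le> n" "i \<noteq> j" and
    *: "star_dom C' n i x y" "star_dom C' n i z w" "star_dom C' n j x z" "star_dom C' n j y w"
  then obtain a b k l where abkl: "x = \<iota> n a" "y = \<iota> n b" "z = \<iota> n k" "w = \<iota> n l"
    "a \<in> ncells C n" "b \<in> ncells C n" "k \<in> ncells C n" "l \<in> ncells C n"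
    unfolding star_dom_def ncells' by blast
  then have dom: "star_dom C n i a b" "star_dom C n i k l" "star_dom C n j a k" "star_dom C n j b l"
    using i * by (simp_all add: star_dom'_iff)
  have "face C n j Plus (star C n i a b) = face C n j Minus (star C n i k l)"
    using i dom face_star_less[of j i n a b Plus] face_star_less[of j i n k l Minus]
      face_star_greater[of i j n a b Plus] face_star_greater[of i j n k l Minus]
    by (cases "i < j") (simp_all add: star_dom_def)
  moreover have "face C n i Plus (star C n j a k) = face C n i Minus (star C n j b l)"
    using i dom face_star_less[of i j n a k Plus] face_star_less[of i j n b l Minus]
      face_star_greater[of j i n a k Plus] face_star_greater[of j i n b l Minus]
    by (cases "i < j") (simp_all add: star_dom_def)
  ultimately have "star_dom C n j (star C n i a b) (star C n i k l)" "star_dom C n i (star C n j a k) (star C n j b l)"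
    using i dom star_closed by (simp_all add: star_dom_def)
  then show "star C' n j (star C' n i x y) (star C' n i z w) = star C' n i (star C' n j x z) (star C' n j y w)"
    using i abkl dom by (simp add: star' star_interchange)
next
  fix i j n x \<alpha> assume i: "1 \<le> i" "i < j" "j \<le> n" and "x \<in> ncells C' (n - 1)"
  then obtain a where a: "x = \<iota> (n - 1) a" "a \<in> ncells C (n - 1)" by (auto simp: ncells')
  then show "face C' n i \<alpha> (degen C' n j x) = degen C' (n - 1) (j - 1) (face C' (n - 1) i \<alpha> x)"
    using i degen'[of j n a] degen_in[of j n a] face'[of i n "degen C n j a" \<alpha>] face_degen_less[of i j n a \<alpha>]
      face'[of i "n - 1" a \<alpha>] face_in[of i "n - 1" a \<alpha>] degen'[of "j - 1" "n - 1" "face C (n - 1) i \<alpha> a"]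
    by simp
next
  fix i n x \<alpha> assume i: "1 \<le> i" "i \<le> n" and "x \<in> ncells C' (n - 1)"
  then obtain a where a: "x = \<iota> (n - 1) a" "a \<in> ncells C (n - 1)" by (auto simp: ncells')
  then show "face C' n i \<alpha> (degen C' n i x) = x"
    using i degen'[of i n a] degen_in[of i n a] face'[of i n "degen C n i a" \<alpha>] face_degen_same[of i n a \<alpha>] by simp
next
  fix i j n x \<alpha> assume i: "1 \<le> j" "j < i" "i \<le> n" and "x \<in> ncells C' (n - 1)"
  then obtain a where a: "x = \<iota> (n - 1) a" "a \<in> ncells C (n - 1)" by (auto simp: ncells')
  then show "face C' n i \<alpha> (degen C' n j x) = degen C' (n - 1) j (face C' (n - 1) (i - 1) \<alpha> x)"
    using i degen'[of j n a] degen_in[of j n a] face'[of i n "degen C n j a" \<alpha>] face_degen_greater[of j i n a \<alpha>]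
      face'[of "i - 1" "n - 1" a \<alpha>] face_in[of "i - 1" "n - 1" a \<alpha>] degen'[of j "n - 1" "face C (n - 1) (i - 1) \<alpha> a"]
    by simp
next
  fix i j n x y assume i: "1 \<le> i" "i \<le> j" "j \<le> n" and "star_dom C' n j x y"
  then obtain a b where ab: "x = \<iota> n a" "y = \<iota> n b" "a \<in> ncells C n" "b \<in> ncells C n" "star_dom C n j a b"
    by (auto elim: star_dom'E)
  have "star_dom C (Suc n) (Suc j) (degen C (Suc n) i a) (degen C (Suc n) i b)"
    using i ab face_degen_greater[of i "Suc j" "Suc n" a Plus] face_degen_greater[of i "Suc j" "Suc n" b Minus]
    by (simp add: star_dom_def degen_in)
  then show "degen C' (n + 1) i (star C' n j x y) = star C' (n + 1) (j + 1) (degen C' (n + 1) i x) (degen C' (n + 1) i y)"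
    using i ab star_closed[of j n a b] degen_star_le[of i j n a b] by (simp add: star' degen'_Suc)
next
  fix i j n x y assume i: "1 \<le> j" "j \<le> n" "j < i" "i \<le> n + 1" and "star_dom C' n j x y"
  then obtain a b where ab: "x = \<iota> n a" "y = \<iota> n b" "a \<in> ncells C n" "b \<in> ncells C n" "star_dom C n j a b"
    by (auto elim: star_dom'E)
  have "star_dom C (Suc n) j (degen C (Suc n) i a) (degen C (Suc n) i b)"
    using i ab face_degen_less[of j i "Suc n" a Plus] face_degen_less[of j i "Suc n" b Minus]
    by (simp add: star_dom_def degen_in)
  then show "degen C' (n + 1) i (star C' n j x y) = star C' (n + 1) j (degen C' (n + 1) i x) (degen C' (n + 1) i y)"
    using i ab star_closed[of j n a b] degen_star_greater[of j n i a b] by (simp add: star' degen'_Suc)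
next
  fix i j n x assume i: "1 \<le> i" "i \<le> j" "j \<le> n" and "x \<in> ncells C' (n - 1)"
  then obtain a where a: "x = \<iota> (n - 1) a" "a \<in> ncells C (n - 1)" by (auto simp: ncells')
  then show "degen C' (n + 1) i (degen C' n j x) = degen C' (n + 1) (j + 1) (degen C' n i x)"
    using i degen'[of j n a] degen'[of i n a] degen_in[of j n a] degen_in[of i n a] degen_degen[of i j n a]
    by (simp add: degen'_Suc)
qed

lemma transport_iso:
  "is_iso CubCat C' C (\<lambda>n. restrict (inv_into (ncells C n) (\<iota> n)) (ncells C' n))"
proof -
  let ?p = "\<lambda>n. restrict (inv_into (ncells C n) (\<iota> n)) (ncells C' n)"
  let ?f = "\<lambda>n. restrict (\<iota> n) (ncells C n)"
  have p: "?p n (\<iota> n a) = a" if "a \<in> ncells C n" for n a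
    using that by (simp add: ncells' inv_\<iota>)
  have "?p \<in> cub_hom C' C"
    unfolding cub_hom_def
  proof (intro CollectI conjI allI impI ballI; (elim conjE)?)
    fix n show "?p n \<in> ncells C' n \<rightarrow>\<^sub>E ncells C n" by (auto simp: ncells' inv_\<iota>)
  next
    fix n i \<alpha> x assume i: "1 \<le> i" "i \<le> n" and "x \<in> ncells C' n"
    then obtain a where a: "x = \<iota> n a" "a \<in> ncells C n" by (auto simp: ncells')
    show "?p (n - 1) (face C' n i \<alpha> x) = face C n i \<alpha> (?p n x)"
      using p[OF face_in[OF i a(2)]] p[OF a(2)] i a by (simp add: face')
  next
    fix n i x y assume i: "1 \<le> i" "i \<le> n" and "star_dom C' n i x y"
    then obtain a b where ab: "x = \<iota> n a" "y = \<iota> n b" "a \<in> ncells C n" "b \<in> ncells C n" "star_dom C n i a b"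
      by (elim star_dom'E)
    show "?p n (star C' n i x y) = star C n i (?p n x) (?p n y)"
      using p[OF star_closed[OF i ab(5)]] p[OF ab(3)] p[OF ab(4)] i ab by (simp add: star')
  next
    fix n i x assume i: "1 \<le> i" "i \<le> n" and "x \<in> ncells C' (n - 1)"
    then obtain a where a: "x = \<iota> (n - 1) a" "a \<in> ncells C (n - 1)" by (auto simp: ncells')
    show "?p n (degen C' n i x) = degen C n i (?p (n - 1) x)"
      using p[OF degen_in[OF i a(2)]] p[OF a(2)] degen'[OF i a(2)] i a by simp
  qed
  moreover have "?f \<in> cub_hom C C'"
    unfolding cub_hom_def
  proof (intro CollectI conjI allI impI ballI; (elim conjE)?)
    fix n show "?f n \<in> ncells C n \<rightarrow>\<^sub>E ncells C' n" by (auto simp: ncells')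
  next
    fix n i \<alpha> a assume "1 \<le> i" "i \<le> n" "a \<in> ncells C n"
    then show "?f (n - 1) (face C n i \<alpha> a) = face C' n i \<alpha> (?f n a)"
      using face_in[of i n a \<alpha>] by (simp add: face')
  next
    fix n i a b assume "1 \<le> i" "i \<le> n" "star_dom C n i a b"
    then show "?f n (star C n i a b) = star C' n i (?f n a) (?f n b)"
      using star_closed[of i n a b] star_domD[of n i a b] by (simp add: star')
  next
    fix n i a assume "1 \<le> i" "i \<le> n" "a \<in> ncells C (n - 1)"
    then show "?f n (degen C n i a) = degen C' n i (?f (n - 1) a)"
      using degen_in[of i n a] degen'[of i n a] by simp
  qed
  moreover have "(\<lambda>n. compose (ncells C' n) (?f n) (?p n)) = (\<lambda>n. restrict (\<lambda>a. a) (ncells C' n))"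
    by (auto simp: fun_eq_iff compose_def ncells' inv_\<iota>)
  moreover have "(\<lambda>n. compose (ncells C n) (?p n) (?f n)) = (\<lambda>n. restrict (\<lambda>a. a) (ncells C n))"
    by (auto simp: fun_eq_iff compose_def ncells' inv_\<iota>)
  ultimately show ?thesis
    unfolding is_iso_def CubCat_def cat.simps by (intro conjI bexI[of _ ?f])
qed

end

text \<open>Identifies each degenerate cell \<open>\<epsilon>\<^sub>n\<^sub>,\<^sub>n a\<close> with \<open>a\<close>; the other cells of \<open>C\<^sub>n\<close> get fresh names \<open>enc (n, a)\<close>.\<close>

primrec rename :: "(nat \<times> 'a \<Rightarrow> 'a) \<Rightarrow> 'a cubcat \<Rightarrow> nat \<Rightarrow> 'a \<Rightarrow> 'a" where
  "rename enc C 0 a = enc (0, a)"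
| "rename enc C (Suc n) a =
    (if a \<in> degen C (Suc n) (Suc n) ` ncells C n then rename enc C n (face C (Suc n) (Suc n) Minus a)
     else enc (Suc n, a))"

text \<open>The tag in a name never exceeds the level of the cell, so a fresh name tagged
  \<open>Suc n\<close> cannot collide with a name inherited from level \<open>n\<close>.\<close>

lemma rename_range: "\<exists>m \<le> n. \<exists>b. rename enc C n a = enc (m, b)"
proof (induction n arbitrary: a)
  case (Suc n)
  then obtain m b where "m \<le> n" "rename enc C n (face C (Suc n) (Suc n) Minus a) = enc (m, b)" by blast
  then show ?case by (cases "a \<in> degen C (Suc n) (Suc n) ` ncells C n") (auto intro: le_SucI)
qed auto

text \<open>Two degenerate cells are compared through the cells they come from, which the face
  recovers; two others through \<open>enc\<close>. A mixed pair has different tags by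
  \<open>rename_range\<close>.\<close>

lemma (in classical_cubical_omega_category) rename_inj:
  assumes enc: "inj enc"
  shows "inj_on (rename enc C n) (ncells C n)"
proof (induction n)
  case 0
  show ?case using enc by (auto simp: inj_on_def)
next
  case (Suc n)
  let ?E = "degen C (Suc n) (Suc n)"
  have ne: "rename enc C n a \<noteq> enc (Suc n, b)" for a b
    using rename_range[of n enc C a] inj_eq[OF enc] by auto
  show ?case
  proof (rule inj_onI)
    fix a b assume eq: "rename enc C (Suc n) a = rename enc C (Suc n) b"
    show "a = b"
    proof (cases "a \<in> ?E ` ncells C n \<and> b \<in> ?E ` ncells C n")
      case True
      then obtain a' b' where "a = ?E a'" "b = ?E b'" "a' \<in> ncells C n" "b' \<in> ncells C n" by blast
      moreover from this have "rename enc C n a' = rename enc C n b'"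
        using eq face_degen_same[of "Suc n" "Suc n"] by simp
      ultimately show ?thesis using inj_onD[OF Suc.IH] by blast
    next
      case False
      then show ?thesis using eq by (auto simp: ne ne[symmetric] inj_eq[OF enc] simp del: rename.simps(1) split: if_splits)
    qed
  qed
qed

text \<open>The last degeneracy of \<open>a\<close> is named by applying the previous renaming to
  its last face, which is \<open>a\<close> again; the transported degeneracy therefore leaves the
  name unchanged.\<close>

lemma (in classical_cubical_omega_category) strict_transport_rename:
  assumes enc: "inj enc"
  shows "strict_cubical (transport C (rename enc C))"
proof -
  interpret t: transported C "rename enc C" by unfold_locales (rule rename_inj[OF enc])
  show ?thesis
  proof (intro strict_cubical.intro strict_cubical_axioms.intro t.classical_transport)
    fix x n assume "x \<in> ncells t.C' n"
    then obtain a where "x = rename enc C n a" "a \<in> ncells C n" by (auto simp: t.ncells')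
    then show "degen t.C' (Suc n) (Suc n) x = x"
      using face_degen_same[of "Suc n" "Suc n" a Minus] by (simp add: t.degen'_Suc)
  qed
qed

lemma infinite_UNIV_inj_nat_prod:
  includes cardinal_syntax
  assumes "infinite (UNIV :: 'a set)"
  shows "\<exists>enc :: nat \<times> 'a \<Rightarrow> 'a. inj enc"
proof -
  have "|UNIV :: nat set| \<le>o |UNIV :: 'a set|"
    using assms by (simp add: infinite_iff_card_of_nat)
  then have "|(UNIV :: nat set) \<times> (UNIV :: 'a set)| =o |UNIV :: 'a set|"
    using assms by (intro card_of_Times_infinite[THEN conjunct2]) auto
  then have "|(UNIV :: nat set) \<times> (UNIV :: 'a set)| \<le>o |UNIV :: 'a set|"
    by (rule ordIso_imp_ordLeq)
  then show ?thesis
    by (auto simp flip: card_of_ordLeq)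
qed

theorem theorem3p2p1:
  assumes "infinite (UNIV :: 'a set)"
  shows "equivalent_categories (SinCat :: ('a sincub, 'a \<Rightarrow> 'a) cat)
           (CubCat :: ('a cubcat, nat \<Rightarrow> 'a \<Rightarrow> 'a) cat)"
proof -
  obtain enc :: "nat \<times> 'a \<Rightarrow> 'a" where enc: "inj enc"
    using infinite_UNIV_inj_nat_prod[OF assms] by blast
  define F :: "('a sincub, 'a \<Rightarrow> 'a, 'a cubcat, nat \<Rightarrow> 'a \<Rightarrow> 'a) functor_data" where
    "F = \<lparr>fobj = classical_of, fmap = (\<lambda>T U f n. restrict f (ncells (classical_of T) n))\<rparr>"
  have obj: "classical_cubical_omega_category (classical_of T)"
    if "single_set_cubical_omega_category T" for T :: "'a sincub"
    unfolding classical_of_def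
    by (intro stable_cubical.classical_truncations single_set_cubical_omega_category.stable that)
  have cells: "x \<in> cells T" if "x \<in> ncells (classical_of T) n" for T :: "'a sincub" and x n
    using that by (simp add: classical_of_def truncations_def level_def)
  have bij: "bij_betw (fmap F T U) (sin_hom T U) (cub_hom (fobj F T) (fobj F U))"
    if "single_set_cubical_omega_category T" "single_set_cubical_omega_category U" for T U :: "'a sincub"
    using bij_betw_sin_hom_cub_hom[OF that] by (simp add: F_def)
  show ?thesis
  proof (rule equivalence_if_fully_faithful_essentially_surjective[of _ _ F])
    show "is_functor SinCat CubCat F"
      unfolding is_functor_def
    proof (intro conjI ballI)
      fix T :: "'a sincub" assume "T \<in> Obj SinCat"
      then show "fobj F T \<in> Obj CubCat" by (simp add: SinCat_def CubCat_def F_def obj)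
      show "fmap F T T (Ident SinCat T) = Ident CubCat (fobj F T)"
        by (auto simp: SinCat_def CubCat_def F_def fun_eq_iff cells)
    next
      fix T U :: "'a sincub" and f assume "T \<in> Obj SinCat" "U \<in> Obj SinCat" "f \<in> Hom SinCat T U"
      then show "fmap F T U f \<in> Hom CubCat (fobj F T) (fobj F U)"
        using bij[of T U] by (auto simp: SinCat_def CubCat_def bij_betw_def)
    next
      fix T U V :: "'a sincub" and f g
      assume TU: "T \<in> Obj SinCat" "U \<in> Obj SinCat" and "V \<in> Obj SinCat"
        and f: "f \<in> Hom SinCat T U" and "g \<in> Hom SinCat U V"
      \<comment> \<open>Restriction to levels respects composition because \<open>f\<close> maps
        level \<open>n\<close> into level \<open>n\<close>; this is read off from the image of
        \<open>f\<close> being a functor.\<close>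
      have "fmap F T U f \<in> cub_hom (classical_of T) (classical_of U)"
        using TU f bij[of T U] by (auto simp: SinCat_def bij_betw_def F_def)
      then have "restrict f (ncells (classical_of T) n) \<in> ncells (classical_of T) n \<rightarrow>\<^sub>E ncells (classical_of U) n" for n
        by (simp add: cub_hom_def F_def)
      then have "f x \<in> ncells (classical_of U) n" if "x \<in> ncells (classical_of T) n" for x n
        using that by (metis PiE_mem restrict_apply')
      then show "fmap F T V (Comp SinCat T U V g f) =
        Comp CubCat (fobj F T) (fobj F U) (fobj F V) (fmap F U V g) (fmap F T U f)"
        by (auto simp: SinCat_def CubCat_def F_def fun_eq_iff compose_def cells)
    qed
    show "bij_betw (fmap F T U) (Hom SinCat T U) (Hom CubCat (fobj F T) (fobj F U))"
      if "T \<in> Obj SinCat" "U \<in> Obj SinCat" for T U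
      using that bij by (simp add: SinCat_def CubCat_def)
    fix C :: "'a cubcat" assume "C \<in> Obj CubCat"
    then interpret C: classical_cubical_omega_category C by (simp add: CubCat_def)
    interpret t: transported C "rename enc C" by unfold_locales (rule C.rename_inj[OF enc])
    interpret s: strict_cubical "transport C (rename enc C)" by (rule C.strict_transport_rename[OF enc])
    \<comment> \<open>The strict category is exactly the value of \<open>F\<close> at its single-set
      structure, so the isomorphism to \<open>C\<close> is just the inverse renaming.\<close>
    have "fobj F s.T = t.C'" by (simp add: F_def s.classical_of_single_set s.truncations_eq)
    then show "\<exists>T \<in> Obj SinCat. \<exists>f. is_iso CubCat (fobj F T) C f"
      using t.transport_iso s.single_set_cubical by (intro bexI[of _ s.T] exI) (auto simp: SinCat_def)
  qed (rule category_SinCat category_CubCat)+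
qed

end
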